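(* Let $M$ be a closed locally homogeneous 3-manifold in the Bianchi case, and let $(M,g(t))$, $t\in[0,T_+)$, be a solution to the backward Ricci flow $$\frac{\partial g}{\partial t}=2\,\mathrm{Rc}-\frac{2r}{3}g,\qquad g(0)=g_0,$$ where $T_+$ is the maximal existence time. Let $a\ge 0$ and let $\lambda(t)$ be the first eigenvalue of the operator $-\Delta+aR$ with respect to $g(t)$. If the flow $g(t)$ converges to a sub-Riemannian geometry after a proper re-scaling as $t\to T_+$, then $\lambda^+(t)\to 0$ as $t\to T_+$, where $\lambda^+(t)=\max\{\lambda(t),0\}$.
   Context: Here $\mathrm{Rc}$ is the Ricci tensor of $g(t)$, $R$ its scalar curvature, $r$ the average of the scalar curvature over $M$ (equal to $R$, since $R$ is constant in space on a locally homogeneous manifold), and $\Delta$ the Laplace–Beltrami operator of $g(t)$. $T_+\in(0,\infty]$ is the maximal forward existence time. Bianchi case: the universal cover of $(M,g_0)$ is isometric to the simply connected Lie group locally isomorphic to one of $\mathbb{R}^3$, $\mathrm{SU}(2)$, $\mathrm{SL}(2,\mathbb{R})$, the Heisenberg group, $E(1,1)$ (the group of isometries of the plane with flat Lorentz metric), $E(2)$ (the group of isometries of the Euclidean plane), endowed with a left-invariant metric. In this case there is a left-invariant frame $(X_1,X_2,X_3)$ (a Milnor frame) diagonalizing both the initial metric and the Ricci tensor, and the flow preserves the diagonal form: $g(t)=A(t)\theta^1\otimes\theta^1+B(t)\theta^2\otimes\theta^2+C(t)\theta^3\otimes\theta^3$ with $(\theta^i)$ the dual frame. First eigenvalue: the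 lowest eigenvalue of $-\Delta+aR$ on $M$, i.e. the one admitting a positive eigenfunction $u$ (normalized by $\int_M u^2\,d\mu=1$). Convergence to a sub-Riemannian geometry after a proper re-scaling: there is a positive function $\varphi(t)$ such that the distance functions of the re-scaled metrics $\varphi(t)g(t)$ converge uniformly, as $t\to T_+$, to the Carnot–Carathéodory distance of a sub-Riemannian structure given by a bracket-generating rank-2 distribution with an inner product on it. *)

theory Defs
  imports "HOL-Analysis.Analysis" "HOL-Algebra.Group"
begin

section \<open>Smooth functions on Euclidean spaces\<close>

fun C_k :: "nat \<Rightarrow> 'a::euclidean_space set \<Rightarrow> ('a \<Rightarrow> 'b::real_normed_vector) \<Rightarrow> bool" where
  "C_k 0 S f \<longleftrightarrow> continuous_on S f"
| "C_k (Suc k) S f \<longleftrightarrow>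
     (\<forall>x\<in>S. f differentiable (at x)) \<and> (\<forall>b\<in>Basis. C_k k S (\<lambda>x. frechet_derivative f (at x) b))"

definition C_infinity :: "'a::euclidean_space set \<Rightarrow> ('a \<Rightarrow> 'b::real_normed_vector) \<Rightarrow> bool" where
  "C_infinity S f \<longleftrightarrow> open S \<and> (\<forall>k. C_k k S f)"

section \<open>Three-dimensional Lie groups\<close>

type_synonym 'g chart = "'g set \<times> ('g \<Rightarrow> real^3)"

definition is_chart :: "'g::topological_space chart \<Rightarrow> bool" where
  "is_chart = (\<lambda>(U, \<kappa>). open U \<and> open (\<kappa> ` U) \<and> homeomorphism U (\<kappa> ` U) \<kappa> (inv_into U \<kappa>))"

text \<open>
  The distinguished chart \<open>chart1\<close> around the unit only serves to identify the tangent space at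
  the unit, and hence the Lie algebra of left-invariant vector fields, with \<^typ>\<open>real^3\<close>.
  The field \<open>bracket\<close> is the Lie bracket of that Lie algebra; \<open>lie_group\<close> below forces it to be
  the commutator of left-invariant vector fields.
\<close>
record 'g lie_group_data = "'g monoid" +
  atlas :: "'g chart set"
  chart1 :: "'g chart"
  bracket :: "real^3 \<Rightarrow> real^3 \<Rightarrow> real^3"

definition smooth_fun :: "'g::topological_space lie_group_data \<Rightarrow> 'g set \<Rightarrow> ('g \<Rightarrow> real) \<Rightarrow> bool" where
  "smooth_fun G U f \<longleftrightarrow> open U \<and> (\<forall>(V, \<kappa>)\<in>atlas G. C_infinity (\<kappa> ` (U \<inter> V)) (f \<circ> inv_into V \<kappa>))"

text \<open>
  The left-invariant vector field with value \<open>v\<close> at the unit, applied to the function \<open>f\<close>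
  (differentiate \<open>f\<close> along the left translate by \<open>p\<close> of a curve through the unit with velocity \<open>v\<close>).
\<close>
definition left_field :: "'g lie_group_data \<Rightarrow> real^3 \<Rightarrow> ('g \<Rightarrow> real) \<Rightarrow> 'g \<Rightarrow> real" where
  "left_field G v f p =
     (let (U, \<kappa>) = chart1 G
      in deriv (\<lambda>s. f (p \<otimes>\<^bsub>G\<^esub> inv_into U \<kappa> (\<kappa> \<one>\<^bsub>G\<^esub> + s *\<^sub>R v))) 0)"

definition lie_group :: "'g::topological_space lie_group_data \<Rightarrow> bool" where
  "lie_group G \<longleftrightarrow>
     group G \<and> carrier G = UNIV \<and>
     (\<forall>c\<in>atlas G. is_chart c) \<and> \<Union> (fst ` atlas G) = UNIV \<and>
     (\<forall>(U, \<kappa>)\<in>atlas G. \<forall>(V, \<eta>)\<in>atlas G. C_infinity (\<kappa> ` (U \<inter> V)) (\<eta> \<circ> inv_into U \<kappa>)) \<and>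
     (\<forall>(U, \<kappa>)\<in>atlas G. \<forall>(V, \<eta>)\<in>atlas G. \<forall>(W, \<zeta>)\<in>atlas G.
        C_infinity {(x, y). x \<in> \<kappa> ` U \<and> y \<in> \<eta> ` V \<and> inv_into U \<kappa> x \<otimes>\<^bsub>G\<^esub> inv_into V \<eta> y \<in> W}
          (\<lambda>(x, y). \<zeta> (inv_into U \<kappa> x \<otimes>\<^bsub>G\<^esub> inv_into V \<eta> y))) \<and>
     (\<forall>(U, \<kappa>)\<in>atlas G. \<forall>(V, \<eta>)\<in>atlas G.
        C_infinity {x \<in> \<kappa> ` U. inv\<^bsub>G\<^esub> (inv_into U \<kappa> x) \<in> V}
          (\<lambda>x. \<eta> (inv\<^bsub>G\<^esub> (inv_into U \<kappa> x)))) \<and>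
     chart1 G \<in> atlas G \<and> \<one>\<^bsub>G\<^esub> \<in> fst (chart1 G) \<and>
     (\<forall>v w U f. smooth_fun G U f \<longrightarrow>
        (\<forall>p\<in>U. left_field G v (left_field G w f) p - left_field G w (left_field G v f) p =
               left_field G (bracket G v w) f p))"

section \<open>The Bianchi classes\<close>

text \<open>
  Two Lie groups are locally isomorphic iff their Lie algebras are isomorphic. The Lie algebras of
  the model groups are given as matrix Lie algebras with the commutator bracket.
\<close>

definition lie_algebra_iso :: "'g lie_group_data \<Rightarrow> ('k::real_algebra_1^'n^'n) set \<Rightarrow> bool" where
  "lie_algebra_iso G \<hh> \<longleftrightarrow>
     (\<exists>L. linear L \<and> bij_betw L (UNIV :: (real^3) set) \<hh> \<and>
          (\<forall>v w. L (bracket G v w) = L v ** L w - L w ** L v))"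

definition su2 :: "(complex^2^2) set" where
  "su2 = {A. (\<chi> i j. cnj (A $ j $ i)) = - A \<and> trace A = 0}"

definition sl2R :: "(real^2^2) set" where
  "sl2R = {A. trace A = 0}"

definition heisenberg :: "(real^3^3) set" where
  "heisenberg = {vector [vector [0, x, z], vector [0, 0, y], vector [0, 0, 0]] | x y z. True}"

text \<open>
  Isometry groups of the plane act by affine maps; the linear part lies in \<open>so(1,1)\<close> or \<open>so(2)\<close>
  and the last column is the translation part.
\<close>

definition e11 :: "(real^3^3) set" where
  "e11 = {vector [vector [0, s, x], vector [s, 0, y], vector [0, 0, 0]] | s x y. True}"

definition e2 :: "(real^3^3) set" where
  "e2 = {vector [vector [0, - s, x], vector [s, 0, y], vector [0, 0, 0]] | s x y. True}"

definition bianchi_group :: "'g::topological_space lie_group_data \<Rightarrow> bool" where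
  "bianchi_group G \<longleftrightarrow>
     lie_group G \<and> simply_connected (UNIV :: 'g set) \<and>
     ((\<forall>v w. bracket G v w = 0) \<or> lie_algebra_iso G su2 \<or> lie_algebra_iso G sl2R \<or>
      lie_algebra_iso G heisenberg \<or> lie_algebra_iso G e11 \<or> lie_algebra_iso G e2)"

section \<open>Riemannian geometry in the left-invariant frame\<close>

text \<open>
  Tangent vectors of the group are expressed in the left-invariant frame
  \<open>E\<^sub>i = left_field G (axis i 1)\<close>, so a metric is a matrix-valued function of the point.
  The metrics in this section are arbitrary, not necessarily left-invariant.
\<close>

type_synonym 'g metric = "'g \<Rightarrow> real^3^3"

definition metric_ip :: "'g metric \<Rightarrow> 'g \<Rightarrow> real^3 \<Rightarrow> real^3 \<Rightarrow> real" where
  "metric_ip g p v w = v \<bullet> (g p *v w)"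

definition riemannian_metric :: "'g::topological_space lie_group_data \<Rightarrow> 'g metric \<Rightarrow> bool" where
  "riemannian_metric G g \<longleftrightarrow>
     (\<forall>p. transpose (g p) = g p \<and> (\<forall>v. v \<noteq> 0 \<longrightarrow> 0 < metric_ip g p v v)) \<and>
     (\<forall>i j. smooth_fun G UNIV (\<lambda>p. g p $ i $ j))"

text \<open>A metric is invariant under all left translations iff its components in a left-invariant
  frame are constant.\<close>
definition left_invariant :: "'g lie_group_data \<Rightarrow> 'g metric \<Rightarrow> bool" where
  "left_invariant G g \<longleftrightarrow> (\<forall>p. g p = g \<one>\<^bsub>G\<^esub>)"

abbreviation frame :: "'g lie_group_data \<Rightarrow> 3 \<Rightarrow> ('g \<Rightarrow> real) \<Rightarrow> 'g \<Rightarrow> real" where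
  "frame G i \<equiv> left_field G (axis i 1)"

abbreviation frame_bracket :: "'g lie_group_data \<Rightarrow> 3 \<Rightarrow> 3 \<Rightarrow> real^3" where
  "frame_bracket G i j \<equiv> bracket G (axis i 1) (axis j 1)"

text \<open>Components of \<open>\<nabla>\<^bsub>E\<^sub>i\<^esub> E\<^sub>j\<close> for the Levi-Civita connection (Koszul formula).\<close>
definition levi_civita :: "'g lie_group_data \<Rightarrow> 'g metric \<Rightarrow> 3 \<Rightarrow> 3 \<Rightarrow> 'g \<Rightarrow> real^3" where
  "levi_civita G g i j p = matrix_inv (g p) *v (\<chi> l.
     (frame G i (\<lambda>q. g q $ j $ l) p + frame G j (\<lambda>q. g q $ i $ l) p - frame G l (\<lambda>q. g q $ i $ j) p
      + metric_ip g p (frame_bracket G i j) (axis l 1)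
      - metric_ip g p (frame_bracket G i l) (axis j 1)
      - metric_ip g p (frame_bracket G j l) (axis i 1)) / 2)"

text \<open>Components of \<open>\<nabla>\<^bsub>E\<^sub>i\<^esub> \<nabla>\<^bsub>E\<^sub>j\<^esub> E\<^sub>k - \<nabla>\<^bsub>E\<^sub>j\<^esub> \<nabla>\<^bsub>E\<^sub>i\<^esub> E\<^sub>k - \<nabla>\<^bsub>[E\<^sub>i, E\<^sub>j]\<^esub> E\<^sub>k\<close>.\<close>
definition curvature :: "'g lie_group_data \<Rightarrow> 'g metric \<Rightarrow> 3 \<Rightarrow> 3 \<Rightarrow> 3 \<Rightarrow> 'g \<Rightarrow> real^3" where
  "curvature G g i j k p = (\<chi> l.
     frame G i (\<lambda>q. levi_civita G g j k q $ l) p - frame G j (\<lambda>q. levi_civita G g i k q $ l) p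
     + (\<Sum>m\<in>UNIV. levi_civita G g j k p $ m * levi_civita G g i m p $ l
                 - levi_civita G g i k p $ m * levi_civita G g j m p $ l
                 - frame_bracket G i j $ m * levi_civita G g m k p $ l))"

definition ricci :: "'g lie_group_data \<Rightarrow> 'g metric \<Rightarrow> 'g \<Rightarrow> real^3^3" where
  "ricci G g p = (\<chi> j k. \<Sum>i\<in>UNIV. curvature G g i j k p $ i)"

definition scalar_curvature :: "'g lie_group_data \<Rightarrow> 'g metric \<Rightarrow> 'g \<Rightarrow> real" where
  "scalar_curvature G g p = (\<Sum>j\<in>UNIV. \<Sum>k\<in>UNIV. matrix_inv (g p) $ j $ k * ricci G g p $ j $ k)"

definition laplacian :: "'g lie_group_data \<Rightarrow> 'g metric \<Rightarrow> ('g \<Rightarrow> real) \<Rightarrow> 'g \<Rightarrow> real" where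
  "laplacian G g u p = (\<Sum>i\<in>UNIV. \<Sum>j\<in>UNIV. matrix_inv (g p) $ i $ j *
     (frame G i (frame G j u) p - (\<Sum>k\<in>UNIV. levi_civita G g i j p $ k * frame G k u p)))"

section \<open>Quotients of the group\<close>

text \<open>
  The closed manifold \<open>M\<close> is the type \<open>'m\<close>, given with its universal covering \<open>\<pi> : G \<rightarrow> M\<close>.
  Its smooth structure is the one making \<open>\<pi>\<close> a local diffeomorphism, and tensors on \<open>M\<close> are
  represented by their lifts to \<open>G\<close>, i.e. by tensors on \<open>G\<close> invariant under the deck
  transformations. Deck transformations need not be left translations.
\<close>

definition deck :: "('g::topological_space \<Rightarrow> 'm) \<Rightarrow> ('g \<Rightarrow> 'g) set" where
  "deck \<pi> = {\<delta>. homeomorphism UNIV UNIV \<delta> (inv_into UNIV \<delta>) \<and> \<pi> \<circ> \<delta> = \<pi>}"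

definition smooth_map :: "'g::topological_space lie_group_data \<Rightarrow> ('g \<Rightarrow> 'g) \<Rightarrow> bool" where
  "smooth_map G \<delta> \<longleftrightarrow> (\<forall>U f. smooth_fun G U f \<longrightarrow> smooth_fun G (\<delta> -` U) (f \<circ> \<delta>))"

definition is_differential ::
  "'g::topological_space lie_group_data \<Rightarrow> ('g \<Rightarrow> 'g) \<Rightarrow> 'g \<Rightarrow> real^3^3 \<Rightarrow> bool" where
  "is_differential G \<delta> p A \<longleftrightarrow>
     (\<forall>U f v. smooth_fun G U f \<and> \<delta> p \<in> U \<longrightarrow>
        left_field G v (f \<circ> \<delta>) p = left_field G (A *v v) f (\<delta> p))"

definition riemannian_isometry :: "'g::topological_space lie_group_data \<Rightarrow> 'g metric \<Rightarrow> ('g \<Rightarrow> 'g) \<Rightarrow> bool" where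
  "riemannian_isometry G g \<delta> \<longleftrightarrow> smooth_map G \<delta> \<and>
     (\<forall>p. \<exists>A. is_differential G \<delta> p A \<and>
          (\<forall>v w. metric_ip g (\<delta> p) (A *v v) (A *v w) = metric_ip g p v w))"

text \<open>Lifts to \<open>G\<close> of Riemannian metrics on \<open>M\<close>.\<close>
definition quotient_metric ::
  "'g::topological_space lie_group_data \<Rightarrow> ('g \<Rightarrow> 'm) \<Rightarrow> 'g metric \<Rightarrow> bool" where
  "quotient_metric G \<pi> g \<longleftrightarrow> riemannian_metric G g \<and> (\<forall>\<delta>\<in>deck \<pi>. riemannian_isometry G g \<delta>)"

text \<open>
  \<open>\<mu>\<close> is the Riemannian volume of \<open>M\<close>. In a chart \<open>\<kappa>\<close> its density is the square root of the
  determinant of the metric in the coordinate frame; passing from the coordinate frame to the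
  left-invariant frame divides it by the Jacobian determinant of the components \<open>E\<^sub>j \<kappa>\<^sub>i\<close>.
\<close>
definition riemannian_volume ::
  "'g::topological_space lie_group_data \<Rightarrow> ('g \<Rightarrow> 'm::topological_space) \<Rightarrow> 'g metric \<Rightarrow> 'm measure \<Rightarrow> bool"
  where
  "riemannian_volume G \<pi> g \<mu> \<longleftrightarrow>
     sets \<mu> = sets borel \<and>
     (\<forall>(U, \<kappa>)\<in>atlas G. \<forall>W. open W \<and> W \<subseteq> U \<and> inj_on \<pi> W \<longrightarrow>
        emeasure \<mu> (\<pi> ` W) =
        (\<integral>\<^sup>+x\<in>\<kappa> ` W. (let p = inv_into U \<kappa> x in
            ennreal (sqrt (det (g p)) / \<bar>det (\<chi> i j. frame G j (\<lambda>q. \<kappa> q $ i) p)\<bar>)) \<partial>lborel))"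

definition average_scalar_curvature ::
  "'g lie_group_data \<Rightarrow> ('g \<Rightarrow> 'm) \<Rightarrow> 'g metric \<Rightarrow> 'm measure \<Rightarrow> real" where
  "average_scalar_curvature G \<pi> g \<mu> =
     (\<integral>x. scalar_curvature G g (inv_into UNIV \<pi> x) \<partial>\<mu>) / measure \<mu> UNIV"

section \<open>The first eigenvalue\<close>

definition eigenvalue ::
  "'g::topological_space lie_group_data \<Rightarrow> ('g \<Rightarrow> 'm) \<Rightarrow> 'g metric \<Rightarrow> real \<Rightarrow> real \<Rightarrow> bool" where
  "eigenvalue G \<pi> g a l \<longleftrightarrow>
     (\<exists>u :: 'm \<Rightarrow> real. smooth_fun G UNIV (u \<circ> \<pi>) \<and> (\<exists>x. u x \<noteq> 0) \<and>
        (\<forall>p. - laplacian G g (u \<circ> \<pi>) p + a * scalar_curvature G g p * u (\<pi> p) = l * u (\<pi> p)))"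

definition first_eigenvalue ::
  "'g::topological_space lie_group_data \<Rightarrow> ('g \<Rightarrow> 'm) \<Rightarrow> 'g metric \<Rightarrow> real \<Rightarrow> real" where
  "first_eigenvalue G \<pi> g a = (LEAST l. eigenvalue G \<pi> g a l)"

section \<open>The backward Ricci flow\<close>

definition time_interval :: "ereal \<Rightarrow> real set" where
  "time_interval T = {t. 0 \<le> t \<and> ereal t < T}"

text \<open>Solutions on \<open>[0, T)\<close> whose lifts to \<open>G\<close> stay left-invariant.\<close>
definition backward_ricci_flow ::
  "'g::topological_space lie_group_data \<Rightarrow> ('g \<Rightarrow> 'm::topological_space) \<Rightarrow> ereal \<Rightarrow> (real \<Rightarrow> 'g metric) \<Rightarrow> bool"
  where
  "backward_ricci_flow G \<pi> T g \<longleftrightarrow>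
     (\<forall>t\<in>time_interval T.
        quotient_metric G \<pi> (g t) \<and> left_invariant G (g t) \<and>
        (\<exists>\<mu>. riemannian_volume G \<pi> (g t) \<mu> \<and>
          (\<forall>p. ((\<lambda>\<tau>. g \<tau> p) has_vector_derivative
                 2 *\<^sub>R ricci G (g t) p - (2 * average_scalar_curvature G \<pi> (g t) \<mu> / 3) *\<^sub>R g t p)
               (at t within time_interval T))))"

definition maximal_backward_ricci_flow ::
  "'g::topological_space lie_group_data \<Rightarrow> ('g \<Rightarrow> 'm::topological_space) \<Rightarrow> ereal \<Rightarrow> (real \<Rightarrow> 'g metric) \<Rightarrow> bool"
  where
  "maximal_backward_ricci_flow G \<pi> T g \<longleftrightarrow>
     0 < T \<and> backward_ricci_flow G \<pi> T g \<and>
     \<not> (\<exists>T' g'. T < T' \<and> backward_ricci_flow G \<pi> T' g' \<and> (\<forall>t\<in>time_interval T. g' t = g t))"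

text \<open>Covers both finite \<open>T\<close> and \<open>T = \<infinity>\<close>.\<close>
definition time_tends_to :: "ereal \<Rightarrow> real filter" where
  "time_tends_to T = filtercomap ereal (at_left T)"

section \<open>Sub-Riemannian structures\<close>

definition has_velocity ::
  "'g::topological_space lie_group_data \<Rightarrow> (real \<Rightarrow> 'g) \<Rightarrow> real \<Rightarrow> real^3 \<Rightarrow> bool" where
  "has_velocity G \<gamma> s v \<longleftrightarrow>
     (\<forall>U f. smooth_fun G U f \<and> \<gamma> s \<in> U \<longrightarrow>
        (f \<circ> \<gamma> has_real_derivative left_field G v f (\<gamma> s)) (at s within {0..1}))"

text \<open>
  Piecewise continuously differentiable curves tangent to the distribution \<open>D\<close>, with velocity \<open>v\<close>
  (whose values at the break points are irrelevant). Every such curve in \<open>M\<close> is \<open>\<pi> \<circ> \<gamma>\<close> for a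
  curve \<open>\<gamma>\<close> in \<open>G\<close>, and the length is the same for \<open>\<gamma>\<close> and \<open>\<pi> \<circ> \<gamma>\<close>.
\<close>
definition horizontal_curve ::
  "'g::topological_space lie_group_data \<Rightarrow> ('g \<Rightarrow> (real^3) set) \<Rightarrow> (real \<Rightarrow> 'g) \<Rightarrow> (real \<Rightarrow> real^3) \<Rightarrow> bool"
  where
  "horizontal_curve G D \<gamma> v \<longleftrightarrow>
     continuous_on {0..1} \<gamma> \<and> bounded (v ` {0..1}) \<and>
     (\<exists>S. finite S \<and> continuous_on ({0..1} - S) v \<and>
          (\<forall>s\<in>{0..1} - S. has_velocity G \<gamma> s (v s) \<and> v s \<in> D (\<gamma> s)))"

definition curve_length ::
  "('g \<Rightarrow> real^3 \<Rightarrow> real^3 \<Rightarrow> real) \<Rightarrow> (real \<Rightarrow> 'g) \<Rightarrow> (real \<Rightarrow> real^3) \<Rightarrow> real" where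
  "curve_length h \<gamma> v = integral {0..1} (\<lambda>s. sqrt (h (\<gamma> s) (v s) (v s)))"

definition cc_distance ::
  "'g::topological_space lie_group_data \<Rightarrow> ('g \<Rightarrow> 'm) \<Rightarrow> ('g \<Rightarrow> (real^3) set) \<Rightarrow>
   ('g \<Rightarrow> real^3 \<Rightarrow> real^3 \<Rightarrow> real) \<Rightarrow> 'm \<Rightarrow> 'm \<Rightarrow> real" where
  "cc_distance G \<pi> D h x y =
     Inf {curve_length h \<gamma> v | \<gamma> v. horizontal_curve G D \<gamma> v \<and> \<pi> (\<gamma> 0) = x \<and> \<pi> (\<gamma> 1) = y}"

definition riemannian_distance ::
  "'g::topological_space lie_group_data \<Rightarrow> ('g \<Rightarrow> 'm) \<Rightarrow> 'g metric \<Rightarrow> 'm \<Rightarrow> 'm \<Rightarrow> real" where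
  "riemannian_distance G \<pi> g = cc_distance G \<pi> (\<lambda>_. UNIV) (metric_ip g)"

definition smooth_field :: "'g::topological_space lie_group_data \<Rightarrow> 'g set \<Rightarrow> ('g \<Rightarrow> real^3) \<Rightarrow> bool" where
  "smooth_field G U Y \<longleftrightarrow> (\<forall>k. smooth_fun G U (\<lambda>q. Y q $ k))"

text \<open>The commutator of the vector fields \<open>\<Sum>\<^sub>i Y\<^sub>i E\<^sub>i\<close> and \<open>\<Sum>\<^sub>i Z\<^sub>i E\<^sub>i\<close>.\<close>
definition field_bracket ::
  "'g lie_group_data \<Rightarrow> ('g \<Rightarrow> real^3) \<Rightarrow> ('g \<Rightarrow> real^3) \<Rightarrow> 'g \<Rightarrow> real^3" where
  "field_bracket G Y Z p =
     (\<chi> k. left_field G (Y p) (\<lambda>q. Z q $ k) p - left_field G (Z p) (\<lambda>q. Y q $ k) p)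
     + bracket G (Y p) (Z p)"

inductive_set iterated_brackets ::
  "'g::topological_space lie_group_data \<Rightarrow> 'g set \<Rightarrow> ('g \<Rightarrow> (real^3) set) \<Rightarrow> ('g \<Rightarrow> real^3) set"
  for G U D where
  section_of: "smooth_field G U Y \<Longrightarrow> (\<And>q. q \<in> U \<Longrightarrow> Y q \<in> D q) \<Longrightarrow> Y \<in> iterated_brackets G U D"
| bracket_of: "Y \<in> iterated_brackets G U D \<Longrightarrow> Z \<in> iterated_brackets G U D \<Longrightarrow>
     field_bracket G Y Z \<in> iterated_brackets G U D"

definition bracket_generating ::
  "'g::topological_space lie_group_data \<Rightarrow> ('g \<Rightarrow> (real^3) set) \<Rightarrow> bool" where
  "bracket_generating G D \<longleftrightarrow>
     (\<forall>p. \<exists>U. open U \<and> p \<in> U \<and> span {Y p | Y. Y \<in> iterated_brackets G U D} = UNIV)"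

definition inner_product_on :: "(real^3) set \<Rightarrow> (real^3 \<Rightarrow> real^3 \<Rightarrow> real) \<Rightarrow> bool" where
  "inner_product_on V h \<longleftrightarrow>
     (\<forall>v\<in>V. \<forall>w\<in>V. h v w = h w v) \<and> (\<forall>v\<in>V. v \<noteq> 0 \<longrightarrow> 0 < h v v) \<and>
     (\<forall>u\<in>V. \<forall>v\<in>V. \<forall>w\<in>V. \<forall>c. h (u + c *\<^sub>R v) w = h u w + c * h v w)"

text \<open>Lifts to \<open>G\<close> of smooth bracket-generating rank-2 sub-Riemannian structures on \<open>M\<close>.\<close>
definition sub_riemannian_structure ::
  "'g::topological_space lie_group_data \<Rightarrow> ('g \<Rightarrow> 'm) \<Rightarrow> ('g \<Rightarrow> (real^3) set) \<Rightarrow>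
   ('g \<Rightarrow> real^3 \<Rightarrow> real^3 \<Rightarrow> real) \<Rightarrow> bool" where
  "sub_riemannian_structure G \<pi> D h \<longleftrightarrow>
     (\<forall>p. subspace (D p) \<and> dim (D p) = 2 \<and> inner_product_on (D p) (h p)) \<and>
     (\<forall>p. \<exists>U Y Z. p \<in> U \<and> smooth_field G U Y \<and> smooth_field G U Z \<and>
          (\<forall>q\<in>U. D q = span {Y q, Z q}) \<and>
          smooth_fun G U (\<lambda>q. h q (Y q) (Y q)) \<and> smooth_fun G U (\<lambda>q. h q (Y q) (Z q)) \<and>
          smooth_fun G U (\<lambda>q. h q (Z q) (Z q))) \<and>
     (\<forall>\<delta>\<in>deck \<pi>. \<forall>p. \<exists>A. is_differential G \<delta> p A \<and> D (\<delta> p) = (\<lambda>v. A *v v) ` D p \<and>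
          (\<forall>v\<in>D p. \<forall>w\<in>D p. h (\<delta> p) (A *v v) (A *v w) = h p v w)) \<and>
     bracket_generating G D"

definition converges_to_sub_riemannian ::
  "'g::topological_space lie_group_data \<Rightarrow> ('g \<Rightarrow> 'm) \<Rightarrow> ereal \<Rightarrow> (real \<Rightarrow> 'g metric) \<Rightarrow> bool" where
  "converges_to_sub_riemannian G \<pi> T g \<longleftrightarrow>
     (\<exists>\<phi> D h. (\<forall>t\<in>time_interval T. 0 < \<phi> t) \<and> sub_riemannian_structure G \<pi> D h \<and>
        uniform_limit UNIV
          (\<lambda>t (x, y). riemannian_distance G \<pi> (\<lambda>p. \<phi> t *\<^sub>R g t p) x y)
          (\<lambda>(x, y). cc_distance G \<pi> D h x y)
          (time_tends_to T))"

end

theory Submission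
  imports Defs
begin

text \<open>
  On a left-invariant metric the scalar curvature \<open>R\<close> is constant in space. Constants are then
  eigenfunctions of \<open>-\<Delta> + a R\<close> with eigenvalue \<open>a R\<close>, and no eigenvalue is smaller, because at a
  positive maximum of an eigenfunction \<open>u\<close> (or of \<open>-u\<close>) the Laplacian is nonpositive
  (\<open>first_eigenvalue_constant_scalar_curvature\<close>). So \<open>\<lambda> = a R\<close>, and the claim is that the positive
  part of \<open>R\<close> tends to zero. Suppose instead that \<open>R \<ge> \<epsilon> > 0\<close> at times arbitrarily close to \<open>T\<close>. The
  contradiction has two halves.

  The metrics at these times are uniformly equivalent. All Bianchi algebras are unimodular: the
  bracket is \<open>[v, w] = N (v \<times> w)\<close> with a symmetric matrix \<open>N\<close>. For a metric \<open>A\<close> the scalar curvature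
  equals \<open>(2 e\<^sub>2 - e\<^sub>1\<^sup>2 / 2) / det A\<close>, where \<open>e\<^sub>1, e\<^sub>2\<close> are the first two elementary symmetric functions
  of the eigenvalues of \<open>N A\<close> (\<open>scalar_curvature_eq\<close>). If this is at least \<open>\<epsilon>\<close>, the characteristic
  polynomial shows that all eigenvalues of \<open>N A\<close> have the same sign and modulus at most
  \<open>2 |det N| / \<epsilon>\<close>; hence \<open>N\<close> is definite and \<open>A\<close> is bounded (geometrically: the group is \<open>SU(2)\<close>). The
  flow preserves volume, because the average of \<open>R\<close> is \<open>R\<close>, so \<open>det A\<close> is constant and \<open>A\<close> is also
  bounded away from the degenerate forms (\<open>positive_scalar_curvature_bounds\<close>,
  \<open>backward_ricci_flow_det_constant\<close>).

  Rescalings of uniformly equivalent Riemannian metrics have no sub-Riemannian limit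
  (\<open>no_sub_riemannian_limit\<close>). Along the sequence the scaling factors are bounded, so the limit
  distance is at most a constant times a fixed Riemannian distance: points at parameter \<open>s\<close> of an
  integral curve have limit distance \<open>O(s)\<close> from its start. If the curve leaves in a direction
  transverse to the distribution, horizontal curves to these points are longer than any given
  multiple of \<open>s\<close>, since their velocities stay close to the plane of the distribution at the start.

  Two points need care. Distances on \<open>M\<close> are infima over curves in \<open>G\<close> that start anywhere in a fibre.
  Local estimates at one point of the fibre suffice because the deck group acts transitively on
  fibres (\<open>deck_transitive\<close>) and by isometries. Moreover the infimum over an empty set of curves is a
  fixed but unknown real number, which could be zero, so that the limit distance might vanish
  identically. This is excluded by exhibiting one nonconstant horizontal curve, an integral curve of
  a section of the distribution, given by the Picard-Lindeloef theorem.
\<close>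

section \<open>Unimodularity of the Bianchi algebras\<close>

lemmas mat3 = matrix_vector_mult_def matrix_matrix_mult_def cross3_def inner_vec_def sum_3 vec_eq_iff
  forall_3 transpose_def axis_def

text \<open>
  In coordinates \<open>a\<close> on the model algebra the commutator is \<open>\<Lambda> (a \<times> b)\<close>. A linear change of
  coordinates \<open>P\<close> multiplies the cross product by \<open>det P\<close> and the inverse transpose of \<open>P\<close>, so that
  \<open>\<Lambda>\<close> is transformed like a symmetric bilinear form and remains symmetric.
\<close>
lemma unimodular_of_model:
  fixes M :: "real^3 \<Rightarrow> 'k::real_algebra_1^'n^'n"
  assumes iso: "lie_algebra_iso G \<hh>" and M: "linear M" "inj M" "\<hh> = range M"
    and \<Lambda>: "transpose \<Lambda> = \<Lambda>" "\<And>a b. M a ** M b - M b ** M a = M (\<Lambda> *v cross3 a b)"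
  shows "\<exists>N. transpose N = N \<and> (\<forall>v w. bracket G v w = N *v cross3 v w)"
proof -
  obtain L where L: "linear L" "bij_betw L UNIV \<hh>"
    "\<And>v w. L (bracket G v w) = L v ** L w - L w ** L v"
    using iso unfolding lie_algebra_iso_def by blast
  define f where "f = inv_into UNIV M \<circ> L"
  have Mf: "M (f v) = L v" for v
    unfolding f_def o_def by (rule f_inv_into_f) (use L(2) M(3) in \<open>auto simp: bij_betw_def\<close>)
  have linf: "linear f"
  proof (rule linearI)
    show "f (x + y) = f x + f y" for x y
      by (rule injD[OF M(2)]) (simp add: Mf linear_add[OF M(1)] linear_add[OF L(1)])
    show "f (c *\<^sub>R x) = c *\<^sub>R f x" for c x
      by (rule injD[OF M(2)]) (simp add: Mf linear_scale[OF M(1)] linear_scale[OF L(1)])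
  qed
  have injf: "inj f"
    using L(2) unfolding bij_betw_def by (metis Mf inj_on_def)
  define P where "P = matrix f"
  have P: "P *v v = f v" for v unfolding P_def by (simp add: matrix_works linf)
  have "inj ((*v) P)" using injf by (simp add: P[abs_def])
  then obtain P' where P': "P' ** P = mat 1" using matrix_left_invertible_injective by blast
  then have P'2: "P ** P' = mat 1" by (simp add: matrix_left_right_inverse)
  have br: "P *v bracket G v w = \<Lambda> *v cross3 (P *v v) (P *v w)" for v w
    unfolding P by (rule injD[OF M(2)]) (simp add: Mf L(3) \<Lambda>(2)[symmetric])
  define N where "N = det P *\<^sub>R (P' ** \<Lambda> ** transpose P')"
  have "transpose N = N"
    by (simp add: N_def transpose_scalar matrix_transpose_mul \<Lambda> matrix_mul_assoc)
  moreover have "bracket G v w = N *v cross3 v w" for v w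
  proof -
    have "bracket G v w = P' *v (P *v bracket G v w)"
      by (simp add: matrix_vector_mul_assoc P')
    also have "\<dots> = P' *v (\<Lambda> *v cross3 (P *v v) (P *v w))" by (simp add: br)
    also have "cross3 (P *v v) (P *v w) = transpose P' *v (transpose P *v cross3 (P *v v) (P *v w))"
      by (metis matrix_transpose_mul P'2 transpose_mat matrix_vector_mul_assoc matrix_vector_mul_lid)
    also have "\<dots> = transpose P' *v (det P *\<^sub>R cross3 v w)" by (simp only: cross_matrix_mult)
    also have "P' *v (\<Lambda> *v (transpose P' *v (det P *\<^sub>R cross3 v w))) = N *v cross3 v w"
      unfolding N_def scaleR_matrix_vector_assoc[symmetric] matrix_vector_mul_assoc[symmetric]
      by (simp only: matrix_vector_mult_scaleR)
    finally show ?thesis .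
  qed
  ultimately show ?thesis by blast
qed

definition diag3 :: "real \<Rightarrow> real \<Rightarrow> real \<Rightarrow> real^3^3" where
  "diag3 a b c = vector [vector [a, 0, 0], vector [0, b, 0], vector [0, 0, c]]"

lemma transpose_diag3: "transpose (diag3 a b c) = diag3 a b c"
  by (simp add: mat3 diag3_def)

text \<open>
  Symmetry of \<open>N\<close> expresses that the algebra is unimodular. Each model algebra is written in a basis
  in which the matrix is diagonal; its signs distinguish the types.
\<close>
lemma bianchi_unimodular:
  assumes "bianchi_group G"
  obtains N where "transpose N = N" "\<And>v w. bracket G v w = N *v cross3 v w"
proof -
  have heis: "\<exists>N. transpose N = N \<and> (\<forall>v w. bracket G v w = N *v cross3 v w)" if "lie_algebra_iso G heisenberg"
  proof (rule unimodular_of_model[OF that _ _ _ transpose_diag3])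
    let ?M = "\<lambda>a::real^3. vector [vector [0, a$1, a$3], vector [0, 0, a$2], vector [0, 0, 0]] :: real^3^3"
    show "linear ?M" by (auto intro!: linearI simp: mat3)
    show "inj ?M" by (auto intro!: injI simp: mat3)
    show "heisenberg = range ?M"
    proof -
      have "vector [vector [0, x, z], vector [0, 0, y], vector [0, 0, 0]] = ?M (vector [x, y, z])" for x y z by simp
      then show ?thesis unfolding heisenberg_def by blast
    qed
    show "?M a ** ?M b - ?M b ** ?M a = ?M (diag3 0 0 1 *v cross3 a b)" for a b
      by (simp add: mat3 diag3_def algebra_simps)
  qed
  have e11: "\<exists>N. transpose N = N \<and> (\<forall>v w. bracket G v w = N *v cross3 v w)" if "lie_algebra_iso G e11"
  proof (rule unimodular_of_model[OF that _ _ _ transpose_diag3])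
    let ?M = "\<lambda>a::real^3. vector [vector [0, a$1, a$2], vector [a$1, 0, a$3], vector [0, 0, 0]] :: real^3^3"
    show "linear ?M" by (auto intro!: linearI simp: mat3)
    show "inj ?M" by (auto intro!: injI simp: mat3)
    show "e11 = range ?M"
    proof -
      have "vector [vector [0, s, x], vector [s, 0, y], vector [0, 0, 0]] = ?M (vector [s, x, y])" for x y s by simp
      then show ?thesis unfolding e11_def by blast
    qed
    show "?M a ** ?M b - ?M b ** ?M a = ?M (diag3 0 (-1) 1 *v cross3 a b)" for a b
      by (simp add: mat3 diag3_def algebra_simps)
  qed
  have e2: "\<exists>N. transpose N = N \<and> (\<forall>v w. bracket G v w = N *v cross3 v w)" if "lie_algebra_iso G e2"
  proof (rule unimodular_of_model[OF that _ _ _ transpose_diag3])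
    let ?M = "\<lambda>a::real^3. vector [vector [0, - (a$1), a$2], vector [a$1, 0, a$3], vector [0, 0, 0]] :: real^3^3"
    show "linear ?M" by (auto intro!: linearI simp: mat3)
    show "inj ?M" by (auto intro!: injI simp: mat3)
    show "e2 = range ?M"
    proof -
      have "vector [vector [0, - s, x], vector [s, 0, y], vector [0, 0, 0]] = ?M (vector [s, x, y])" for x y s by simp
      then show ?thesis unfolding e2_def by blast
    qed
    show "?M a ** ?M b - ?M b ** ?M a = ?M (diag3 0 1 1 *v cross3 a b)" for a b
      by (simp add: mat3 diag3_def algebra_simps)
  qed
  have sl2: "\<exists>N. transpose N = N \<and> (\<forall>v w. bracket G v w = N *v cross3 v w)" if "lie_algebra_iso G sl2R"
  proof (rule unimodular_of_model[OF that _ _ _ transpose_diag3])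
    let ?M = "\<lambda>a::real^3. vector [vector [a$3, a$1 + a$2], vector [a$1 - a$2, - (a$3)]] :: real^2^2"
    show "linear ?M" by (auto intro!: linearI simp: mat3 forall_2 algebra_simps)
    show "inj ?M" by (auto intro!: injI simp: mat3 forall_2)
    show "sl2R = range ?M"
    proof -
      have "A = ?M (vector [(A$1$2 + A$2$1) / 2, (A$1$2 - A$2$1) / 2, A$1$1])" if "trace A = 0" for A :: "real^2^2"
        using that by (auto simp: trace_def sum_2 vec_eq_iff forall_2 field_simps)
      moreover have "trace (?M a) = 0" for a by (simp add: trace_def sum_2)
      ultimately show ?thesis unfolding sl2R_def by blast
    qed
    show "?M a ** ?M b - ?M b ** ?M a = ?M (diag3 (-2) 2 (-2) *v cross3 a b)" for a b
      by (simp add: mat3 sum_2 forall_2 diag3_def algebra_simps)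
  qed
  have su2: "\<exists>N. transpose N = N \<and> (\<forall>v w. bracket G v w = N *v cross3 v w)" if "lie_algebra_iso G su2"
  proof (rule unimodular_of_model[OF that _ _ _ transpose_diag3])
    let ?M = "\<lambda>a::real^3. vector [vector [Complex 0 (a$3), Complex (a$1) (a$2)],
        vector [Complex (- (a$1)) (a$2), Complex 0 (- (a$3))]] :: complex^2^2"
    show "linear ?M" by (auto intro!: linearI simp: mat3 forall_2 complex_eq_iff)
    show "inj ?M"
    proof (rule injI)
      fix a b assume "?M a = ?M b"
      then have "?M a $ 1 $ 1 = ?M b $ 1 $ 1" "?M a $ 1 $ 2 = ?M b $ 1 $ 2" by metis+
      then show "a = b" by (simp add: vec_eq_iff forall_3)
    qed
    show "su2 = range ?M"
    proof -
      have "A = ?M (vector [Re (A$1$2), Im (A$1$2), Im (A$1$1)])"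
        if "(\<chi> i j. cnj (A $ j $ i)) = - A" "trace A = 0" for A :: "complex^2^2"
      proof -
        have e: "cnj (A $ j $ i) = - A $ i $ j" for i j
          using arg_cong[OF that(1), of "\<lambda>B. B $ i $ j"] by simp
        have "A $ 1 $ 1 + A $ 2 $ 2 = 0" using that(2) by (simp add: trace_def sum_2)
        then show ?thesis using e[of 1 1] e[of 1 2]
          by (simp add: vec_eq_iff forall_2 complex_eq_iff)
      qed
      moreover have "trace (?M a) = 0" for a by (simp add: trace_def sum_2 complex_eq_iff)
      moreover have "(\<chi> i j. cnj (?M a $ j $ i)) = - ?M a" for a
        by (simp add: vec_eq_iff forall_2 complex_eq_iff)
      ultimately show ?thesis unfolding su2_def by blast
    qed
    show "?M a ** ?M b - ?M b ** ?M a = ?M (diag3 2 2 2 *v cross3 a b)" for a b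
      by (simp add: mat3 sum_2 forall_2 diag3_def complex_eq_iff algebra_simps)
  qed
  have ab: "\<exists>N. transpose N = N \<and> (\<forall>v w. bracket G v w = N *v cross3 v w)" if "\<forall>v w. bracket G v w = 0"
    using that by (intro exI[of _ 0]) (simp add: mat3 zero_vec_def)
  show ?thesis
    using assms ab heis e11 e2 sl2 su2 that unfolding bianchi_group_def by blast
qed

section \<open>Scalar curvature of left-invariant metrics\<close>

lemma left_field_const [simp]: "left_field G v (\<lambda>q. c) p = 0"
  by (simp add: left_field_def split: prod.split)

text \<open>
  The second coefficient of the characteristic polynomial: the sum of the principal \<open>2 \<times> 2\<close> minors.
\<close>
definition minors2 :: "real^3^3 \<Rightarrow> real" where
  "minors2 X = (X$1$1 * X$2$2 - X$1$2 * X$2$1) + (X$1$1 * X$3$3 - X$1$3 * X$3$1) + (X$2$2 * X$3$3 - X$2$3 * X$3$2)"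

text \<open>
  With \<open>X = N A\<close> this is the operator \<open>S\<close> for which the Levi-Civita connection of the metric \<open>A\<close> is
  \<open>\<nabla>\<^sub>v w = A\<^sup>-\<^sup>1 (S v \<times> w)\<close>. In a Milnor frame its eigenvalues are, up to a common factor, the numbers
  \<open>\<mu>\<^sub>i = (\<lambda>\<^sub>1 + \<lambda>\<^sub>2 + \<lambda>\<^sub>3) / 2 - \<lambda>\<^sub>i\<close>.
\<close>
definition half_trace_minus :: "real^3^3 \<Rightarrow> real^3^3" where
  "half_trace_minus X = mat (trace X / 2) - X"

lemma symmetric_entries: "transpose A = A \<Longrightarrow> A $ i $ j = A $ j $ i"
  by (metis transpose_def vec_lambda_beta)

lemma cross_sum_right: "(\<Sum>m\<in>UNIV. w $ m * (H *v cross3 u (axis m 1)) $ l) = (H *v cross3 u w) $ l"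
  for H :: "real^3^3" and w u :: "real^3"
  using exhaust_3[of l] by (auto simp: mat3 algebra_simps)

lemma cross_sum_left: "(\<Sum>m\<in>UNIV. w $ m * (H *v cross3 (T *v axis m 1) u) $ l) = (H *v cross3 (T *v w) u) $ l"
  for H T :: "real^3^3" and w u :: "real^3"
  by (simp add: mat3 algebra_simps)

lemma cross_diff_left: "cross3 (x - y) z = cross3 x z - cross3 y z"
  by (simp add: mat3 algebra_simps)

text \<open>
  Jacobi identity of the unimodular Lie bracket \<open>H (v \<times> w)\<close>; for \<open>H = A\<^sup>-\<^sup>1\<close> it is, up to scale, the
  cross product of the metric \<open>A\<close>.
\<close>
lemma cross_jacobi:
  fixes H :: "real^3^3"
  assumes "transpose H = H"
  shows "H *v cross3 u (H *v cross3 v w) - H *v cross3 v (H *v cross3 u w) = H *v cross3 (H *v cross3 u v) w"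
proof -
  note s = symmetric_entries[OF assms, of 2 1] symmetric_entries[OF assms, of 3 1] symmetric_entries[OF assms, of 3 2]
  show ?thesis by (simp add: mat3 s algebra_simps)
qed

context
  fixes G :: "'g lie_group_data" and g :: "'g metric" and A N H :: "real^3^3"
  assumes g: "\<And>q. g q = A" and A: "transpose A = A" and N: "transpose N = N"
    and HA: "H ** A = mat 1" and br: "\<And>v w. bracket G v w = N *v cross3 v w"
begin

lemma matrix_inv_eq: "matrix_inv A = H"
proof -
  have "invertible A" using HA matrix_left_right_inverse[of H A] unfolding invertible_def by blast
  then have "A ** matrix_inv A = mat 1"
    unfolding invertible_def matrix_inv_def by (rule someI2_ex) blast
  then have "H ** (A ** matrix_inv A) = H" by simp
  then show ?thesis by (simp add: matrix_mul_assoc HA)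
qed

abbreviation "connection_matrix \<equiv> half_trace_minus (N ** A)"

text \<open>
  The frame components of the metric are constant, so only the three bracket terms of the Koszul
  formula remain. They combine by the polarised determinant identity
  \<open>tr M det(z, v, w) = det(M z, v, w) + det(z, M v, w) + det(z, v, M w)\<close> with \<open>M = N A\<close>.
\<close>
lemma levi_civita_eq: "levi_civita G g i j p = H *v cross3 (connection_matrix *v axis i 1) (axis j 1)"
proof -
  note s = symmetric_entries[OF A, of 2 1] symmetric_entries[OF A, of 3 1] symmetric_entries[OF A, of 3 2]
    symmetric_entries[OF N, of 2 1] symmetric_entries[OF N, of 3 1] symmetric_entries[OF N, of 3 2]
  have "(N *v cross3 (axis i 1) (axis j 1)) \<bullet> (A *v axis l 1)
      - (N *v cross3 (axis i 1) (axis l 1)) \<bullet> (A *v axis j 1)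
      - (N *v cross3 (axis j 1) (axis l 1)) \<bullet> (A *v axis i 1) = 2 * cross3 (connection_matrix *v axis i 1) (axis j 1) $ l" for l
    using exhaust_3[of i] exhaust_3[of j] exhaust_3[of l]
    by (elim disjE) (simp_all add: mat3 half_trace_minus_def mat_def trace_def s algebra_simps)
  then have "(\<chi> l. ((N *v cross3 (axis i 1) (axis j 1)) \<bullet> (A *v axis l 1)
      - (N *v cross3 (axis i 1) (axis l 1)) \<bullet> (A *v axis j 1)
      - (N *v cross3 (axis j 1) (axis l 1)) \<bullet> (A *v axis i 1)) / 2) = cross3 (connection_matrix *v axis i 1) (axis j 1)"
    by (simp add: vec_eq_iff)
  then show ?thesis
    by (simp add: levi_civita_def g matrix_inv_eq metric_ip_def br)
qed

lemma inverse_symmetric: "transpose H = H"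
proof -
  have "A ** H = mat 1" using HA by (simp add: matrix_left_right_inverse)
  then have "transpose H ** A = mat 1" using A by (metis matrix_transpose_mul transpose_mat)
  then show ?thesis using HA \<open>A ** H = mat 1\<close> by (metis matrix_mul_assoc matrix_mul_lid matrix_mul_rid)
qed

text \<open>
  The connection acts through the cross product of the metric, hence by the Jacobi identity
  the commutator of two covariant derivatives is again of this form.
\<close>
lemma curvature_eq: "curvature G g i j k p = H *v cross3
    (H *v cross3 (connection_matrix *v axis i 1) (connection_matrix *v axis j 1) - connection_matrix *v (N *v cross3 (axis i 1) (axis j 1))) (axis k 1)"
proof -
  have "curvature G g i j k p = H *v cross3 (connection_matrix *v axis i 1) (H *v cross3 (connection_matrix *v axis j 1) (axis k 1))
      - H *v cross3 (connection_matrix *v axis j 1) (H *v cross3 (connection_matrix *v axis i 1) (axis k 1))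
      - H *v cross3 (connection_matrix *v (N *v cross3 (axis i 1) (axis j 1))) (axis k 1)"
    by (simp add: curvature_def vec_eq_iff levi_civita_eq br sum.distrib sum_subtractf cross_sum_right cross_sum_left)
  then show ?thesis
    by (simp add: cross_jacobi[OF inverse_symmetric] cross_diff_left matrix_vector_mult_diff_distrib)
qed

text \<open>
  Contracting with \<open>H\<close> moves both free indices of the curvature to the columns of \<open>H\<close>.
\<close>
lemma scalar_curvature_eq_sum: "scalar_curvature G g p =
   (\<Sum>i\<in>UNIV. \<Sum>j\<in>UNIV. (H *v cross3 (connection_matrix *v axis i 1) (connection_matrix *v axis j 1) - connection_matrix *v (N *v cross3 (axis i 1) (axis j 1)))
       \<bullet> cross3 (H *v axis j 1) (H *v axis i 1))"
proof -
  have k: "(\<Sum>k\<in>UNIV. H $ j $ k * (H *v cross3 q (axis k 1)) $ i) = q \<bullet> cross3 (H *v axis j 1) (H *v axis i 1)"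
    for i j :: 3 and q :: "real^3"
  proof -
    note s = symmetric_entries[OF inverse_symmetric, of 2 1] symmetric_entries[OF inverse_symmetric, of 3 1] symmetric_entries[OF inverse_symmetric, of 3 2]
    show ?thesis
      using exhaust_3[of i] exhaust_3[of j]
      by (elim disjE) (simp_all add: mat3 s algebra_simps)
  qed
  have "scalar_curvature G g p = (\<Sum>j\<in>UNIV. \<Sum>i\<in>UNIV. \<Sum>k\<in>UNIV. H $ j $ k * curvature G g i j k p $ i)"
    unfolding scalar_curvature_def ricci_def
    by (simp add: matrix_inv_eq g sum_distrib_left) (intro sum.cong refl sum.swap)
  also have "\<dots> = (\<Sum>j\<in>UNIV. \<Sum>i\<in>UNIV. (H *v cross3 (connection_matrix *v axis i 1) (connection_matrix *v axis j 1) - connection_matrix *v (N *v cross3 (axis i 1) (axis j 1)))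
       \<bullet> cross3 (H *v axis j 1) (H *v axis i 1))"
    unfolding curvature_eq k ..
  also have "\<dots> = (\<Sum>i\<in>UNIV. \<Sum>j\<in>UNIV. (H *v cross3 (connection_matrix *v axis i 1) (connection_matrix *v axis j 1) - connection_matrix *v (N *v cross3 (axis i 1) (axis j 1)))
       \<bullet> cross3 (H *v axis j 1) (H *v axis i 1))" by (rule sum.swap)
  finally show ?thesis .
qed

text \<open>
  Milnor's formula in a basis-free form. The cross product of two columns of \<open>H = A\<^sup>-\<^sup>1\<close> is
  \<open>det H A\<close> applied to the cross product of the basis vectors, so that the only trace of \<open>H\<close> left is
  the factor \<open>det H = 1 / det A\<close>.
\<close>
lemma scalar_curvature_eq:
  "scalar_curvature G g p = (2 * minors2 (N ** A) - (trace (N ** A))\<^sup>2 / 2) / det A"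
proof -
  have AH: "A ** H = mat 1" using HA by (simp add: matrix_left_right_inverse)
  have "det H * det A = 1" using HA by (metis det_mul det_I)
  then have dH: "det H = 1 / det A" by (metis div_by_0 nonzero_eq_divide_eq mult_zero_right zero_neq_one)
  have HH: "H *v cross3 (H *v x) (H *v y) = det H *\<^sub>R cross3 x y" for x y
    using cross_matrix_mult[of H x y] by (simp add: inverse_symmetric)
  have HHA: "cross3 (H *v x) (H *v y) = det H *\<^sub>R (A *v cross3 x y)" for x y
    using arg_cong[OF HH[of x y], of "(*v) A"]
    by (simp add: matrix_vector_mul_assoc AH matrix_vector_mult_scaleR)
  have sh: "(H *v x) \<bullet> y = x \<bullet> (H *v y)" for x y
    by (metis inverse_symmetric dot_lmul_matrix vector_transpose_matrix)
  have c: "cross3 (H *v axis j 1) (H *v axis i 1) = (- det H) *\<^sub>R (A *v cross3 (axis i 1) (axis j 1))" for i j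
    using HHA[of "axis i 1" "axis j 1"] cross_skew[of "H *v axis j 1" "H *v axis i 1"] by simp
  have Hc: "H *v cross3 (H *v axis j 1) (H *v axis i 1) = (- det H) *\<^sub>R cross3 (axis i 1) (axis j 1)" for i j
    by (simp only: c matrix_vector_mult_scaleR matrix_vector_mul_assoc HA matrix_vector_mul_lid)
  have summand: "(H *v cross3 (connection_matrix *v axis i 1) (connection_matrix *v axis j 1) - connection_matrix *v (N *v cross3 (axis i 1) (axis j 1)))
       \<bullet> cross3 (H *v axis j 1) (H *v axis i 1)
     = det H * ((connection_matrix *v (N *v cross3 (axis i 1) (axis j 1))) \<bullet> (A *v cross3 (axis i 1) (axis j 1))
        - cross3 (connection_matrix *v axis i 1) (connection_matrix *v axis j 1) \<bullet> cross3 (axis i 1) (axis j 1))" for i j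
  proof -
    have "(H *v cross3 (connection_matrix *v axis i 1) (connection_matrix *v axis j 1)) \<bullet> cross3 (H *v axis j 1) (H *v axis i 1)
      = - det H * (cross3 (connection_matrix *v axis i 1) (connection_matrix *v axis j 1) \<bullet> cross3 (axis i 1) (axis j 1))"
      by (simp add: sh Hc)
    moreover have "(connection_matrix *v (N *v cross3 (axis i 1) (axis j 1))) \<bullet> cross3 (H *v axis j 1) (H *v axis i 1)
      = - det H * ((connection_matrix *v (N *v cross3 (axis i 1) (axis j 1))) \<bullet> (A *v cross3 (axis i 1) (axis j 1)))"
      by (simp add: c)
    ultimately show ?thesis by (simp add: inner_diff_left algebra_simps)
  qed
  have 1: "(\<Sum>i\<in>UNIV. \<Sum>j\<in>UNIV. (connection_matrix *v (N *v cross3 (axis i 1) (axis j 1))) \<bullet> (A *v cross3 (axis i 1) (axis j 1)))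
      = 2 * trace (connection_matrix ** (N ** A))"
  proof -
    have "(\<Sum>i\<in>UNIV. \<Sum>j\<in>UNIV. (B *v cross3 (axis i 1) (axis j 1)) \<bullet> (A *v cross3 (axis i 1) (axis j 1)))
       = 2 * trace (B ** A)" for B
    proof -
      note s = symmetric_entries[OF A, of 2 1] symmetric_entries[OF A, of 3 1] symmetric_entries[OF A, of 3 2]
      show ?thesis by (simp add: mat3 trace_def s algebra_simps)
    qed
    from this[of "connection_matrix ** N"] show ?thesis by (simp add: matrix_vector_mul_assoc matrix_mul_assoc)
  qed
  have 2: "(\<Sum>i\<in>UNIV. \<Sum>j\<in>UNIV. cross3 (connection_matrix *v axis i 1) (connection_matrix *v axis j 1) \<bullet> cross3 (axis i 1) (axis j 1))
      = 2 * minors2 connection_matrix"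
    by (simp add: mat3 minors2_def algebra_simps)
  have 3: "2 * trace (half_trace_minus X ** X) - 2 * minors2 (half_trace_minus X)
      = 2 * minors2 X - (trace X)\<^sup>2 / 2" for X
    by (simp add: mat3 minors2_def half_trace_minus_def mat_def trace_def power2_eq_square field_simps)
  show ?thesis
    unfolding scalar_curvature_eq_sum summand
    unfolding sum_distrib_left[symmetric] sum_subtractf 1 2 3 by (simp add: dH)
qed

end

text \<open>
  The characteristic equation, written as eigenvalue times the product of the other two.
\<close>
lemma eigenvalue_char_poly:
  fixes X :: "real^3^3"
  assumes "X *v f = l *\<^sub>R f" "f \<noteq> 0"
  shows "l * (minors2 X - l * (trace X - l)) = det X"
proof -
  have "(X - mat l) *v f = 0"
    using assms by (simp add: mat3 mat_def algebra_simps)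
  then have "det (X - mat l) = 0"
    using assms(2) by (metis det_nz_iff_inj inj_matrix_vector_mult injD matrix_vector_mult_0_right invertible_det_nz)
  then show ?thesis
    by (simp add: det_3 minors2_def trace_def sum_3 mat_def algebra_simps)
qed

text \<open>
  Otherwise moving from \<open>f\<close> a little against \<open>M f\<close> would make the form negative.
\<close>
lemma psd_null_vector:
  fixes M :: "real^3^3"
  assumes M: "transpose M = M" "\<And>v. 0 \<le> v \<bullet> (M *v v)" and f: "f \<bullet> (M *v f) = 0"
  shows "M *v f = 0"
proof (rule ccontr)
  let ?w = "M *v f"
  assume w: "?w \<noteq> 0"
  have s: "f \<bullet> (M *v ?w) = ?w \<bullet> ?w"
    by (metis M(1) dot_lmul_matrix vector_transpose_matrix)
  define c where "c = ?w \<bullet> (M *v ?w)"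
  have q: "0 \<le> - 2 * t * (?w \<bullet> ?w) + t\<^sup>2 * c" for t
  proof -
    have "0 \<le> (f - t *\<^sub>R ?w) \<bullet> (M *v (f - t *\<^sub>R ?w))" by (rule M(2))
    also have "\<dots> = - 2 * t * (?w \<bullet> ?w) + t\<^sup>2 * c"
      by (simp add: matrix_vector_mult_diff_distrib matrix_vector_mult_scaleR inner_diff_left inner_diff_right f s c_def
        inner_commute power2_eq_square algebra_simps)
    finally show ?thesis .
  qed
  have pos: "0 < ?w \<bullet> ?w" using w by simp
  have c: "0 \<le> c" unfolding c_def by (rule M(2))
  have "0 \<le> - 2 * ((?w \<bullet> ?w) / (c + 1)) * (?w \<bullet> ?w) + ((?w \<bullet> ?w) / (c + 1))\<^sup>2 * c" by (rule q)
  also have "\<dots> = (?w \<bullet> ?w)\<^sup>2 / (c + 1) * (c / (c + 1) - 2)"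
  proof -
    have "- 2 * (W / k) * W + (W / k)\<^sup>2 * c = W\<^sup>2 / k * (c / k - 2)" if "k \<noteq> 0" for W k :: real
      using that by (simp add: power2_eq_square field_simps)
    then show ?thesis using c by (metis add_nonneg_pos zero_less_one less_irrefl)
  qed
  also have "\<dots> < 0"
    using pos c by (intro mult_pos_neg) (auto simp: field_simps)
  finally show False by simp
qed

definition positive_definite :: "real^3^3 \<Rightarrow> bool" where
  "positive_definite A \<longleftrightarrow> transpose A = A \<and> (\<forall>v. v \<noteq> 0 \<longrightarrow> 0 < v \<bullet> (A *v v))"

lemma symmetric_inner: "transpose A = A \<Longrightarrow> (A *v x) \<bullet> y = x \<bullet> (A *v y)" for A :: "real^3^3"
  by (metis dot_lmul_matrix vector_transpose_matrix)

text \<open>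
  Although \<open>N A\<close> is not symmetric, it is self-adjoint for the inner product \<open>A\<close>. The largest
  eigenvalue is the maximum of the Rayleigh quotient.
\<close>
lemma max_eigenvalue:
  fixes A N :: "real^3^3"
  assumes A: "positive_definite A" and N: "transpose N = N"
  obtains l f where "f \<noteq> 0" "(N ** A) *v f = l *\<^sub>R f" "\<And>v. (A *v v) \<bullet> (N *v (A *v v)) \<le> l * (v \<bullet> (A *v v))"
proof -
  let ?q = "\<lambda>v. v \<bullet> (A *v v)" and ?Q = "\<lambda>v. (A *v v) \<bullet> (N *v (A *v v))"
  have At: "transpose A = A" and Ap: "\<And>v. v \<noteq> 0 \<Longrightarrow> 0 < ?q v" using A by (auto simp: positive_definite_def)
  have lin: "continuous_on UNIV ((*v) B)" for B :: "real^3^3"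
    by (simp add: linear_continuous_on matrix_vector_mul_bounded_linear)
  have "continuous_on (sphere 0 1) (\<lambda>v. ?Q v / ?q v)"
  proof -
    have cA: "continuous_on (sphere 0 1) ((*v) A)" by (rule continuous_on_subset[OF lin]) simp
    have cN: "continuous_on (sphere 0 1) (\<lambda>v. N *v (A *v v))"
      by (rule continuous_on_compose2[OF lin cA]) simp
    have "v \<bullet> (A *v v) \<noteq> 0" if "v \<in> sphere 0 1" for v using Ap[of v] that by fastforce
    then show ?thesis by (intro continuous_intros cA cN) blast
  qed
  moreover have "sphere 0 (1::real) \<noteq> ({} :: (real^3) set)" by simp
  ultimately obtain f where f: "f \<in> sphere 0 1" "\<And>v. v \<in> sphere 0 1 \<Longrightarrow> ?Q v / ?q v \<le> ?Q f / ?q f"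
    using continuous_attains_sup[OF compact_sphere] by blast
  define l where "l = ?Q f / ?q f"
  have f0: "f \<noteq> 0" using f by auto
  have ub: "?Q v \<le> l * ?q v" for v
  proof (cases "v = 0")
    case False
    let ?u = "(1 / norm v) *\<^sub>R v"
    have "?Q ?u / ?q ?u \<le> l" using f(2)[of ?u] False by (simp add: l_def)
    moreover have "?Q ?u / ?q ?u = ?Q v / ?q v"
      using False by (simp add: matrix_vector_mult_scaleR)
    ultimately show ?thesis using Ap[OF False] by (simp add: pos_divide_le_eq)
  qed simp
  \<comment> \<open>At the maximiser \<open>f\<close> this positive semidefinite form vanishes, so \<open>f\<close> is in its kernel.\<close>
  define M where "M = l *\<^sub>R A - A ** N ** A"
  have Mv: "M *v v = l *\<^sub>R (A *v v) - A *v (N *v (A *v v))" for v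
    by (simp add: M_def matrix_vector_mult_diff_rdistrib scaleR_matrix_vector_assoc matrix_vector_mul_assoc matrix_mul_assoc)
  have "M *v f = 0"
  proof (rule psd_null_vector)
    show "transpose M = M"
      unfolding M_def using At N
      by (simp add: matrix_transpose_mul matrix_mul_assoc vec_eq_iff transpose_def)
        (metis (no_types, lifting) matrix_transpose_mul matrix_mul_assoc transpose_def vec_lambda_beta At N)
    have Mq: "v \<bullet> (M *v v) = l * ?q v - ?Q v" for v
      by (simp add: Mv inner_diff_right symmetric_inner[OF At, symmetric])
    show "0 \<le> v \<bullet> (M *v v)" for v using ub[of v] Mq by simp
    show "f \<bullet> (M *v f) = 0" using Ap[OF f0] by (simp add: Mq l_def)
  qed
  then have "A *v (l *\<^sub>R f - N *v (A *v f)) = 0"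
    by (simp add: Mv matrix_vector_mult_diff_distrib matrix_vector_mult_scaleR)
  then have "l *\<^sub>R f - N *v (A *v f) = 0" using Ap by (metis inner_zero_right less_irrefl)
  then have "(N ** A) *v f = l *\<^sub>R f" by (simp add: matrix_vector_mul_assoc)
  then show ?thesis using that f0 ub by blast
qed

text \<open>
  Positivity of the scalar curvature forces all eigenvalues of \<open>N A\<close> to have the same sign. The bound
  on the eigenvalues, and thereby on the form \<open>A N A\<close> relative to \<open>A\<close>, comes from the same identity:
  eigenvalue times the product of the other two is the determinant, and that product is at least
  \<open>\<delta> / 2\<close>.
\<close>
lemma positive_scalar_bound:
  fixes A N :: "real^3^3"
  assumes A: "positive_definite A" and N: "transpose N = N"
    and \<delta>: "0 < \<delta>" "2 * minors2 (N ** A) - (trace (N ** A))\<^sup>2 / 2 = \<delta>"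
  shows "v \<noteq> 0 \<Longrightarrow> (A *v v) \<bullet> (N *v (A *v v)) \<noteq> 0"
    and "\<bar>(A *v v) \<bullet> (N *v (A *v v))\<bar> \<le> 2 * \<bar>det (N ** A)\<bar> / \<delta> * (v \<bullet> (A *v v))"
proof -
  let ?K = "2 * \<bar>det (N ** A)\<bar> / \<delta>" and ?X = "N ** A"
  have Ap: "\<And>v. v \<noteq> 0 \<Longrightarrow> 0 < v \<bullet> (A *v v)" using A by (auto simp: positive_definite_def)
  have ev: "\<exists>D>0. l * D = det ?X \<and> \<bar>l\<bar> \<le> ?K" if "(N ** A) *v f = l *\<^sub>R f" "f \<noteq> 0" for f l
  proof -
    \<comment> \<open>\<open>D\<close> is the product of the other two eigenvalues: \<open>l D = det\<close>, and \<open>D \<ge> \<delta> / 2\<close> by completing a square.\<close>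
    define D where "D = minors2 ?X - l * (trace ?X - l)"
    have "2 * D = \<delta> + (l - (trace ?X - l))\<^sup>2 / 2" unfolding D_def \<delta>(2)[symmetric]
      by (simp add: power2_eq_square field_simps)
    then have D: "D \<ge> \<delta> / 2" using zero_le_power2[of "l - (trace ?X - l)"] by linarith
    have e: "l * D = det ?X" using eigenvalue_char_poly[OF that] by (simp add: D_def)
    have "\<bar>l\<bar> * (\<delta> / 2) \<le> \<bar>l\<bar> * D" using D by (intro mult_left_mono) auto
    also have "\<dots> = \<bar>det ?X\<bar>" using D \<delta>(1) by (simp flip: e add: abs_mult)
    finally have "\<bar>l\<bar> \<le> ?K" using \<delta>(1) by (simp add: field_simps)
    then show ?thesis using D \<delta>(1) e by (intro exI[of _ D]) auto
  qed
  obtain l f where l: "f \<noteq> 0" "(N ** A) *v f = l *\<^sub>R f" "\<And>v. (A *v v) \<bullet> (N *v (A *v v)) \<le> l * (v \<bullet> (A *v v))"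
    using max_eigenvalue[OF A N] by blast
  have negm: "(- N) *v x = - (N *v x)" for x by (simp add: mat3)
  have Nm: "transpose (- N) = - N"
    by (simp add: vec_eq_iff transpose_def) (metis symmetric_entries[OF N])
  have "\<exists>m f'. f' \<noteq> 0 \<and> ((- N) ** A) *v f' = m *\<^sub>R f' \<and>
      (\<forall>v. (A *v v) \<bullet> ((- N) *v (A *v v)) \<le> m * (v \<bullet> (A *v v)))"
    by (rule max_eigenvalue[OF A Nm]) (intro exI conjI allI; assumption)
  then obtain m f' where m: "f' \<noteq> 0" "((- N) ** A) *v f' = m *\<^sub>R f'"
      "\<forall>v. (A *v v) \<bullet> ((- N) *v (A *v v)) \<le> m * (v \<bullet> (A *v v))" by (elim exE conjE)
  have m2: "(N ** A) *v f' = (- m) *\<^sub>R f'"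
  proof -
    have "((- N) ** A) *v f' = - ((N ** A) *v f')" by (simp add: negm flip: matrix_vector_mul_assoc)
    then show ?thesis using m(2) by (simp add: minus_equation_iff[of "(N ** A) *v f'"])
  qed
  have m3: "- m * (v \<bullet> (A *v v)) \<le> (A *v v) \<bullet> (N *v (A *v v))" for v using spec[OF m(3), of v] by (simp add: negm)
  obtain D where D: "D > 0" "l * D = det ?X" "\<bar>l\<bar> \<le> ?K" using ev[OF l(2,1)] by blast
  obtain D' where D': "D' > 0" "- m * D' = det ?X" "\<bar>- m\<bar> \<le> ?K" using ev[OF m2 m(1)] by blast
  have q0: "0 \<le> v \<bullet> (A *v v)" using Ap[of v] by (cases "v = 0") auto
  show "\<bar>(A *v v) \<bullet> (N *v (A *v v))\<bar> \<le> ?K * (v \<bullet> (A *v v))"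
  proof -
    have "l * (v \<bullet> (A *v v)) \<le> ?K * (v \<bullet> (A *v v))" using D q0 by (intro mult_right_mono) auto
    moreover have "- ?K * (v \<bullet> (A *v v)) \<le> - m * (v \<bullet> (A *v v))" using D' q0 by (intro mult_right_mono) auto
    ultimately show ?thesis using l(3)[of v] m3[of v] by linarith
  qed
  show "(A *v v) \<bullet> (N *v (A *v v)) \<noteq> 0" if "v \<noteq> 0"
  proof -
    have q: "0 < v \<bullet> (A *v v)" by (rule Ap[OF that])
    \<comment> \<open>All eigenvalues have the sign of the determinant.\<close>
    consider "det ?X > 0" | "det ?X < 0" | "det ?X = 0" by linarith
    then show ?thesis
    proof cases
      case 1
      then have "- m > 0" using D' by (metis zero_less_mult_pos2)
      then have "0 < - m * (v \<bullet> (A *v v))" using q by (intro mult_pos_pos)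
      then show ?thesis using m3[of v] by linarith
    next
      case 2
      then have "l < 0" using D by (metis mult_less_0_iff not_less_iff_gr_or_eq)
      then have "l * (v \<bullet> (A *v v)) < 0" using q by (rule mult_neg_pos)
      then show ?thesis using l(3)[of v] by linarith
    next
      case 3
      then have "l = 0" "m = 0" using D D' by auto
      then have Q0: "(A *v v) \<bullet> (N *v (A *v v)) = 0" for v using l(3)[of v] m3[of v] by simp
      have "surj ((*v) A)"
        using Ap by (metis inner_zero_right less_irrefl linear_injective_imp_surjective linear_injective_0 matrix_vector_mul_linear)
      then have N0: "u \<bullet> (N *v u) = 0" for u using Q0 by (metis surjD)
      have "(u + w) \<bullet> (N *v (u + w)) = 2 * (u \<bullet> (N *v w))" for u w
        using symmetric_inner[OF N, of u w] N0[of u] N0[of w]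
        by (simp add: matrix_vector_right_distrib inner_add_left inner_add_right inner_commute)
      then have "u \<bullet> (N *v w) = 0" for u w using N0[of "u + w"] by simp
      then have "N *v w = 0" for w by (metis inner_eq_zero_iff)
      then have "N = 0" by (simp add: matrix_eq)
      then have "\<delta> = 0" using \<delta>(2) by (simp add: minors2_def trace_def)
      then show ?thesis using \<delta>(1) by simp
    qed
  qed
qed

section \<open>Metrics of positive scalar curvature and fixed volume\<close>

lemma matrix_norm_bound:
  fixes A :: "real^3^3"
  assumes "\<And>v. norm (A *v v) \<le> C * norm v"
  shows "norm A \<le> 9 * C"
proof -
  have e: "\<bar>A $ i $ j\<bar> \<le> C" for i j
  proof -
    have "A $ i $ j = (A *v axis j 1) $ i"
      using exhaust_3[of j] by (auto simp: mat3)
    then have "\<bar>A $ i $ j\<bar> \<le> norm (A *v axis j 1)" by (metis component_le_norm_cart)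
    also have "\<dots> \<le> C" using assms[of "axis j 1"] by (simp add: norm_axis_1)
    finally show ?thesis .
  qed
  have "norm (A $ i) \<le> 3 * C" for i
  proof -
    have "norm (A $ i) \<le> (\<Sum>j\<in>UNIV. \<bar>A $ i $ j\<bar>)" by (rule norm_le_l1_cart)
    also have "\<dots> \<le> (\<Sum>j\<in>(UNIV :: 3 set). C)" by (intro sum_mono e)
    finally show ?thesis by simp
  qed
  moreover have "norm A \<le> (\<Sum>i\<in>UNIV. norm (A $ i))"
    unfolding norm_vec_def by (rule L2_set_le_sum) simp
  ultimately have "norm A \<le> (\<Sum>i\<in>(UNIV :: 3 set). 3 * C)"
    by (meson order_trans sum_mono)
  then show ?thesis by simp
qed

text \<open>
  Compactness: a degenerate limit would have determinant zero.
\<close>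
lemma positive_definite_lower_bound:
  assumes V: "V \<noteq> 0"
  obtains c where "c > 0"
    "\<And>A v. positive_definite A \<Longrightarrow> det A = V \<Longrightarrow> norm A \<le> B \<Longrightarrow> c * (norm v)\<^sup>2 \<le> v \<bullet> (A *v v)"
proof -
  define S where "S = {A :: real^3^3. \<forall>i j. A $ i $ j = A $ j $ i} \<inter> {A. \<forall>w. 0 \<le> w \<bullet> (A *v w)} \<inter> {A. det A = V} \<inter> cball 0 B"
  have "closed {A :: real^3^3. \<forall>i j. A $ i $ j = A $ j $ i}"
    by (intro closed_Collect_all closed_Collect_eq continuous_intros)
  moreover have "closed {A :: real^3^3. \<forall>w. 0 \<le> w \<bullet> (A *v w)}"
    unfolding inner_vec_def sum_3 matrix_vector_mult_def vec_lambda_beta inner_real_def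
    by (intro closed_Collect_all closed_Collect_le continuous_intros)
  moreover have "closed {A :: real^3^3. det A = V}"
    unfolding det_3 by (intro closed_Collect_eq continuous_intros)
  ultimately have "compact S"
    unfolding S_def by (intro closed_Int_compact closed_Int compact_cball)
  then have comp: "compact (S \<times> sphere (0 :: real^3) 1)" by (intro compact_Times compact_sphere)
  have cont: "continuous_on (S \<times> sphere (0 :: real^3) 1) (\<lambda>z. snd z \<bullet> (fst z *v snd z))"
    unfolding inner_vec_def sum_3 matrix_vector_mult_def vec_lambda_beta inner_real_def
    by (intro continuous_intros)
  have pd: "A \<in> S" if "positive_definite A" "det A = V" "norm A \<le> B" for A
    using that unfolding S_def positive_definite_def
    by (auto simp: symmetric_entries) (metis inner_zero_left less_eq_real_def)
  have "\<exists>c>0. \<forall>A\<in>S. \<forall>v\<in>sphere 0 1. c \<le> v \<bullet> (A *v v)"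
  proof (cases "S = {}")
    case True then show ?thesis by (intro exI[of _ 1]) auto
  next
    case False
    then have "S \<times> sphere (0 :: real^3) 1 \<noteq> {}" by simp
    from continuous_attains_inf[OF comp this cont]
    obtain z where z: "z \<in> S \<times> sphere 0 1"
      "\<forall>y\<in>S \<times> sphere 0 1. snd z \<bullet> (fst z *v snd z) \<le> snd y \<bullet> (fst y *v snd y)" by blast
    obtain A v where Av: "z = (A, v)" by (cases z)
    have A: "transpose A = A" "\<And>w. 0 \<le> w \<bullet> (A *v w)" "det A \<noteq> 0" and v: "norm v = 1"
      using z(1) V unfolding Av S_def by (auto simp: transpose_def vec_eq_iff)
    have "v \<bullet> (A *v v) \<noteq> 0"
    proof
      assume "v \<bullet> (A *v v) = 0"
      then have "A *v v = 0" by (rule psd_null_vector[OF A(1,2)])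
      moreover have "inj ((*v) A)" using A(3) by (simp add: det_nz_iff_inj invertible_det_nz inj_matrix_vector_mult)
      ultimately have "v = 0" by (metis injD matrix_vector_mult_0_right)
      then show False using v by simp
    qed
    then have "0 < v \<bullet> (A *v v)" using A(2)[of v] by simp
    then show ?thesis using z(2) unfolding Av by (intro exI[of _ "v \<bullet> (A *v v)"]) auto
  qed
  then obtain c where c: "c > 0" "\<And>A v. A \<in> S \<Longrightarrow> norm v = 1 \<Longrightarrow> c \<le> v \<bullet> (A *v v)" by auto
  show ?thesis
  proof (rule that[OF c(1)])
    fix A v assume A: "positive_definite A" "det A = V" "norm A \<le> B"
    show "c * (norm v)\<^sup>2 \<le> v \<bullet> (A *v v)"
    proof (cases "v = 0")
      case False
      let ?u = "(1 / norm v) *\<^sub>R v"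
      have "c \<le> ?u \<bullet> (A *v ?u)" using False by (intro c pd A) simp
      also have "\<dots> = (v \<bullet> (A *v v)) / (norm v)\<^sup>2"
        by (simp add: matrix_vector_mult_scaleR power2_eq_square)
      finally show ?thesis using False by (simp add: pos_le_divide_eq)
    qed simp
  qed
qed

text \<open>
  If some metric has positive scalar curvature, then \<open>N\<close> is definite, and \<open>m |u|\<^sup>2 \<le> |u \<bullet> N u|\<close>.
  Applied to \<open>u = A v\<close>, the eigenvalue bound becomes \<open>m |A v|\<^sup>2 \<le> K (v \<bullet> A v)\<close> and bounds \<open>A\<close>. The factor
  \<open>det A\<close> cancels in \<open>K\<close>, so the upper bound depends on \<open>N\<close> and \<open>\<epsilon>\<close> only; the lower bound uses the
  fixed determinant.
\<close>
theorem positive_scalar_curvature_bounds: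
  assumes N: "transpose N = N" and V: "V > 0" and \<epsilon>: "\<epsilon> > 0"
  obtains c C where "c > 0" "C > 0" "\<And>A v. positive_definite A \<Longrightarrow> det A = V \<Longrightarrow>
     \<epsilon> \<le> (2 * minors2 (N ** A) - (trace (N ** A))\<^sup>2 / 2) / det A \<Longrightarrow>
     c * (norm v)\<^sup>2 \<le> v \<bullet> (A *v v) \<and> v \<bullet> (A *v v) \<le> C * (norm v)\<^sup>2"
proof -
  let ?R = "\<lambda>A. (2 * minors2 (N ** A) - (trace (N ** A))\<^sup>2 / 2) / det A"
  have surjA: "\<exists>v. u = A *v v" if "positive_definite A" for A and u :: "real^3"
  proof -
    have "surj ((*v) A)"
      using that unfolding positive_definite_def by (metis inner_zero_right less_irrefl linear_injective_imp_surjective linear_injective_0 matrix_vector_mul_linear)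
    then show ?thesis by (metis surjD)
  qed
  show ?thesis
  proof (cases "\<exists>A. positive_definite A \<and> det A = V \<and> \<epsilon> \<le> ?R A")
    case False
    then show ?thesis by (intro that[of 1 1]) auto
  next
    case True
    then obtain A0 where A0: "positive_definite A0" "det A0 = V" "\<epsilon> \<le> ?R A0" by blast
    have Npos: "u \<bullet> (N *v u) \<noteq> 0" if u: "u \<noteq> 0" for u
    proof -
      have "0 < 2 * minors2 (N ** A0) - (trace (N ** A0))\<^sup>2 / 2"
        using A0 V \<epsilon> by (metis less_le_trans zero_less_divide_iff not_less_iff_gr_or_eq)
      note pb = positive_scalar_bound(1)[OF A0(1) N this refl]
      obtain v where v: "u = A0 *v v" using surjA[OF A0(1)] by blast
      then have "v \<noteq> 0" using u by auto
      then show ?thesis using pb unfolding v by blast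
    qed
    have "continuous_on (sphere 0 1) (\<lambda>u. \<bar>u \<bullet> (N *v u)\<bar>)"
      unfolding inner_vec_def sum_3 matrix_vector_mult_def vec_lambda_beta inner_real_def
      by (intro continuous_intros)
    moreover have "sphere 0 (1::real) \<noteq> ({} :: (real^3) set)" by simp
    ultimately obtain u0 where u0: "u0 \<in> sphere 0 1" "\<forall>u\<in>sphere 0 1. \<bar>u0 \<bullet> (N *v u0)\<bar> \<le> \<bar>u \<bullet> (N *v u)\<bar>"
      using continuous_attains_inf[OF compact_sphere] by blast
    define m where "m = \<bar>u0 \<bullet> (N *v u0)\<bar>"
    have "u0 \<noteq> 0" using u0(1) by auto
    then have m: "m > 0" using Npos unfolding m_def by simp
    have mb: "m * (norm u)\<^sup>2 \<le> \<bar>u \<bullet> (N *v u)\<bar>" for u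
    proof (cases "u = 0")
      case False
      have "m \<le> \<bar>((1 / norm u) *\<^sub>R u) \<bullet> (N *v ((1 / norm u) *\<^sub>R u))\<bar>"
        unfolding m_def by (rule bspec[OF u0(2)]) (use False in simp)
      also have "\<dots> = \<bar>u \<bullet> (N *v u)\<bar> / (norm u)\<^sup>2"
        by (simp add: matrix_vector_mult_scaleR power2_eq_square abs_mult)
      finally show ?thesis using False by (simp add: pos_le_divide_eq)
    qed simp
    define K where "K = 2 * \<bar>det N\<bar> / \<epsilon>"
    define C where "C = K / m + 1"
    have K0: "K \<ge> 0" unfolding K_def using \<epsilon> by simp
    have Cpos: "C > 0" unfolding C_def using K0 m by (simp add: add_nonneg_pos)
    have up: "norm (A *v v) \<le> C * norm v" if A: "positive_definite A" "det A = V" "\<epsilon> \<le> ?R A" for A v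
    proof (cases "A *v v = 0")
      case False
      define \<delta> where "\<delta> = 2 * minors2 (N ** A) - (trace (N ** A))\<^sup>2 / 2"
      have \<delta>: "\<epsilon> * V \<le> \<delta>" using A(2,3) V unfolding \<delta>_def by (simp add: pos_le_divide_eq)
      have \<delta>0: "0 < \<delta>" using \<delta> V \<epsilon> by (metis less_le_trans mult_pos_pos)
      have q0: "0 \<le> v \<bullet> (A *v v)" using A(1) unfolding positive_definite_def by (metis inner_zero_left less_eq_real_def)
      have "m * (norm (A *v v))\<^sup>2 \<le> \<bar>(A *v v) \<bullet> (N *v (A *v v))\<bar>" by (rule mb)
      also have "\<dots> \<le> 2 * \<bar>det (N ** A)\<bar> / \<delta> * (v \<bullet> (A *v v))"
        by (rule positive_scalar_bound(2)[OF A(1) N \<delta>0 \<delta>_def[symmetric]])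
      also have "\<dots> \<le> K * (v \<bullet> (A *v v))"
      proof (rule mult_right_mono[OF _ q0])
        have "2 * \<bar>det (N ** A)\<bar> / \<delta> \<le> 2 * \<bar>det (N ** A)\<bar> / (\<epsilon> * V)"
          using \<delta> V \<epsilon> by (intro divide_left_mono) (auto intro: mult_pos_pos \<delta>0)
        also have "\<dots> = K" using V \<epsilon> A(2) by (simp add: K_def det_mul abs_mult)
        finally show "2 * \<bar>det (N ** A)\<bar> / \<delta> \<le> K" .
      qed
      also have "\<dots> \<le> K * (norm v * norm (A *v v))"
        by (intro mult_left_mono K0) (rule norm_cauchy_schwarz)
      finally have "(m * norm (A *v v)) * norm (A *v v) \<le> (K * norm v) * norm (A *v v)"
        by (simp add: power2_eq_square mult.assoc)
      then have "m * norm (A *v v) \<le> K * norm v" using False by simp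
      then have "norm (A *v v) \<le> K / m * norm v" using m by (simp add: field_simps)
      then show ?thesis unfolding C_def by (simp add: distrib_right add_increasing2)
    qed (use Cpos in simp)
    have "V \<noteq> 0" using V by simp
    then obtain c where c: "c > 0"
      "\<And>A v. positive_definite A \<Longrightarrow> det A = V \<Longrightarrow> norm A \<le> 9 * C \<Longrightarrow> c * (norm v)\<^sup>2 \<le> v \<bullet> (A *v v)"
      using positive_definite_lower_bound[of V "9 * C"] by blast
    show ?thesis
    proof (rule that[OF c(1) Cpos])
      fix A v assume A: "positive_definite A" "det A = V" "\<epsilon> \<le> ?R A"
      have "v \<bullet> (A *v v) \<le> norm v * norm (A *v v)" by (rule norm_cauchy_schwarz)
      also have "\<dots> \<le> norm v * (C * norm v)" by (intro mult_left_mono up A) simp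
      finally have "v \<bullet> (A *v v) \<le> C * (norm v)\<^sup>2" by (simp add: power2_eq_square mult_ac)
      then show "c * (norm v)\<^sup>2 \<le> v \<bullet> (A *v v) \<and> v \<bullet> (A *v v) \<le> C * (norm v)\<^sup>2"
        using c(2)[OF A(1,2) matrix_norm_bound[OF up[OF A]]] by simp
    qed
  qed
qed

section \<open>Deck transformations of simply connected coverings\<close>

text \<open>
  One evenly covered set serves all points of the fibre.
\<close>
lemma covering_local_section:
  fixes p :: "'g::topological_space \<Rightarrow> 'm::topological_space"
  assumes cov: "covering_space UNIV p UNIV"
  obtains T where "open T" "y \<in> T"
    "\<And>a. p a \<in> T \<Longrightarrow> \<exists>q. continuous_on T q \<and> q (p a) = a \<and> (\<forall>z\<in>T. p (q z) = z)"
proof -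
  have "\<forall>x\<in>UNIV. \<exists>T. x \<in> T \<and> openin (top_of_set UNIV) T \<and> (\<exists>v. \<Union>v = UNIV \<inter> p -` T \<and>
      (\<forall>u\<in>v. openin (top_of_set UNIV) u) \<and> pairwise disjnt v \<and> (\<forall>u\<in>v. \<exists>q. homeomorphism u T p q))"
    using cov unfolding covering_space_def by (elim conjE)
  from bspec[OF this UNIV_I, of y]
  obtain T v where T: "y \<in> T" "openin (top_of_set UNIV) T" and v: "\<Union>v = UNIV \<inter> p -` T"
    and hom: "\<forall>u\<in>v. \<exists>q. homeomorphism u T p q" by (elim exE conjE)
  have T: "y \<in> T" "open T" using T by simp_all
  show ?thesis
  proof (rule that[OF T(2,1)])
    fix a assume "p a \<in> T"
    then obtain u where u: "u \<in> v" "a \<in> u" using v by blast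
    then obtain q where "homeomorphism u T p q" using hom by blast
    then show "\<exists>q. continuous_on T q \<and> q (p a) = a \<and> (\<forall>z\<in>T. p (q z) = z)"
      using u by (auto simp: homeomorphism_def)
  qed
qed

lemma covering_locally_injective:
  fixes p :: "'g::topological_space \<Rightarrow> 'm::topological_space"
  assumes cov: "covering_space UNIV p UNIV"
  obtains W where "open W" "x \<in> W" "inj_on p W"
proof -
  obtain T u q where "x \<in> T" "openin (top_of_set UNIV) T" "homeomorphism T u p q"
    using covering_space_local_homeomorphism[OF cov UNIV_I, of x] by metis
  then show ?thesis using that[of T]
    by (auto simp: homeomorphism_def intro: inj_on_inverseI)
qed

text \<open>
  The set where two lifts agree is open because the covering is locally injective, and closed
  because its total space is Hausdorff.
\<close>
lemma covering_lift_unique: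
  fixes p :: "'g::t2_space \<Rightarrow> 'm::topological_space" and g1 g2 :: "'a::topological_space \<Rightarrow> 'g"
  assumes cov: "covering_space UNIV p UNIV" and T: "connected T"
    and g: "continuous_on T g1" "continuous_on T g2" "\<And>x. x \<in> T \<Longrightarrow> p (g1 x) = p (g2 x)"
    and a: "a \<in> T" "g1 a = g2 a" and x: "x \<in> T"
  shows "g1 x = g2 x"
proof -
  let ?S = "{x\<in>T. g1 x = g2 x}"
  have "openin (top_of_set T) ?S"
  proof (subst openin_subopen, safe)
    fix x assume x: "x \<in> T" "g1 x = g2 x"
    obtain W where W: "open W" "g1 x \<in> W" "inj_on p W" using covering_locally_injective[OF cov] .
    let ?A = "(T \<inter> g1 -` W) \<inter> (T \<inter> g2 -` W)"
    have "openin (top_of_set T) ?A"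
      using g W by (intro openin_Int continuous_openin_preimage_gen) auto
    moreover have "x \<in> ?A" using x W by auto
    moreover have "?A \<subseteq> ?S" using g W by (auto simp: inj_on_def)
    ultimately show "\<exists>A. openin (top_of_set T) A \<and> x \<in> A \<and> A \<subseteq> ?S" by blast
  qed
  moreover have "openin (top_of_set T) (T - ?S)"
  proof (subst openin_subopen, intro ballI)
    fix x assume "x \<in> T - ?S"
    then have x: "x \<in> T" "g1 x \<noteq> g2 x" by auto
    then obtain A B where AB: "open A" "open B" "g1 x \<in> A" "g2 x \<in> B" "A \<inter> B = {}"
      by (metis (no_types, lifting) hausdorff)
    let ?A = "(T \<inter> g1 -` A) \<inter> (T \<inter> g2 -` B)"
    have "openin (top_of_set T) ?A"
      using g AB by (intro openin_Int continuous_openin_preimage_gen) auto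
    moreover have "x \<in> ?A" using x AB by auto
    moreover have "?A \<subseteq> T - ?S" using AB by auto
    ultimately show "\<exists>A. openin (top_of_set T) A \<and> x \<in> A \<and> A \<subseteq> T - ?S" by blast
  qed
  ultimately have "?S = {} \<or> ?S = T"
    using T unfolding connected_clopen closedin_def by auto
  then show ?thesis using a x by blast
qed

text \<open>
  Prescribing the value of the lift at an arbitrary point of \<open>R\<close> makes the property additive.
\<close>
definition liftable :: "('g::topological_space \<Rightarrow> 'm) \<Rightarrow> ('a::topological_space \<Rightarrow> 'm) \<Rightarrow> 'a set \<Rightarrow> bool" where
  "liftable p f R \<longleftrightarrow> (\<forall>z\<in>R. \<forall>a. p a = f z \<longrightarrow>
     (\<exists>k. continuous_on R k \<and> (\<forall>w\<in>R. p (k w) = f w) \<and> k z = a))"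

text \<open>
  The lift over the second set is chosen to agree with the first at one common point, hence on the
  connected intersection.
\<close>
lemma liftable_Un:
  fixes p :: "'g::t2_space \<Rightarrow> 'm::topological_space"
  assumes cov: "covering_space UNIV p UNIV"
    and R: "liftable p f R1" "liftable p f R2" "closed R1" "closed R2"
    and C: "connected (R1 \<inter> R2)" "R1 \<inter> R2 \<noteq> {}"
  shows "liftable p f (R1 \<union> R2)"
proof -
  have *: "\<exists>k. continuous_on (R1 \<union> R2) k \<and> (\<forall>w\<in>R1 \<union> R2. p (k w) = f w) \<and> k z = a"
    if R: "liftable p f R1" "liftable p f R2" "closed R1" "closed R2"
      and C: "connected (R1 \<inter> R2)" "R1 \<inter> R2 \<noteq> {}" and z: "z \<in> R1" "p a = f z" for R1 R2 z a
  proof -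
    obtain k1 where k1: "continuous_on R1 k1" "\<And>w. w \<in> R1 \<Longrightarrow> p (k1 w) = f w" "k1 z = a"
      using R(1) z unfolding liftable_def by blast
    obtain c where c: "c \<in> R1" "c \<in> R2" using C by blast
    obtain k2 where k2: "continuous_on R2 k2" "\<And>w. w \<in> R2 \<Longrightarrow> p (k2 w) = f w" "k2 c = k1 c"
      using R(2) c k1 unfolding liftable_def by metis
    have eq: "k1 w = k2 w" if "w \<in> R1" "w \<in> R2" for w
      by (rule covering_lift_unique[OF cov C(1), of k1 k2 c])
         (use c that k1 k2 in \<open>auto intro: continuous_on_subset\<close>)
    have "continuous_on (R1 \<union> R2) (\<lambda>w. if w \<in> R1 then k1 w else k2 w)"
      using R(3,4) k1 k2 eq by (intro continuous_on_If) auto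
    moreover have "\<forall>w\<in>R1 \<union> R2. p (if w \<in> R1 then k1 w else k2 w) = f w" using k1 k2 by auto
    ultimately show ?thesis using k1 z by (intro exI[of _ "\<lambda>w. if w \<in> R1 then k1 w else k2 w"]) auto
  qed
  show ?thesis unfolding liftable_def
  proof safe
    fix z a assume "z \<in> R1" "p a = f z"
    then show "\<exists>k. continuous_on (R1 \<union> R2) k \<and> (\<forall>w\<in>R1 \<union> R2. p (k w) = f w) \<and> k z = a"
      using *[OF R C] by blast
  next
    fix z a assume "z \<in> R2" "p a = f z"
    then show "\<exists>k. continuous_on (R1 \<union> R2) k \<and> (\<forall>w\<in>R1 \<union> R2. p (k w) = f w) \<and> k z = a"
      using *[OF R(2,1,4,3), of z a] C by (simp add: Un_commute Int_commute)
  qed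
qed

text \<open>
  A bisection in each direction reduces the claim to small rectangles.
\<close>
lemma liftable_rectangle:
  fixes p :: "'g::t2_space \<Rightarrow> 'm::topological_space" and f :: "real \<times> real \<Rightarrow> 'm"
  assumes cov: "covering_space UNIV p UNIV" and f: "continuous_on UNIV f"
    and ab: "a \<le> b" "c \<le> d"
  shows "liftable p f ({a..b} \<times> {c..d})"
proof -
  \<comment> \<open>Small rectangles map into an evenly covered set.\<close>
  have small: "\<exists>e>0. \<forall>a b c d. a \<le> x \<and> x \<le> b \<and> b - a < e \<and> c \<le> y \<and> y \<le> d \<and> d - c < e
      \<longrightarrow> liftable p f ({a..b} \<times> {c..d})" for x y
  proof -
    obtain T where T: "open T" "f (x, y) \<in> T"
      "\<And>a. p a \<in> T \<Longrightarrow> \<exists>q. continuous_on T q \<and> q (p a) = a \<and> (\<forall>z\<in>T. p (q z) = z)"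
      using covering_local_section[OF cov] by blast
    have "open (f -` T)" using f T by (simp add: continuous_on_open_vimage)
    then obtain e where e: "e > 0" "ball (x, y) e \<subseteq> f -` T"
      using T by (meson open_contains_ball vimageI)
    have "liftable p f ({a..b} \<times> {c..d})"
      if h: "a \<le> x \<and> x \<le> b \<and> b - a < e/2 \<and> c \<le> y \<and> y \<le> d \<and> d - c < e/2" for a b c d
    proof -
      have sub: "f z \<in> T" if "z \<in> {a..b} \<times> {c..d}" for z
      proof -
        have "dist (x, y) z \<le> dist x (fst z) + dist y (snd z)"
          by (cases z) (simp add: dist_Pair_Pair sqrt_sum_squares_le_sum)
        also have "\<dots> < e" using that h by (auto simp: dist_real_def)
        finally show ?thesis using e by auto
      qed
      show ?thesis unfolding liftable_def
      proof (intro ballI allI impI)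
        fix z u assume z: "z \<in> {a..b} \<times> {c..d}" "p u = f z"
        then obtain q where q: "continuous_on T q" "q (p u) = u" "\<And>z. z\<in>T \<Longrightarrow> p (q z) = z"
          using T(3)[of u] sub by auto
        have "continuous_on ({a..b} \<times> {c..d}) (q \<circ> f)"
          using sub f q by (intro continuous_on_compose) (auto intro: continuous_on_subset)
        then show "\<exists>k. continuous_on ({a..b} \<times> {c..d}) k \<and> (\<forall>w\<in>{a..b} \<times> {c..d}. p (k w) = f w) \<and> k z = u"
          using q sub z by (intro exI[of _ "q \<circ> f"]) auto
      qed
    qed
    then show ?thesis using e by (intro exI[of _ "e/2"]) auto
  qed
  \<comment> \<open>Subdividing the second side; the width \<open>e\<close> shrinks only finitely often.\<close>
  have strip: "\<exists>e>0. \<forall>a b. a \<le> x \<and> x \<le> b \<and> b - a < e \<longrightarrow> liftable p f ({a..b} \<times> {c..d})" for x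
    using \<open>c \<le> d\<close>
  proof (induction c d rule: Bolzano)
    case (trans c1 c2 c3)
    then obtain e1 e2 where e: "e1 > 0" "e2 > 0"
      "\<And>a b. a \<le> x \<and> x \<le> b \<and> b - a < e1 \<longrightarrow> liftable p f ({a..b} \<times> {c1..c2})"
      "\<And>a b. a \<le> x \<and> x \<le> b \<and> b - a < e2 \<longrightarrow> liftable p f ({a..b} \<times> {c2..c3})" by blast
    have "liftable p f ({a..b} \<times> {c1..c3})" if "a \<le> x" "x \<le> b" "b - a < min e1 e2" for a b
    proof -
      have "{c1..c3} = {c1..c2} \<union> {c2..c3}" using trans by auto
      then have *: "{a..b} \<times> {c1..c3} = {a..b} \<times> {c1..c2} \<union> {a..b} \<times> {c2..c3}" by auto
      have i: "({a..b} \<times> {c1..c2}) \<inter> ({a..b} \<times> {c2..c3}) = {a..b} \<times> {c2}" using trans by auto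
      show ?thesis unfolding * using e that
        by (intro liftable_Un[OF cov], unfold i) (auto intro!: connected_Times closed_Times)
    qed
    then show ?case using e by (intro exI[of _ "min e1 e2"]) auto
  next
    case (local y)
    then show ?case using small[of x y] by meson
  qed
  show ?thesis using \<open>a \<le> b\<close>
  proof (induction a b rule: Bolzano)
    case (trans a1 a2 a3)
    have "{a1..a3} = {a1..a2} \<union> {a2..a3}" using trans by auto
    then have *: "{a1..a3} \<times> {c..d} = {a1..a2} \<times> {c..d} \<union> {a2..a3} \<times> {c..d}" by auto
    have i: "({a1..a2} \<times> {c..d}) \<inter> ({a2..a3} \<times> {c..d}) = {a2} \<times> {c..d}" using trans by auto
    show ?case unfolding * using trans ab
      by (intro liftable_Un[OF cov], unfold i) (auto intro!: connected_Times closed_Times)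
  next
    case (local x)
    then show ?case using strip[of x] by blast
  qed
qed

lemma covering_lift_square:
  fixes p :: "'g::t2_space \<Rightarrow> 'm::topological_space" and f :: "real \<times> real \<Rightarrow> 'm"
  assumes cov: "covering_space UNIV p UNIV" and f: "continuous_on ({0..1} \<times> {0..1}) f"
    and a: "p a = f (0, 0)"
  obtains k where "continuous_on ({0..1} \<times> {0..1}) k"
    "\<And>w. w \<in> {0..1} \<times> {0..1} \<Longrightarrow> p (k w) = f w" "k (0, 0) = a"
proof -
  let ?Q = "{0..1::real} \<times> {0..1::real}"
  \<comment> \<open>The retraction onto the square extends the map to the plane.\<close>
  define c :: "real \<times> real \<Rightarrow> real \<times> real" where "c = (\<lambda>w. (min 1 (max 0 (fst w)), min 1 (max 0 (snd w))))"
  have c1: "continuous_on UNIV c" unfolding c_def by (intro continuous_intros)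
  have c2: "c w \<in> ?Q" for w unfolding c_def by simp
  have c3: "c w = w" if "w \<in> ?Q" for w
    using that by (cases w) (simp add: c_def)
  have "continuous_on UNIV (\<lambda>w. f (c w))"
    by (rule continuous_on_compose2[OF f c1]) (use c2 in blast)
  from liftable_rectangle[OF cov this zero_le_one zero_le_one]
  have "liftable p (\<lambda>w. f (c w)) ?Q" .
  moreover have "(0, 0) \<in> ?Q" by simp
  moreover have "p a = f (c (0, 0))" using a c3[of "(0,0)"] by simp
  ultimately obtain k where k: "continuous_on ?Q k" "\<forall>w\<in>?Q. p (k w) = f (c w)" "k (0, 0) = a"
    unfolding liftable_def by blast
  show ?thesis
  proof (rule that[OF k(1) _ k(3)])
    fix w assume "w \<in> ?Q" then show "p (k w) = f w" using k(2) c3 by metis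
  qed
qed

lemma covering_lift_path:
  fixes p :: "'g::t2_space \<Rightarrow> 'm::topological_space"
  assumes cov: "covering_space UNIV p UNIV" and f: "path f" and a: "p a = f 0"
  obtains k where "path k" "\<And>t. t \<in> {0..1} \<Longrightarrow> p (k t) = f t" "k 0 = a"
proof -
  have "continuous_on ({0..1::real} \<times> {0..1::real}) (f \<circ> fst)"
    using f unfolding path_def by (intro continuous_on_compose continuous_intros) (auto intro: continuous_on_subset)
  moreover have "p a = (f \<circ> fst) (0::real, 0::real)" using a by simp
  ultimately obtain k where k: "continuous_on ({0..1} \<times> {0..1}) k"
    "\<And>w. w \<in> {0..1} \<times> {0..1} \<Longrightarrow> p (k w) = (f \<circ> fst) w" "k (0::real, 0::real) = a"
    using covering_lift_square[OF cov] by metis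
  have "continuous_on {0..1} (k \<circ> (\<lambda>t. (t, 0)))"
    by (intro continuous_on_compose continuous_intros) (auto intro: continuous_on_subset[OF k(1)])
  then show ?thesis using k by (intro that[of "k \<circ> (\<lambda>t. (t, 0))"]) (auto simp: path_def)
qed

text \<open>
  Monodromy for a free homotopy of loops to a constant loop.
\<close>
lemma covering_loop_lift_closed:
  fixes p :: "'g::t2_space \<Rightarrow> 'm::topological_space"
  assumes cov: "covering_space UNIV p UNIV" and sc: "simply_connected (UNIV :: 'g set)"
    and \<alpha>: "path \<alpha>" "\<alpha> 0 = \<alpha> 1" and \<beta>: "path \<beta>" "\<And>t. t \<in> {0..1} \<Longrightarrow> p (\<beta> t) = p (\<alpha> t)"
  shows "\<beta> 0 = \<beta> (1::real)"
proof -
  have pc: "continuous_on UNIV p" using cov by (rule covering_space_imp_continuous)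
  have "path (\<lambda>t::real. \<alpha> 0)" by (simp add: path_def)
  then have "homotopic_loops UNIV \<alpha> (\<lambda>t. \<alpha> 0)"
    using sc \<alpha> unfolding simply_connected_def by (simp add: pathfinish_def pathstart_def)
  then obtain h where h: "continuous_on ({0..1::real} \<times> {0..1::real}) h"
      "\<And>t. t \<in> {0..1} \<Longrightarrow> h (0, t) = \<alpha> t" "\<And>t. t \<in> {0..1} \<Longrightarrow> h (1, t) = \<alpha> 0"
      "\<And>s. s \<in> {0..1} \<Longrightarrow> h (s, 0) = h (s, 1)"
    unfolding homotopic_loops pathfinish_def pathstart_def o_def by metis
  have ph: "continuous_on ({0..1} \<times> {0..1}) (\<lambda>w. p (h w))"
    by (rule continuous_on_compose2[OF pc h(1)]) simp
  have "p (\<beta> 0) = p (h (0, 0))" using \<beta>(2)[of 0] h(2)[of 0] by simp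
  from covering_lift_square[OF cov ph this] obtain k where k: "continuous_on ({0..1} \<times> {0..1}) k"
    "\<And>w. w \<in> {0..1} \<times> {0..1} \<Longrightarrow> p (k w) = p (h w)" "k (0, 0) = \<beta> 0"
    by blast
  have kl: "continuous_on {0..1} (\<lambda>t. k (0, t))" "continuous_on {0..1} (\<lambda>t. k (1, t))"
     "continuous_on {0..1} (\<lambda>s. k (s, 0))" "continuous_on {0..1} (\<lambda>s. k (s, 1))"
    by (rule continuous_on_compose2[OF k(1)]; auto intro!: continuous_intros)+
  have I: "connected {0..1::real}" by simp
  \<comment> \<open>The lift of the null homotopy starts with \<open>\<beta>\<close> and ends with a constant; its two sides lift the same path and agree at the end.\<close>
  have 1: "k (0, 1) = \<beta> 1"
    by (rule covering_lift_unique[OF cov I kl(1), of \<beta> 0]) (use \<beta> h k in \<open>auto simp: path_def\<close>)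
  have 2: "k (1, 1) = k (1, 0)"
    by (rule covering_lift_unique[OF cov I kl(2), of "\<lambda>_. k (1, 0)" 0]) (use h k in auto)
  have "k (0, 0) = k (0, 1)"
    by (rule covering_lift_unique[OF cov I kl(3,4), of 1]) (use h k 2 in auto)
  then show ?thesis using 1 k by simp
qed

lemma simply_connected_UNIV_path:
  assumes "simply_connected (UNIV :: 'g::topological_space set)"
  obtains g where "path g" "g 0 = (x::'g)" "g 1 = y"
proof -
  have "path (\<lambda>t::real. x)" "path (\<lambda>t::real. y)" by (simp_all add: path_def)
  then have "homotopic_loops UNIV (\<lambda>t::real. x) (\<lambda>t. y)"
    using assms unfolding simply_connected_def by (simp add: pathfinish_def pathstart_def)
  then obtain h where h: "continuous_on ({0..1::real} \<times> {0..1::real}) h"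
      "\<And>t. t \<in> {0..1} \<Longrightarrow> h (0, t) = x" "\<And>t. t \<in> {0..1} \<Longrightarrow> h (1, t) = y"
    unfolding homotopic_loops by metis
  have "continuous_on {0..1} (\<lambda>s. h (s, 0))"
    by (rule continuous_on_compose2[OF h(1)]) (auto intro!: continuous_intros)
  then show ?thesis using h by (intro that[of "\<lambda>s. h (s, 0)"]) (auto simp: path_def)
qed

text \<open>
  Two points of the fibre product of the covering with itself lie in the same path component. For a
  simply connected total space these components are the graphs of the deck transformations.
\<close>
definition fibre_path :: "('g::topological_space \<Rightarrow> 'm) \<Rightarrow> 'g \<times> 'g \<Rightarrow> 'g \<times> 'g \<Rightarrow> bool" where
  "fibre_path p = (\<lambda>(a, b) (x, y). \<exists>\<alpha> \<beta>. path \<alpha> \<and> path \<beta> \<and> (\<forall>t\<in>{0..1}. p (\<beta> t) = p (\<alpha> t)) \<and>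
     \<alpha> 0 = a \<and> \<beta> 0 = b \<and> \<alpha> 1 = x \<and> \<beta> 1 = y)"

lemma fibre_path_refl: "p a = p b \<Longrightarrow> fibre_path p (a, b) (a, b)"
  unfolding fibre_path_def prod.case
  by (intro exI[of _ "\<lambda>_. a"] exI[of _ "\<lambda>_. b"]) (simp add: path_def)

lemma fibre_pathI:
  assumes "path \<alpha>" "path \<beta>" "\<And>t. t \<in> {0..1} \<Longrightarrow> p (\<beta> t) = p (\<alpha> t)"
    "\<alpha> 0 = a" "\<beta> 0 = b" "\<alpha> 1 = x" "\<beta> 1 = y"
  shows "fibre_path p (a, b) (x, y)"
  using assms unfolding fibre_path_def prod.case by blast

lemma fibre_pathE:
  assumes "fibre_path p (a, b) (x, y)"
  obtains \<alpha> \<beta> where "path \<alpha>" "path \<beta>" "\<And>t. t \<in> {0..1} \<Longrightarrow> p (\<beta> t) = p (\<alpha> t)"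
    "\<alpha> 0 = a" "\<beta> 0 = b" "\<alpha> 1 = x" "\<beta> 1 = y"
  using assms unfolding fibre_path_def prod.case by blast

lemma fibre_path_swap: "fibre_path p (a, b) (x, y) \<Longrightarrow> fibre_path p (b, a) (y, x)"
  by (elim fibre_pathE) (metis fibre_pathI)

lemma fibre_path_sym: "fibre_path p (a, b) (x, y) \<Longrightarrow> fibre_path p (x, y) (a, b)"
proof (erule fibre_pathE)
  fix \<alpha> \<beta> :: "real \<Rightarrow> 'a" assume h: "path \<alpha>" "path \<beta>" "\<And>t. t \<in> {0..1} \<Longrightarrow> p (\<beta> t) = p (\<alpha> t)"
    "\<alpha> 0 = a" "\<beta> 0 = b" "\<alpha> 1 = x" "\<beta> 1 = y"
  show ?thesis
    by (rule fibre_pathI[of "reversepath \<alpha>" "reversepath \<beta>"])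
      (use h in \<open>simp_all add: path_reversepath, simp_all add: reversepath_def\<close>)
qed

lemma fibre_path_trans:
  assumes "fibre_path p (a, b) (x, y)" "fibre_path p (x, y) (u, v)"
  shows "fibre_path p (a, b) (u, v)"
proof -
  obtain \<alpha> \<beta> where h: "path \<alpha>" "path \<beta>" "\<And>t. t \<in> {0..1} \<Longrightarrow> p (\<beta> t) = p (\<alpha> t)"
    "\<alpha> 0 = a" "\<beta> 0 = b" "\<alpha> 1 = x" "\<beta> 1 = y" using fibre_pathE[OF assms(1)] by blast
  obtain \<alpha>' \<beta>' where h': "path \<alpha>'" "path \<beta>'" "\<And>t. t \<in> {0..1} \<Longrightarrow> p (\<beta>' t) = p (\<alpha>' t)"
    "\<alpha>' 0 = x" "\<beta>' 0 = y" "\<alpha>' 1 = u" "\<beta>' 1 = v" using fibre_pathE[OF assms(2)] by blast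
  show ?thesis
  proof (rule fibre_pathI[of "\<alpha> +++ \<alpha>'" "\<beta> +++ \<beta>'"])
    show "path (\<alpha> +++ \<alpha>')" "path (\<beta> +++ \<beta>')"
      using h h' by (auto simp: pathstart_def pathfinish_def intro!: path_join_imp)
    show "p ((\<beta> +++ \<beta>') t) = p ((\<alpha> +++ \<alpha>') t)" if "t \<in> {0..1}" for t
      using h(3)[of "2 * t"] h'(3)[of "2 * t - 1"] that by (simp add: joinpaths_def)
  qed (use h h' in \<open>simp_all add: joinpaths_def\<close>)
qed

text \<open>
  The path components of the fibre product are graphs: two points over the same \<open>x\<close> are joined by a
  loop in the first factor, whose lift in the second factor is closed.
\<close>
lemma fibre_path_unique:
  fixes p :: "'g::t2_space \<Rightarrow> 'm::topological_space"
  assumes cov: "covering_space UNIV p UNIV" and sc: "simply_connected (UNIV :: 'g set)"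
    and "fibre_path p (a, b) (x, y)" "fibre_path p (a, b) (x, z)"
  shows "y = z"
proof -
  have "fibre_path p (x, y) (x, z)" using assms fibre_path_sym fibre_path_trans by metis
  from fibre_pathE[OF this] obtain \<alpha> \<beta> where h: "path \<alpha>" "path \<beta>" "\<And>t. t \<in> {0..1} \<Longrightarrow> p (\<beta> t) = p (\<alpha> t)"
    "\<alpha> 0 = x" "\<beta> 0 = y" "\<alpha> 1 = x" "\<beta> 1 = z" by blast
  have "\<beta> 0 = \<beta> 1"
    by (rule covering_loop_lift_closed[OF cov sc h(1) _ h(2)]) (use h in simp_all)
  then show ?thesis using h by simp
qed

text \<open>
  The universal covering is normal. The deck transformation that takes \<open>a\<close> to \<open>b\<close> is the function
  whose graph is the path component of \<open>(a, b)\<close> in the fibre product; swapping the factors gives its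
  inverse.
\<close>
theorem deck_transitive:
  fixes p :: "'g::t2_space \<Rightarrow> 'm::topological_space"
  assumes cov: "covering_space UNIV p UNIV" and sc: "simply_connected (UNIV :: 'g set)"
    and lpc: "\<And>(x::'g) V. open V \<Longrightarrow> x \<in> V \<Longrightarrow> \<exists>W. open W \<and> x \<in> W \<and> W \<subseteq> V \<and> path_connected W"
    and ab: "p a = p b"
  obtains \<delta> where "\<delta> \<in> deck p" "\<delta> a = b"
proof -
  have pc: "continuous_on UNIV p" using cov by (rule covering_space_imp_continuous)
  have ex: "\<exists>y. fibre_path p (a, b) (x, y)" if ab: "p a = p b" for a b x
  proof -
    obtain \<alpha> where \<alpha>: "path \<alpha>" "\<alpha> 0 = a" "\<alpha> 1 = x" by (rule simply_connected_UNIV_path[OF sc])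
    have "path (p \<circ> \<alpha>)" by (intro path_continuous_image \<alpha> continuous_on_subset[OF pc]) auto
    moreover have "p b = (p \<circ> \<alpha>) 0" using \<alpha> ab by simp
    ultimately obtain \<beta> where "path \<beta>" "\<And>t. t \<in> {0..1} \<Longrightarrow> p (\<beta> t) = (p \<circ> \<alpha>) t" "\<beta> 0 = b"
      by (rule covering_lift_path[OF cov]) auto
    then have "fibre_path p (a, b) (x, \<beta> 1)" using \<alpha>
      by (intro fibre_pathI[of \<alpha> \<beta>]) simp_all
    then show ?thesis by blast
  qed
  define d where "d = (\<lambda>a b x. THE y. fibre_path p (a, b) (x, y))"
  have d_eq: "d a b x = y" if "fibre_path p (a, b) (x, y)" for a b x y
    unfolding d_def using that fibre_path_unique[OF cov sc] by blast
  have d: "fibre_path p (a, b) (x, d a b x)" if "p a = p b" for a b x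
  proof -
    obtain y where "fibre_path p (a, b) (x, y)" using ex[OF \<open>p a = p b\<close>] by blast
    then show ?thesis using d_eq by simp
  qed
  have fp: "p y = p x" if "fibre_path p (a, b) (x, y)" for a b x y
    using that by (rule fibre_pathE) (metis atLeastAtMost_iff order_refl zero_le_one)
  \<comment> \<open>Near \<open>x\<close> the map is a local section of the covering composed with the covering.\<close>
  have cont: "continuous_on UNIV (d a b)" if ab: "p a = p b" for a b
  proof (subst continuous_on_eq_continuous_at, simp, intro ballI)
    fix x
    have pd: "p (d a b x) = p x" using fp[OF d[OF ab]] by simp
    obtain T where T: "open T" "p x \<in> T"
      "\<And>a. p a \<in> T \<Longrightarrow> \<exists>q. continuous_on T q \<and> q (p a) = a \<and> (\<forall>z\<in>T. p (q z) = z)"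
      using covering_local_section[OF cov] by blast
    then obtain q where q: "continuous_on T q" "q (p x) = d a b x" "\<And>z. z\<in>T \<Longrightarrow> p (q z) = z"
      by (metis pd)
    have "open (p -` T)" using pc T by (simp add: continuous_on_open_vimage)
    then obtain W where W: "open W" "x \<in> W" "W \<subseteq> p -` T" "path_connected W" using lpc T by (meson vimageI)
    have eq: "d a b x' = q (p x')" if x': "x' \<in> W" for x'
    proof (rule d_eq)
      obtain c where c: "path c" "path_image c \<subseteq> W" "c 0 = x" "c 1 = x'"
        using W(4) W(2) x' unfolding path_connected_def pathstart_def pathfinish_def by blast
      have cT: "p (c t) \<in> T" if "t \<in> {0..1}" for t
        using c(2) W(3) that unfolding path_image_def by blast
      have "path (q \<circ> (p \<circ> c))"
        by (intro path_continuous_image c continuous_on_subset[OF q(1)] continuous_on_subset[OF pc])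
          (use cT in \<open>auto simp: path_image_def\<close>)
      then have "fibre_path p (x, d a b x) (x', q (p x'))"
        using c q cT by (intro fibre_pathI[of c "q \<circ> (p \<circ> c)"]) simp_all
      then show "fibre_path p (a, b) (x', q (p x'))" using d[OF ab] fibre_path_trans by metis
    qed
    have "continuous_on W (q \<circ> p)"
      using W by (intro continuous_on_compose continuous_on_subset[OF pc] continuous_on_subset[OF q(1)]) auto
    then have "continuous_on W (d a b)" using eq by (simp cong: continuous_on_cong)
    then show "isCont (d a b) x" using W by (simp add: continuous_on_eq_continuous_at)
  qed
  have inv: "d b a (d a b x) = x" if "p a = p b" for a b x
    by (rule d_eq, rule fibre_path_swap, rule d[OF that])
  have "inv_into UNIV (d a b) = d b a"
    by (rule inv_equality) (use inv ab in auto)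
  then have "homeomorphism UNIV UNIV (d a b) (inv_into UNIV (d a b))"
    using cont ab inv by (auto simp: homeomorphism_def) (metis rangeI)+
  moreover have "p \<circ> d a b = p" using fp[OF d[OF ab]] by (simp add: fun_eq_iff)
  ultimately have "d a b \<in> deck p" by (simp add: deck_def)
  moreover have "d a b a = b" by (rule d_eq, rule fibre_path_refl, rule ab)
  ultimately show ?thesis using that by blast
qed

section \<open>Smooth and Lipschitz functions\<close>

lemma frechet_derivative_cong_open:
  assumes "open S" "x \<in> S" "\<And>x. x \<in> S \<Longrightarrow> f x = g x"
  shows "frechet_derivative f (at x) = frechet_derivative g (at x)"
    and "f differentiable (at x) \<longleftrightarrow> g differentiable (at x)"
proof -
  have "(f has_derivative f') (at x) \<longleftrightarrow> (g has_derivative f') (at x)" for f'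
    using has_derivative_transform_within_open[of f f' x UNIV S g]
      has_derivative_transform_within_open[of g f' x UNIV S f] assms by auto
  then show "frechet_derivative f (at x) = frechet_derivative g (at x)"
    "f differentiable (at x) \<longleftrightarrow> g differentiable (at x)"
    unfolding frechet_derivative_def differentiable_def by simp_all
qed

lemma C_k_cong:
  assumes "open S" "\<And>x. x \<in> S \<Longrightarrow> f x = g x"
  shows "C_k k S f \<longleftrightarrow> C_k k S g"
  using assms(2)
proof (induction k arbitrary: f g)
  case 0
  then show ?case by (simp cong: continuous_on_cong)
next
  case (Suc k)
  have "C_k k S (\<lambda>x. frechet_derivative f (at x) b) \<longleftrightarrow> C_k k S (\<lambda>x. frechet_derivative g (at x) b)" for b
    by (rule Suc.IH) (use frechet_derivative_cong_open(1)[OF assms(1) _ Suc.prems] in auto)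
  then show ?case using frechet_derivative_cong_open(2)[OF assms(1) _ Suc.prems] by simp
qed

lemma C_k_bounded_linear:
  assumes "open S" "bounded_linear L" "C_k k S f"
  shows "C_k k S (\<lambda>x. L (f x))"
  using assms(3)
proof (induction k arbitrary: f)
  case 0
  then show ?case using assms(2) by (simp add: bounded_linear.continuous_on)
next
  case (Suc k)
  have d: "((\<lambda>x. L (f x)) has_derivative (\<lambda>h. L (frechet_derivative f (at x) h))) (at x)" if "x \<in> S" for x
    using Suc.prems that assms(2) by (simp add: bounded_linear.has_derivative frechet_derivative_works[THEN iffD1])
  have "C_k k S (\<lambda>x. frechet_derivative (\<lambda>x. L (f x)) (at x) b)" if "b \<in> Basis" for b
  proof -
    have "C_k k S (\<lambda>x. L (frechet_derivative f (at x) b))" using Suc that by simp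
    then show ?thesis
      using C_k_cong[OF assms(1), of "\<lambda>x. frechet_derivative (\<lambda>x. L (f x)) (at x) b" "\<lambda>x. L (frechet_derivative f (at x) b)" k]
        frechet_derivative_at[OF d] by metis
  qed
  then show ?case using d by (auto simp: differentiable_def)
qed

lemma C_k_const: "C_k k S (\<lambda>x. c)"
  by (induction k arbitrary: c) (simp_all add: frechet_derivative_const)

lemma C_infinity_has_derivative:
  assumes "C_infinity S f" "x \<in> S"
  shows "(f has_derivative frechet_derivative f (at x)) (at x)"
proof -
  have "C_k (Suc 0) S f" using assms unfolding C_infinity_def by blast
  then show ?thesis using assms(2) by (simp add: frechet_derivative_works[THEN iffD1])
qed

definition lipschitz_at :: "('a::metric_space \<Rightarrow> 'b::metric_space) \<Rightarrow> 'a \<Rightarrow> bool" where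
  "lipschitz_at f x \<longleftrightarrow> (\<exists>r>0. \<exists>L. L-lipschitz_on (cball x r) f)"

text \<open>
  The partial derivatives are bounded on a compact ball, and their sum bounds the operator norm.
\<close>
lemma C_1_lipschitz_at:
  assumes "open S" "x0 \<in> S" "C_k (Suc 0) S f"
  shows "lipschitz_at f x0"
proof -
  obtain r where r: "r > 0" "cball x0 r \<subseteq> S" using assms open_contains_cball by blast
  have d: "(f has_derivative frechet_derivative f (at x)) (at x)" if "x \<in> cball x0 r" for x
    using assms(3) r that by (auto simp: frechet_derivative_works[THEN iffD1])
  have "\<exists>M. \<forall>x\<in>cball x0 r. norm (frechet_derivative f (at x) b) \<le> M" if "b \<in> Basis" for b
  proof -
    have "continuous_on (cball x0 r) (\<lambda>x. frechet_derivative f (at x) b)"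
      using assms(3) r that by (auto intro: continuous_on_subset)
    then have "bounded ((\<lambda>x. frechet_derivative f (at x) b) ` cball x0 r)"
      by (intro compact_imp_bounded compact_continuous_image compact_cball)
    then show ?thesis unfolding bounded_iff by blast
  qed
  then obtain M where M: "\<And>b x. b \<in> Basis \<Longrightarrow> x \<in> cball x0 r \<Longrightarrow> norm (frechet_derivative f (at x) b) \<le> M b"
    by metis
  have M0: "0 \<le> M b" if "b \<in> Basis" for b using M[OF that, of x0] r by (smt (verit) centre_in_cball norm_ge_zero)
  have on: "onorm (frechet_derivative f (at x)) \<le> (\<Sum>b\<in>Basis. M b)" if x: "x \<in> cball x0 r" for x
  proof (rule onorm_bound)
    show "0 \<le> (\<Sum>b\<in>Basis. M b)" by (intro sum_nonneg M0)
    fix h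
    have lin: "linear (frechet_derivative f (at x))" using d[OF x] by (rule has_derivative_linear)
    have "frechet_derivative f (at x) h = frechet_derivative f (at x) (\<Sum>b\<in>Basis. (h \<bullet> b) *\<^sub>R b)"
      by (simp add: euclidean_representation)
    also have "\<dots> = (\<Sum>b\<in>Basis. (h \<bullet> b) *\<^sub>R frechet_derivative f (at x) b)"
      by (simp add: linear_sum[OF lin] linear_scale[OF lin])
    also have "norm \<dots> \<le> (\<Sum>b\<in>Basis. norm h * M b)"
      by (rule sum_norm_le) (auto intro!: mult_mono M[OF _ x] Basis_le_norm)
    also have "\<dots> = (\<Sum>b\<in>Basis. M b) * norm h" by (simp add: sum_distrib_left mult.commute)
    finally show "norm (frechet_derivative f (at x) h) \<le> (\<Sum>b\<in>Basis. M b) * norm h" .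
  qed
  have "(\<Sum>b\<in>Basis. M b)-lipschitz_on (cball x0 r) f"
  proof (rule lipschitz_onI)
    fix x y assume "x \<in> cball x0 r" "y \<in> cball x0 r"
    then have "norm (f x - f y) \<le> (\<Sum>b\<in>Basis. M b) * norm (x - y)"
      using d on by (intro differentiable_bound[of "cball x0 r"]) (auto intro: has_derivative_at_withinI)
    then show "dist (f x) (f y) \<le> (\<Sum>b\<in>Basis. M b) * dist x y" by (simp add: dist_norm)
  qed (intro sum_nonneg M0)
  then show ?thesis unfolding lipschitz_at_def using r by blast
qed

lemma lipschitz_at_isCont: "lipschitz_at f x \<Longrightarrow> isCont f x"
proof -
  assume "lipschitz_at f x"
  then obtain r L where r: "r > 0" "L-lipschitz_on (cball x r) f" unfolding lipschitz_at_def by blast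
  have "continuous_on (ball x r) f"
    by (rule continuous_on_subset[OF lipschitz_on_continuous_on[OF r(2)]]) auto
  then show ?thesis using r(1) by (simp add: continuous_on_eq_continuous_at)
qed

lemma lipschitz_at_common:
  assumes "lipschitz_at f x" "lipschitz_at g x"
  obtains r L M where "r > 0" "L-lipschitz_on (cball x r) f" "M-lipschitz_on (cball x r) g"
proof -
  obtain r L r' M where "r > 0" "L-lipschitz_on (cball x r) f" "r' > 0" "M-lipschitz_on (cball x r') g"
    using assms unfolding lipschitz_at_def by blast
  then show ?thesis
    by (intro that[of "min r r'" L M]) (auto intro: lipschitz_on_subset simp: subset_cball)
qed

lemma lipschitz_at_add:
  fixes f g :: "'a::metric_space \<Rightarrow> 'b::real_normed_vector"
  assumes "lipschitz_at f x" "lipschitz_at g x"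
  shows "lipschitz_at (\<lambda>x. f x + g x) x"
  using lipschitz_at_common[OF assms] lipschitz_on_add unfolding lipschitz_at_def by metis

lemma lipschitz_at_mult:
  fixes f g :: "'a::metric_space \<Rightarrow> real"
  assumes "lipschitz_at f x" "lipschitz_at g x"
  shows "lipschitz_at (\<lambda>x. f x * g x) x"
proof -
  obtain r L M where r: "r > 0" and L: "L-lipschitz_on (cball x r) f" and M: "M-lipschitz_on (cball x r) g"
    using lipschitz_at_common[OF assms] .
  have L0: "L \<ge> 0" "M \<ge> 0" using L M lipschitz_on_nonneg by auto
  have fb: "\<bar>f y\<bar> \<le> \<bar>f x\<bar> + L * r" if y: "y \<in> cball x r" for y
  proof -
    have "dist (f y) (f x) \<le> L * dist y x" by (rule lipschitz_onD[OF L]) (use y r in auto)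
    also have "\<dots> \<le> L * r" using y L0 by (intro mult_left_mono) (auto simp: dist_commute)
    finally show ?thesis by (auto simp: dist_real_def)
  qed
  have gb: "\<bar>g y\<bar> \<le> \<bar>g x\<bar> + M * r" if y: "y \<in> cball x r" for y
  proof -
    have "dist (g y) (g x) \<le> M * dist y x" by (rule lipschitz_onD[OF M]) (use y r in auto)
    also have "\<dots> \<le> M * r" using y L0 by (intro mult_left_mono) (auto simp: dist_commute)
    finally show ?thesis by (auto simp: dist_real_def)
  qed
  let ?F = "\<bar>f x\<bar> + L * r" and ?G = "\<bar>g x\<bar> + M * r"
  have "(?F * M + ?G * L)-lipschitz_on (cball x r) (\<lambda>x. f x * g x)"
  proof (rule lipschitz_onI)
    fix y z assume yz: "y \<in> cball x r" "z \<in> cball x r"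
    have "\<bar>f y * g y - f z * g z\<bar> = \<bar>f y * (g y - g z) + g z * (f y - f z)\<bar>" by (simp add: algebra_simps)
    also have "\<dots> \<le> \<bar>f y\<bar> * \<bar>g y - g z\<bar> + \<bar>g z\<bar> * \<bar>f y - f z\<bar>" by (metis abs_mult abs_triangle_ineq)
    also have "\<dots> \<le> ?F * (M * dist y z) + ?G * (L * dist y z)"
      using fb[OF yz(1)] gb[OF yz(2)] lipschitz_onD[OF L yz] lipschitz_onD[OF M yz] L0 r
      by (intro add_mono mult_mono) (auto simp: dist_real_def)
    finally show "dist (f y * g y) (f z * g z) \<le> (?F * M + ?G * L) * dist y z"
      by (simp add: dist_real_def algebra_simps)
  qed (use L0 r in auto)
  then show ?thesis unfolding lipschitz_at_def using r by blast
qed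

lemma lipschitz_at_cong:
  assumes "lipschitz_at f x" "open S" "x \<in> S" "\<And>y. y \<in> S \<Longrightarrow> g y = f y"
  shows "lipschitz_at g x"
proof -
  obtain r L where r: "r > 0" "L-lipschitz_on (cball x r) f" using assms(1) unfolding lipschitz_at_def by blast
  obtain e where e: "e > 0" "cball x e \<subseteq> S" using assms open_contains_cball by blast
  have "L-lipschitz_on (cball x (min r e)) g"
    by (rule lipschitz_on_transform[OF lipschitz_on_subset[OF r(2)]]) (use e assms(4) in auto)
  then show ?thesis unfolding lipschitz_at_def using r(1) e(1) by (meson min_less_iff_conj)
qed

lemma lipschitz_at_vec:
  fixes f :: "'a::metric_space \<Rightarrow> real^3"
  assumes "\<And>i. lipschitz_at (\<lambda>x. f x $ i) x"
  shows "lipschitz_at f x"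
proof -
  have "lipschitz_at (\<lambda>y. f y $ i *\<^sub>R axis i 1 :: real^3) x" for i
  proof -
    obtain r L where r: "r > 0" "L-lipschitz_on (cball x r) (\<lambda>x. f x $ i)" using assms[of i] unfolding lipschitz_at_def by blast
    have "L-lipschitz_on (cball x r) (\<lambda>y. f y $ i *\<^sub>R axis i 1 :: real^3)"
    proof (rule lipschitz_onI)
      fix y z assume "y \<in> cball x r" "z \<in> cball x r"
      then have "dist (f y $ i) (f z $ i) \<le> L * dist y z" by (rule lipschitz_onD[OF r(2)])
      then show "dist (f y $ i *\<^sub>R axis i 1 :: real^3) (f z $ i *\<^sub>R axis i 1) \<le> L * dist y z"
        by (simp add: dist_norm norm_axis_1 flip: scaleR_diff_left)
    qed (rule lipschitz_on_nonneg[OF r(2)])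
    then show ?thesis unfolding lipschitz_at_def using r by blast
  qed
  then have "lipschitz_at (\<lambda>y. f y $ 1 *\<^sub>R axis 1 1 + f y $ 2 *\<^sub>R axis 2 1 + f y $ 3 *\<^sub>R axis 3 1 :: real^3) x"
    by (intro lipschitz_at_add)
  moreover have "f y $ 1 *\<^sub>R axis 1 1 + f y $ 2 *\<^sub>R axis 2 1 + f y $ 3 *\<^sub>R axis 3 1 = f y" for y
    by (simp add: vec_eq_iff forall_3 axis_def)
  ultimately show ?thesis by simp
qed

section \<open>Left-invariant fields in charts\<close>

definition frame_matrix :: "'g lie_group_data \<Rightarrow> ('g \<Rightarrow> real^3) \<Rightarrow> 'g \<Rightarrow> real^3^3" where
  "frame_matrix G \<kappa> p = (\<chi> i j. frame G j (\<lambda>q. \<kappa> q $ i) p)"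

locale lie_chart =
  fixes G :: "'g::topological_space lie_group_data" and U :: "'g set" and \<kappa> :: "'g \<Rightarrow> real^3"
  assumes lie: "lie_group G" and chart: "(U, \<kappa>) \<in> atlas G"
begin

abbreviation "\<psi> \<equiv> inv_into U \<kappa>"

lemma chart_homeo: "open U" "open (\<kappa> ` U)" "homeomorphism U (\<kappa> ` U) \<kappa> \<psi>"
  using lie chart unfolding lie_group_def is_chart_def by auto

lemma chart_inj: "inj_on \<kappa> U"
  using chart_homeo(3) by (metis homeomorphism_def inj_on_inverseI)

lemma \<psi>_\<kappa> [simp]: "p \<in> U \<Longrightarrow> \<psi> (\<kappa> p) = p"
  using chart_inj by simp

lemma \<kappa>_\<psi> [simp]: "x \<in> \<kappa> ` U \<Longrightarrow> \<kappa> (\<psi> x) = x"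
  by (rule f_inv_into_f)

lemma \<psi>_in [simp]: "x \<in> \<kappa> ` U \<Longrightarrow> \<psi> x \<in> U"
  by (rule inv_into_into)

lemma chart_continuous: "continuous_on U \<kappa>" "continuous_on (\<kappa> ` U) \<psi>"
  using chart_homeo(3) by (auto simp: homeomorphism_def)

lemma open_chart_image: 
  assumes "open W" "W \<subseteq> U" shows "open (\<kappa> ` W)"
proof -
  have "\<kappa> ` W = \<kappa> ` U \<inter> \<psi> -` W" using assms(2) by (auto simp: subset_iff image_iff)
  then show ?thesis using continuous_open_preimage[OF chart_continuous(2) chart_homeo(2) assms(1)] by simp
qed

lemma open_chart_preimage:
  assumes "open V" "V \<subseteq> \<kappa> ` U" shows "open (\<psi> ` V)"
proof -
  have "\<psi> ` V = U \<inter> \<kappa> -` V" using assms(2) by (auto simp: subset_iff image_iff) (metis \<psi>_\<kappa> imageI)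
  then show ?thesis using continuous_open_preimage[OF chart_continuous(1) chart_homeo(1) assms(1)] by simp
qed

lemma group_G: "group G" "carrier G = UNIV"
  using lie unfolding lie_group_def by auto

end

lemma lie_group_chart_at:
  assumes "lie_group G"
  obtains U \<kappa> where "(U, \<kappa>) \<in> atlas G" "p \<in> U"
proof -
  have "p \<in> \<Union> (fst ` atlas G)" using assms unfolding lie_group_def by simp
  then show ?thesis using that by auto
qed

lemma lie_group_locally_path_connected:
  fixes G :: "'g::topological_space lie_group_data"
  assumes "lie_group G" "open V" "x \<in> (V :: 'g set)"
  shows "\<exists>W. open W \<and> x \<in> W \<and> W \<subseteq> V \<and> path_connected W"
proof -
  obtain U \<kappa> where c: "(U, \<kappa>) \<in> atlas G" "x \<in> U" using lie_group_chart_at[OF assms(1)] .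
  interpret lie_chart G U \<kappa> by unfold_locales (use assms c in auto)
  have "open (\<kappa> ` (U \<inter> V))" using assms(2) chart_homeo by (intro open_chart_image open_Int) auto
  moreover have "\<kappa> x \<in> \<kappa> ` (U \<inter> V)" using c(2) assms(3) by blast
  ultimately obtain r where r: "r > 0" "ball (\<kappa> x) r \<subseteq> \<kappa> ` (U \<inter> V)" by (rule openE)
  let ?W = "\<psi> ` ball (\<kappa> x) r"
  have sub: "ball (\<kappa> x) r \<subseteq> \<kappa> ` U" using r by auto
  have "open ?W" using sub by (intro open_chart_preimage) auto
  moreover have "x \<in> ?W" using r c(2) by (intro image_eqI[of _ _ "\<kappa> x"]) auto
  moreover have "?W \<subseteq> V"
  proof
    fix q assume "q \<in> ?W"
    then obtain y where y: "y \<in> ball (\<kappa> x) r" "q = \<psi> y" by blast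
    then obtain q' where "q' \<in> U \<inter> V" "y = \<kappa> q'" using r by blast
    then show "q \<in> V" using y by simp
  qed
  moreover have "path_connected ?W"
    by (intro path_connected_continuous_image continuous_on_subset[OF chart_continuous(2) sub] convex_imp_path_connected convex_ball)
  ultimately show ?thesis by blast
qed

context lie_chart
begin

abbreviation "unit_chart_dom \<equiv> fst (chart1 G)"
abbreviation "unit_chart \<equiv> snd (chart1 G)"
abbreviation "unit_chart_inv \<equiv> inv_into (fst (chart1 G)) (snd (chart1 G))"
abbreviation "unit_coord \<equiv> snd (chart1 G) \<one>\<^bsub>G\<^esub>"

lemma unit_chart: "(unit_chart_dom, unit_chart) \<in> atlas G" "\<one>\<^bsub>G\<^esub> \<in> unit_chart_dom"
  using lie unfolding lie_group_def by simp_all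

lemma lie_chart_unit: "lie_chart G unit_chart_dom unit_chart"
  by unfold_locales (rule lie, rule unit_chart)

text \<open>
  The smoothness of multiplication in the definition of a Lie group, for one choice of charts.
\<close>
lemma smooth_mult:
  assumes "(V, \<eta>) \<in> atlas G" "(V', \<eta>') \<in> atlas G" "(W, \<zeta>) \<in> atlas G"
  shows "C_infinity {(x, y). x \<in> \<eta> ` V \<and> y \<in> \<eta>' ` V' \<and> inv_into V \<eta> x \<otimes>\<^bsub>G\<^esub> inv_into V' \<eta>' y \<in> W}
          (\<lambda>(x, y). \<zeta> (inv_into V \<eta> x \<otimes>\<^bsub>G\<^esub> inv_into V' \<eta>' y))"
proof -
  have H: "\<forall>(U, \<kappa>)\<in>atlas G. \<forall>(V, \<eta>)\<in>atlas G. \<forall>(W, \<zeta>)\<in>atlas G.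
        C_infinity {(x, y). x \<in> \<kappa> ` U \<and> y \<in> \<eta> ` V \<and> inv_into U \<kappa> x \<otimes>\<^bsub>G\<^esub> inv_into V \<eta> y \<in> W}
          (\<lambda>(x, y). \<zeta> (inv_into U \<kappa> x \<otimes>\<^bsub>G\<^esub> inv_into V \<eta> y))"
    using lie unfolding lie_group_def by (elim conjE)
  note 1 = bspec[OF H assms(1), unfolded prod.case]
  note 2 = bspec[OF 1 assms(2), unfolded prod.case]
  show ?thesis using bspec[OF 2 assms(3), unfolded prod.case] .
qed

text \<open>
  Multiplication in charts, with the second factor near the unit. Its partial derivative in the second
  variable at the unit is the differential of a left translation.
\<close>
definition "mult_chart = (\<lambda>(x, y). \<kappa> (\<psi> x \<otimes>\<^bsub>G\<^esub> unit_chart_inv y))"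
definition "mult_dom = {(x, y). x \<in> \<kappa> ` U \<and> y \<in> unit_chart ` unit_chart_dom \<and> \<psi> x \<otimes>\<^bsub>G\<^esub> unit_chart_inv y \<in> U}"

lemma mult_chart_smooth: "C_infinity mult_dom mult_chart"
  unfolding mult_dom_def mult_chart_def by (rule smooth_mult[OF chart unit_chart(1) chart])

lemma mult_dom_open: "open mult_dom"
  using mult_chart_smooth unfolding C_infinity_def by blast

lemma mult_unit [simp]: "p \<otimes>\<^bsub>G\<^esub> \<one>\<^bsub>G\<^esub> = p"
  using group_G by (simp add: group.is_monoid monoid.r_one)

lemma unit_chart_inv_unit [simp]: "unit_chart_inv unit_coord = \<one>\<^bsub>G\<^esub>"
  by (rule lie_chart.\<psi>_\<kappa>[OF lie_chart_unit unit_chart(2)])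

lemma mult_dom_unit: "p \<in> U \<Longrightarrow> (\<kappa> p, unit_coord) \<in> mult_dom"
  unfolding mult_dom_def using unit_chart(2) by simp

definition "translation_derivative p h = frechet_derivative mult_chart (at (\<kappa> p, unit_coord)) (0, h)"

lemma translation_has_derivative:
  assumes p: "p \<in> U"
  shows "((\<lambda>y. \<kappa> (p \<otimes>\<^bsub>G\<^esub> unit_chart_inv y)) has_derivative translation_derivative p) (at unit_coord)"
proof -
  have "((\<lambda>y. (\<kappa> p, y)) has_derivative (\<lambda>h. (0, h))) (at unit_coord)"
    by (auto intro!: derivative_eq_intros)
  from has_derivative_compose[OF this, of mult_chart] C_infinity_has_derivative[OF mult_chart_smooth mult_dom_unit[OF p]]
  have "((\<lambda>y. mult_chart (\<kappa> p, y)) has_derivative translation_derivative p) (at unit_coord)"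
    unfolding translation_derivative_def by blast
  then show ?thesis using p by (simp add: mult_chart_def)
qed

lemma translation_derivative_linear: "p \<in> U \<Longrightarrow> linear (translation_derivative p)"
  using translation_has_derivative has_derivative_linear by blast

text \<open>
  Continuity of left translation at the unit, in coordinates.
\<close>
lemma translation_open:
  assumes p: "p \<in> U" and W: "open W" "p \<in> W"
  obtains Y where "open Y" "unit_coord \<in> Y" "\<And>y. y \<in> Y \<Longrightarrow> p \<otimes>\<^bsub>G\<^esub> unit_chart_inv y \<in> W \<inter> U"
    "Y \<subseteq> unit_chart ` unit_chart_dom"
proof -
  have oW: "open (\<kappa> ` (W \<inter> U))" using W chart_homeo(1) by (intro open_chart_image) auto
  have cm: "continuous_on mult_dom mult_chart"
    using mult_chart_smooth unfolding C_infinity_def by (metis C_k.simps(1))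
  have o: "open (mult_dom \<inter> mult_chart -` (\<kappa> ` (W \<inter> U)))"
    using continuous_open_preimage[OF cm mult_dom_open oW] .
  let ?Y = "(\<lambda>y. (\<kappa> p, y)) -` (mult_dom \<inter> mult_chart -` (\<kappa> ` (W \<inter> U)))"
  show ?thesis
  proof (rule that[of ?Y])
    show "open ?Y" by (intro open_vimage o continuous_intros)
    show "unit_coord \<in> ?Y" using mult_dom_unit[OF p] p W by (simp add: mult_chart_def)
    show "?Y \<subseteq> unit_chart ` unit_chart_dom" unfolding mult_dom_def by blast
    fix y assume "y \<in> ?Y"
    then have y: "p \<otimes>\<^bsub>G\<^esub> unit_chart_inv y \<in> U" "\<kappa> (p \<otimes>\<^bsub>G\<^esub> unit_chart_inv y) \<in> \<kappa> ` (W \<inter> U)"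
      using p by (simp_all add: mult_dom_def mult_chart_def)
    then obtain q where "q \<in> W \<inter> U" "\<kappa> (p \<otimes>\<^bsub>G\<^esub> unit_chart_inv y) = \<kappa> q" by blast
    then show "p \<otimes>\<^bsub>G\<^esub> unit_chart_inv y \<in> W \<inter> U" using y(1) chart_inj by (metis IntD2 inj_onD)
  qed
qed

text \<open>
  Chain rule. The defining curve of the left-invariant field is a straight line in the chart at the
  unit, moved by a left translation.
\<close>
lemma left_field_translation:
  assumes p: "p \<in> U" and W: "open W" "p \<in> W" "\<And>q. q \<in> W \<Longrightarrow> q \<in> U \<Longrightarrow> f q = F (\<kappa> q)"
    and F: "(F has_derivative F') (at (\<kappa> p))"
  shows "left_field G v f p = F' (translation_derivative p v)"
proof -
  obtain Y where Y: "open Y" "unit_coord \<in> Y" "\<And>y. y \<in> Y \<Longrightarrow> p \<otimes>\<^bsub>G\<^esub> unit_chart_inv y \<in> W \<inter> U"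
    using translation_open[OF p W(1,2)] by metis
  let ?m = "\<lambda>y. \<kappa> (p \<otimes>\<^bsub>G\<^esub> unit_chart_inv y)"
  have l: "((\<lambda>s. unit_coord + s *\<^sub>R v) has_derivative (\<lambda>s. s *\<^sub>R v)) (at 0)"
    by (auto intro!: derivative_eq_intros)
  have m: "(?m has_derivative translation_derivative p) (at (unit_coord + 0 *\<^sub>R v))"
    using translation_has_derivative[OF p] by simp
  have Fm: "(F has_derivative F') (at (?m (unit_coord + 0 *\<^sub>R v)))" using F p by simp
  have d: "((\<lambda>s. F (?m (unit_coord + s *\<^sub>R v))) has_derivative (\<lambda>s. F' (translation_derivative p (s *\<^sub>R v)))) (at 0)"
    by (rule has_derivative_compose[OF has_derivative_compose[OF l m] Fm])
  have oS: "open ((\<lambda>s. unit_coord + s *\<^sub>R v) -` Y)" by (intro open_vimage Y continuous_intros)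
  have "((\<lambda>s. f (p \<otimes>\<^bsub>G\<^esub> unit_chart_inv (unit_coord + s *\<^sub>R v))) has_derivative (\<lambda>s. F' (translation_derivative p (s *\<^sub>R v)))) (at 0)"
    by (rule has_derivative_transform_within_open[OF d oS]) (use Y W(3) in auto)
  moreover have "F' (translation_derivative p (s *\<^sub>R v)) = F' (translation_derivative p v) * s" for s
    using linear_scale[OF translation_derivative_linear[OF p]] linear_scale[OF has_derivative_linear[OF F]] by simp
  ultimately have "((\<lambda>s. f (p \<otimes>\<^bsub>G\<^esub> unit_chart_inv (unit_coord + s *\<^sub>R v))) has_real_derivative F' (translation_derivative p v)) (at 0)"
    unfolding has_field_derivative_def by simp
  then show ?thesis unfolding left_field_def Let_def case_prod_beta by (rule DERIV_imp_deriv)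
qed

lemma frame_matrix_eq:
  assumes p: "p \<in> U"
  shows "frame_matrix G \<kappa> p = matrix (translation_derivative p)"
proof -
  have "frame G j (\<lambda>q. \<kappa> q $ i) p = translation_derivative p (axis j 1) $ i" for i j
    by (rule left_field_translation[OF p chart_homeo(1) p, where F = "\<lambda>x. x $ i" and F' = "\<lambda>x. x $ i"])
      (auto intro: bounded_linear_imp_has_derivative bounded_linear_vec_nth)
  then show ?thesis unfolding frame_matrix_def matrix_def by simp
qed

lemma frame_matrix_mult: "p \<in> U \<Longrightarrow> frame_matrix G \<kappa> p *v v = translation_derivative p v"
  by (simp add: frame_matrix_eq matrix_works translation_derivative_linear)

lemma left_field_chart:
  assumes "p \<in> U" "open W" "p \<in> W" "\<And>q. q \<in> W \<Longrightarrow> q \<in> U \<Longrightarrow> f q = F (\<kappa> q)"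
    and "(F has_derivative F') (at (\<kappa> p))"
  shows "left_field G v f p = F' (frame_matrix G \<kappa> p *v v)"
  using left_field_translation[OF assms] frame_matrix_mult[OF assms(1)] by simp

text \<open>
  Left translation by the inverse element inverts left translation, so its differential inverts
  the frame matrix.
\<close>
lemma frame_matrix_det_nonzero:
  assumes p: "p \<in> U"
  shows "det (frame_matrix G \<kappa> p) \<noteq> 0"
proof -
  let ?p' = "inv\<^bsub>G\<^esub> p"
  have ip: "?p' \<otimes>\<^bsub>G\<^esub> p = \<one>\<^bsub>G\<^esub>" and as: "?p' \<otimes>\<^bsub>G\<^esub> (p \<otimes>\<^bsub>G\<^esub> q) = q" for q
    using group_G by (simp_all add: group.l_inv group.inv_solve_left' group.is_monoid monoid.l_one flip: monoid.m_assoc)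
  obtain V \<eta> where V: "(V, \<eta>) \<in> atlas G" "?p' \<in> V" using lie_group_chart_at[OF lie] .
  interpret V: lie_chart G V \<eta> by unfold_locales (rule lie, rule V)
  define M where "M = (\<lambda>(a, x). unit_chart (inv_into V \<eta> a \<otimes>\<^bsub>G\<^esub> \<psi> x))"
  have "(\<eta> ?p', \<kappa> p) \<in> {(a, x). a \<in> \<eta> ` V \<and> x \<in> \<kappa> ` U \<and> inv_into V \<eta> a \<otimes>\<^bsub>G\<^esub> \<psi> x \<in> unit_chart_dom}"
    using V p ip unit_chart by simp
  from C_infinity_has_derivative[OF smooth_mult[OF V(1) chart unit_chart(1)] this]
  obtain M' where M': "(M has_derivative M') (at (\<eta> ?p', \<kappa> p))" unfolding M_def by blast
  have "((\<lambda>x. (\<eta> ?p', x)) has_derivative (\<lambda>h. (0, h))) (at (\<kappa> p))"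
    by (auto intro!: derivative_eq_intros)
  from has_derivative_compose[OF this M']
  have n: "((\<lambda>x. M (\<eta> ?p', x)) has_derivative (\<lambda>h. M' (0, h))) (at (\<kappa> (p \<otimes>\<^bsub>G\<^esub> unit_chart_inv unit_coord)))" by simp
  have c: "((\<lambda>y. M (\<eta> ?p', \<kappa> (p \<otimes>\<^bsub>G\<^esub> unit_chart_inv y))) has_derivative (\<lambda>h. M' (0, translation_derivative p h))) (at unit_coord)"
    by (rule has_derivative_compose[OF translation_has_derivative[OF p] n])
  obtain Y where Y: "open Y" "unit_coord \<in> Y" "\<And>y. y \<in> Y \<Longrightarrow> p \<otimes>\<^bsub>G\<^esub> unit_chart_inv y \<in> UNIV \<inter> U"
    "Y \<subseteq> unit_chart ` unit_chart_dom"
    using translation_open[OF p open_UNIV UNIV_I] by metis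
  have "((\<lambda>y. y) has_derivative (\<lambda>h. M' (0, translation_derivative p h))) (at unit_coord)"
  proof (rule has_derivative_transform_within_open[OF c Y(1,2)])
    fix y assume y: "y \<in> Y"
    then have "p \<otimes>\<^bsub>G\<^esub> unit_chart_inv y \<in> U" "y \<in> unit_chart ` unit_chart_dom" using Y by auto
    then show "M (\<eta> ?p', \<kappa> (p \<otimes>\<^bsub>G\<^esub> unit_chart_inv y)) = y"
      using V(2) lie_chart.\<kappa>_\<psi>[OF lie_chart_unit] by (simp add: M_def as)
  qed
  from has_derivative_unique[OF this has_derivative_ident]
  have id: "M' (0, translation_derivative p h) = h" for h by (rule fun_cong)
  have "inj ((*v) (frame_matrix G \<kappa> p))"
    by (rule injI) (metis id frame_matrix_mult[OF p])
  then show ?thesis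
    by (simp add: invertible_left_inverse matrix_left_invertible_injective flip: invertible_det_nz)
qed

text \<open>
  The entries are first partial derivatives of the multiplication, which is smooth.
\<close>
lemma frame_matrix_lipschitz:
  assumes p: "p \<in> U"
  shows "lipschitz_at (\<lambda>x. frame_matrix G \<kappa> (\<psi> x) $ i $ j) (\<kappa> p)"
proof -
  let ?b = "(0, axis j 1) :: (real^3) \<times> (real^3)"
  let ?f = "\<lambda>z. frechet_derivative mult_chart (at z) ?b $ i"
  have "C_k (Suc (Suc 0)) mult_dom mult_chart" using mult_chart_smooth unfolding C_infinity_def by blast
  moreover have "?b \<in> Basis" by (simp add: Basis_prod_def axis_in_Basis_iff)
  ultimately have "C_k (Suc 0) mult_dom (\<lambda>z. frechet_derivative mult_chart (at z) ?b)"
    unfolding C_k.simps(2)[of "Suc 0"] by blast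
  then have "C_k (Suc 0) mult_dom ?f"
    by (rule C_k_bounded_linear[OF mult_dom_open bounded_linear_vec_nth])
  then have "lipschitz_at ?f (\<kappa> p, unit_coord)"
    by (rule C_1_lipschitz_at[OF mult_dom_open mult_dom_unit[OF p]])
  then obtain r L where r: "r > 0" "L-lipschitz_on (cball (\<kappa> p, unit_coord) r) ?f"
    unfolding lipschitz_at_def by blast
  have "L-lipschitz_on (cball (\<kappa> p) r) (\<lambda>x. ?f (x, unit_coord))"
  proof (rule lipschitz_onI)
    fix x y assume "x \<in> cball (\<kappa> p) r" "y \<in> cball (\<kappa> p) r"
    then have "dist (?f (x, unit_coord)) (?f (y, unit_coord)) \<le> L * dist (x, unit_coord) (y, unit_coord)"
      by (intro lipschitz_onD[OF r(2)]) (auto simp: dist_Pair_Pair)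
    then show "dist (?f (x, unit_coord)) (?f (y, unit_coord)) \<le> L * dist x y" by (simp add: dist_Pair_Pair)
  qed (rule lipschitz_on_nonneg[OF r(2)])
  then have "lipschitz_at (\<lambda>x. ?f (x, unit_coord)) (\<kappa> p)" unfolding lipschitz_at_def using r(1) by blast
  then show ?thesis
  proof (rule lipschitz_at_cong[OF _ chart_homeo(2)])
    show "\<kappa> p \<in> \<kappa> ` U" using p by simp
    fix x assume "x \<in> \<kappa> ` U"
    then show "frame_matrix G \<kappa> (\<psi> x) $ i $ j = ?f (x, unit_coord)"
      by (simp add: frame_matrix_eq matrix_def translation_derivative_def)
  qed
qed

lemma frame_matrix_continuous: "continuous_on (\<kappa> ` U) (\<lambda>x. frame_matrix G \<kappa> (\<psi> x) $ i $ j)"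
  using lipschitz_at_isCont[OF frame_matrix_lipschitz] by (auto intro!: continuous_at_imp_continuous_on)

lemma smooth_fun_chart:
  assumes "smooth_fun G V f" shows "C_infinity (\<kappa> ` (V \<inter> U)) (f \<circ> \<psi>)" "open (\<kappa> ` (V \<inter> U))" "open V"
  using assms chart unfolding smooth_fun_def C_infinity_def by blast+

lemma left_field_smooth:
  assumes f: "smooth_fun G V f" and p: "p \<in> V" "p \<in> U"
  shows "left_field G v f p = frechet_derivative (f \<circ> \<psi>) (at (\<kappa> p)) (frame_matrix G \<kappa> p *v v)"
  by (rule left_field_chart[OF p(2) smooth_fun_chart(3)[OF f] p(1) _ C_infinity_has_derivative[OF smooth_fun_chart(1)[OF f]]])
    (use p in auto)

lemma smooth_fun_lipschitz_at:
  assumes f: "smooth_fun G V f" and p: "p \<in> V" "p \<in> U"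
  shows "lipschitz_at (f \<circ> \<psi>) (\<kappa> p)"
proof (rule C_1_lipschitz_at[OF smooth_fun_chart(2)[OF f]])
  show "C_k (Suc 0) (\<kappa> ` (V \<inter> U)) (f \<circ> \<psi>)" using smooth_fun_chart(1)[OF f] unfolding C_infinity_def by blast
qed (use p in auto)

lemma smooth_fun_coordinate: "smooth_fun G U (\<lambda>q. \<kappa> q $ i)"
proof -
  have H: "\<forall>(U, \<kappa>)\<in>atlas G. \<forall>(V, \<eta>)\<in>atlas G. C_infinity (\<kappa> ` (U \<inter> V)) (\<eta> \<circ> inv_into U \<kappa>)"
    using lie unfolding lie_group_def by (elim conjE)
  have "C_infinity (\<eta> ` (U \<inter> V)) ((\<lambda>q. \<kappa> q $ i) \<circ> inv_into V \<eta>)" if V: "(V, \<eta>) \<in> atlas G" for V \<eta>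
  proof -
    have "C_infinity (\<eta> ` (V \<inter> U)) (\<kappa> \<circ> inv_into V \<eta>)"
      using bspec[OF bspec[OF H V, unfolded prod.case] chart, unfolded prod.case] .
    then show ?thesis unfolding C_infinity_def Int_commute[of U V]
      using C_k_bounded_linear[OF _ bounded_linear_vec_nth[of i], of "\<eta> ` (V \<inter> U)" _ "\<kappa> \<circ> inv_into V \<eta>"]
      by (auto simp: o_def)
  qed
  then show ?thesis unfolding smooth_fun_def using chart_homeo(1) by auto
qed

end

lemma smooth_fun_continuous:
  fixes f :: "'g::t2_space \<Rightarrow> real"
  assumes "lie_group G" "smooth_fun G V f" "p \<in> V"
  shows "isCont f p"
proof -
  obtain U \<kappa> where c: "(U, \<kappa>) \<in> atlas G" "p \<in> U" using lie_group_chart_at[OF assms(1)] .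
  interpret lie_chart G U \<kappa> by unfold_locales (use assms c in auto)
  have cf: "isCont (f \<circ> \<psi>) (\<kappa> p)" using lipschitz_at_isCont[OF smooth_fun_lipschitz_at[OF assms(2,3) c(2)]] .
  have ck: "isCont \<kappa> p" using chart_continuous(1) chart_homeo(1) c(2) by (simp add: continuous_on_eq_continuous_at)
  have "isCont (\<lambda>q. (f \<circ> \<psi>) (\<kappa> q)) p" using ck cf by (rule isCont_o2)
  moreover have "eventually (\<lambda>q. (f \<circ> \<psi>) (\<kappa> q) = f q) (nhds p)"
    by (rule eventually_nhds_in_open[OF chart_homeo(1) c(2), THEN eventually_mono]) simp
  ultimately show ?thesis by (simp add: isCont_cong)
qed

lemma smooth_fun_const:
  assumes "lie_group (G :: 'g::topological_space lie_group_data)" "open V"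
  shows "smooth_fun G V (\<lambda>q. c)"
proof -
  have "C_infinity (\<kappa> ` (V \<inter> U)) ((\<lambda>q. c) \<circ> inv_into U \<kappa>)" if "(U, \<kappa>) \<in> atlas G" for U \<kappa>
  proof -
    interpret lie_chart G U \<kappa> by unfold_locales (use assms that in auto)
    have "open (\<kappa> ` (V \<inter> U))" using assms(2) chart_homeo(1) by (intro open_chart_image) auto
    then show ?thesis unfolding C_infinity_def by (simp add: o_def C_k_const)
  qed
  then show ?thesis unfolding smooth_fun_def using assms by auto
qed

section \<open>The first eigenvalue\<close>

text \<open>
  The trace of the product of a positive and a negative semidefinite matrix. Removing one rank-one
  square from \<open>H\<close> per variable only increases the sum and ends with the zero matrix.
\<close>
lemma psd_nsd_trace:
  fixes H B :: "real^3^3"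
  assumes H: "transpose H = H" "\<And>v. 0 \<le> v \<bullet> (H *v v)" and B: "\<And>z. z \<bullet> (B *v z) \<le> 0"
  shows "(\<Sum>i\<in>UNIV. \<Sum>j\<in>UNIV. H $ i $ j * B $ i $ j) \<le> 0"
proof -
  \<comment> \<open>Completing the square in the variable \<open>a\<close>; if the diagonal entry vanishes, so does the column, and \<open>x / 0 = 0\<close> leaves \<open>H\<close> unchanged.\<close>
  let ?r = "\<lambda>a (H :: real^3^3). (\<chi> i j. H $ i $ j - H $ i $ a * H $ j $ a / H $ a $ a) :: real^3^3"
  let ?s = "\<lambda>H :: real^3^3. \<Sum>i\<in>UNIV. \<Sum>j\<in>UNIV. H $ i $ j * B $ i $ j"
  have step: "transpose (?r a H) = ?r a H \<and> (\<forall>v. 0 \<le> v \<bullet> (?r a H *v v)) \<and> ?s H \<le> ?s (?r a H) \<and>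
      (\<forall>i. ?r a H $ i $ a = 0) \<and> (\<forall>b. (\<forall>i. H $ i $ b = 0) \<longrightarrow> (\<forall>i. ?r a H $ i $ b = 0))"
    if H: "transpose H = H" "\<And>v. 0 \<le> v \<bullet> (H *v v)" for a and H :: "real^3^3"
  proof -
    note sy = symmetric_entries[OF H(1)]
    have col: "H *v axis a 1 = (\<chi> i. H $ i $ a)"
      using exhaust_3[of a] by (auto simp: mat3)
    have aa: "axis a 1 \<bullet> (H *v axis a 1) = H $ a $ a" using exhaust_3[of a] by (auto simp: mat3)
    have aa0: "0 \<le> H $ a $ a" using H(2)[of "axis a 1"] aa by simp
    have z: "H $ i $ a = 0" if "H $ a $ a = 0" for i
    proof -
      have "H *v axis a 1 = 0" by (rule psd_null_vector[OF H]) (simp add: aa that)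
      then show ?thesis unfolding col by (simp add: vec_eq_iff)
    qed
    have rv: "v \<bullet> (?r a H *v v) = v \<bullet> (H *v v) - (v \<bullet> (H *v axis a 1))\<^sup>2 / H $ a $ a" for v
      unfolding col by (simp add: inner_vec_def sum_3 matrix_vector_mult_def power2_eq_square algebra_simps add_divide_distrib diff_divide_distrib)
    have psd: "0 \<le> v \<bullet> (?r a H *v v)" for v
    proof (cases "H $ a $ a = 0")
      case True then show ?thesis unfolding rv using H(2) by simp
    next
      case False
      define t where "t = (v \<bullet> (H *v axis a 1)) / H $ a $ a"
      have "0 \<le> (v - t *\<^sub>R axis a 1) \<bullet> (H *v (v - t *\<^sub>R axis a 1))" by (rule H(2))
      also have "\<dots> = v \<bullet> (H *v v) - 2 * t * (v \<bullet> (H *v axis a 1)) + t\<^sup>2 * H $ a $ a"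
        using symmetric_inner[OF H(1), of "axis a 1" v] aa
        by (simp add: matrix_vector_mult_diff_distrib matrix_vector_mult_scaleR inner_diff_left inner_diff_right
           inner_commute power2_eq_square algebra_simps)
      also have "\<dots> = v \<bullet> (?r a H *v v)" unfolding rv t_def using False by (simp add: power2_eq_square field_simps)
      finally show ?thesis .
    qed
    have "?s (?r a H) = ?s H - ((H *v axis a 1) \<bullet> (B *v (H *v axis a 1))) / H $ a $ a"
      unfolding col by (simp add: inner_vec_def sum_3 matrix_vector_mult_def algebra_simps add_divide_distrib diff_divide_distrib)
    moreover have "((H *v axis a 1) \<bullet> (B *v (H *v axis a 1))) / H $ a $ a \<le> 0"
      using B aa0 by (simp add: divide_nonpos_nonneg)
    ultimately have s: "?s H \<le> ?s (?r a H)" by simp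
    have "transpose (?r a H) = ?r a H" by (simp add: transpose_def vec_eq_iff sy[of _ _] mult.commute)
    moreover have "?r a H $ i $ a = 0" for i using z[of i] sy[of a i] by (cases "H $ a $ a = 0") auto
    moreover have "?r a H $ i $ b = 0" if "\<forall>i. H $ i $ b = 0" for i b using that sy[of b a] by simp
    ultimately show ?thesis using psd s by blast
  qed
  let ?H1 = "?r 1 H" let ?H2 = "?r 2 ?H1" let ?H3 = "?r 3 ?H2"
  note s1 = step[OF H, of 1]
  have s2: "transpose ?H2 = ?H2 \<and> (\<forall>v. 0 \<le> v \<bullet> (?H2 *v v)) \<and> ?s ?H1 \<le> ?s ?H2 \<and>
      (\<forall>i. ?H2 $ i $ 2 = 0) \<and> (\<forall>b. (\<forall>i. ?H1 $ i $ b = 0) \<longrightarrow> (\<forall>i. ?H2 $ i $ b = 0))"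
    by (rule step) (use s1 in blast)+
  have s3: "transpose ?H3 = ?H3 \<and> (\<forall>v. 0 \<le> v \<bullet> (?H3 *v v)) \<and> ?s ?H2 \<le> ?s ?H3 \<and>
      (\<forall>i. ?H3 $ i $ 3 = 0) \<and> (\<forall>b. (\<forall>i. ?H2 $ i $ b = 0) \<longrightarrow> (\<forall>i. ?H3 $ i $ b = 0))"
    by (rule step) (use s2 in blast)+
  define H3 where "H3 = ?H3"
  have a3: "\<forall>i. H3 $ i $ 3 = 0" using s3 unfolding H3_def by blast
  have a2: "\<forall>i. H3 $ i $ 2 = 0" using s3 s2 unfolding H3_def by blast
  have a1: "\<forall>i. H3 $ i $ 1 = 0" using s3 s2 s1 unfolding H3_def by blast
  have "?s H3 = 0" by (simp add: sum_3 a1 a2 a3)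
  moreover have "?s H \<le> ?s H3" unfolding H3_def using s1 s2 s3 by (meson order_trans)
  ultimately show ?thesis by simp
qed

lemma second_derivative_at_max:
  fixes \<phi> \<phi>' :: "real \<Rightarrow> real"
  assumes d: "d > 0" and \<phi>: "\<And>s. \<bar>s\<bar> < d \<Longrightarrow> (\<phi> has_real_derivative \<phi>' s) (at s)"
    and \<phi>'': "(\<phi>' has_real_derivative c) (at 0)" and max: "\<And>s. \<bar>s\<bar> < d \<Longrightarrow> \<phi> s \<le> \<phi> 0"
  shows "c \<le> 0"
proof (rule ccontr)
  assume "\<not> c \<le> 0"
  then have "0 < c" by simp
  have z: "\<phi>' 0 = 0"
    by (rule DERIV_local_max[OF \<phi>[of 0] d]) (use d max in auto)
  obtain e where e: "e > 0" "\<And>h. h > 0 \<Longrightarrow> h < e \<Longrightarrow> \<phi>' 0 < \<phi>' (0 + h)"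
    using DERIV_pos_inc_right[OF \<phi>'' \<open>0 < c\<close>] by auto
  define h where "h = min d e / 2"
  have h: "0 < h" "h < d" "h < e" using d e unfolding h_def by auto
  obtain s where s: "0 < s" "s < h" "\<phi> h - \<phi> 0 = (h - 0) * \<phi>' s"
    using MVT2[of 0 h \<phi> \<phi>'] h \<phi> by auto
  have "0 < \<phi>' s" using e(2)[of s] s h z by simp
  then have "0 < (h - 0) * \<phi>' s" using h by simp
  then show False using s(3) max[of h] h by simp
qed

text \<open>
  Product rule at a zero of one factor; the other factor need only be continuous.
\<close>
lemma has_derivative_mult_vanishing:
  fixes f g :: "'a::{perfect_space,real_normed_vector} \<Rightarrow> real"
  assumes f: "isCont f x" and g: "(g has_derivative g') (at x)" "g x = 0"
  shows "((\<lambda>y. f y * g y) has_derivative (\<lambda>h. f x * g' h)) (at x)"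
proof -
  have blg: "bounded_linear g'" using g(1) by (rule has_derivative_bounded_linear)
  have gl: "((\<lambda>y. (g y - g x - g' (y - x)) /\<^sub>R norm (y - x)) \<longlongrightarrow> 0) (at x)"
    using g(1) unfolding has_derivative_def by (simp add: netlimit_at)
  have fl: "(f \<longlongrightarrow> f x) (at x)" using f by (simp add: isCont_def)
  obtain K where K: "\<And>h. norm (g' h) \<le> norm h * K" using bounded_linear.bounded[OF blg] by blast
  have z: "((\<lambda>y. (f y - f x) * (g' (y - x) / norm (y - x))) \<longlongrightarrow> 0) (at x)"
  proof (rule Lim_null_comparison[of _ "\<lambda>y. \<bar>f y - f x\<bar> * K"])
    have "\<bar>g' (y - x)\<bar> / norm (y - x) \<le> K" if "y \<noteq> x" for y
      using K[of "y - x"] that by (simp add: divide_le_eq mult.commute)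
    then have "norm ((f y - f x) * (g' (y - x) / norm (y - x))) \<le> \<bar>f y - f x\<bar> * K" if "y \<noteq> x" for y
      using mult_left_mono[of "\<bar>g' (y - x)\<bar> / norm (y - x)" K "\<bar>f y - f x\<bar>"] that by (simp add: abs_mult)
    then show "\<forall>\<^sub>F y in at x. norm ((f y - f x) * (g' (y - x) / norm (y - x))) \<le> \<bar>f y - f x\<bar> * K"
      unfolding eventually_at_filter by (intro always_eventually allI impI)
    have "((\<lambda>y. \<bar>f y - f x\<bar> * K) \<longlongrightarrow> \<bar>f x - f x\<bar> * K) (at x)" by (intro tendsto_intros fl)
    then show "((\<lambda>y. \<bar>f y - f x\<bar> * K) \<longlongrightarrow> 0) (at x)" by simp
  qed
  have "((\<lambda>y. f y * ((g y - g x - g' (y - x)) /\<^sub>R norm (y - x)) + (f y - f x) * (g' (y - x) / norm (y - x))) \<longlongrightarrow> f x * 0 + 0) (at x)"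
    by (intro tendsto_add tendsto_mult fl gl z)
  moreover have "f y * ((g y - g x - g' (y - x)) /\<^sub>R norm (y - x)) + (f y - f x) * (g' (y - x) / norm (y - x))
     = (f y * g y - f x * g x - f x * g' (y - x)) /\<^sub>R norm (y - x)" for y
    by (simp add: g(2) divide_inverse algebra_simps)
  ultimately have "((\<lambda>y. (f y * g y - f x * g x - f x * g' (y - x)) /\<^sub>R norm (y - x)) \<longlongrightarrow> 0) (at x)" by simp
  then show ?thesis unfolding has_derivative_def
    by (simp add: netlimit_at bounded_linear_const_mult[OF blg])
qed

text \<open>
  Positivity of the determinant follows by connecting \<open>A\<close> to the identity within the positive
  definite matrices.
\<close>
lemma positive_definite_inverse:
  assumes "positive_definite A"
  shows "matrix_inv A ** A = mat 1" "transpose (matrix_inv A) = matrix_inv A" "0 \<le> v \<bullet> (matrix_inv A *v v)"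
    "det A > 0"
proof -
  have A: "transpose A = A" "\<And>v. v \<noteq> 0 \<Longrightarrow> 0 < v \<bullet> (A *v v)" using assms by (auto simp: positive_definite_def)
  have nz: "A *v v \<noteq> 0" if "v \<noteq> 0" for v using A(2)[OF that] by auto
  then have inj: "inj ((*v) A)" by (metis inj_matrix_vector_mult matrix_left_invertible_ker invertible_left_inverse)
  then have inv: "invertible A" by (simp add: invertible_left_inverse matrix_left_invertible_injective)
  then have ex: "\<exists>A'. A ** A' = mat 1 \<and> A' ** A = mat 1" unfolding invertible_def by blast
  have HA: "A ** matrix_inv A = mat 1 \<and> matrix_inv A ** A = mat 1"
    unfolding matrix_inv_def by (rule someI_ex[OF ex])
  then show 1: "matrix_inv A ** A = mat 1" by simp
  show t: "transpose (matrix_inv A) = matrix_inv A"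
  proof -
    have "transpose (matrix_inv A) ** A = mat 1" using HA A(1) by (metis matrix_transpose_mul transpose_mat)
    then show ?thesis using HA by (metis matrix_mul_assoc matrix_mul_lid matrix_mul_rid)
  qed
  show "0 \<le> v \<bullet> (matrix_inv A *v v)"
  proof -
    define w where "w = matrix_inv A *v v"
    have "v = A *v w" using HA by (simp add: w_def matrix_vector_mul_assoc)
    then have "v \<bullet> (matrix_inv A *v v) = w \<bullet> (A *v w)" by (simp add: w_def inner_commute)
    then show ?thesis using A(2)[of w] by (cases "w = 0") auto
  qed
  show "det A > 0"
  proof -
    \<comment> \<open>The determinant has no zero on the segment from the identity to \<open>A\<close>.\<close>
    define f where "f t = det ((1 - t) *\<^sub>R mat 1 + t *\<^sub>R A)" for t :: real
    have nz: "f t \<noteq> 0" if t: "0 \<le> t" "t \<le> 1" for t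
    proof -
      let ?M = "(1 - t) *\<^sub>R mat 1 + t *\<^sub>R A"
      have pos: "0 < v \<bullet> (?M *v v)" if "v \<noteq> 0" for v
      proof -
        have "v \<bullet> (?M *v v) = (1 - t) * (v \<bullet> v) + t * (v \<bullet> (A *v v))"
          by (simp add: matrix_vector_mult_add_rdistrib inner_add_right flip: scaleR_matrix_vector_assoc)
        moreover have "0 < v \<bullet> v" "0 < v \<bullet> (A *v v)" using that A(2) by auto
        ultimately show ?thesis using t
          by (cases "t = 0") (auto intro!: add_nonneg_pos)
      qed
      then have "?M *v v \<noteq> 0" if "v \<noteq> 0" for v using that by (metis inner_zero_right less_irrefl)
      then have "invertible ?M" by (metis matrix_left_invertible_ker invertible_left_inverse)
      then show ?thesis unfolding f_def by (simp add: invertible_det_nz)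
    qed
    have c: "continuous_on {0..1} f" unfolding f_def det_3 by (intro continuous_intros)
    have "f 0 = 1" "f 1 = det A" by (simp_all add: f_def)
    then show ?thesis
      using IVT2'[of f 1 0 0] c nz by (metis atLeastAtMost_iff less_eq_real_def linorder_not_le zero_le_one zero_less_one)
  qed
qed

lemma riemannian_metric_positive_definite: "riemannian_metric G g \<Longrightarrow> positive_definite (g p)"
  unfolding riemannian_metric_def positive_definite_def metric_ip_def by blast

context lie_chart
begin

text \<open>
  At a maximum of \<open>\<sigma> u\<close> the gradient vanishes and the Laplacian is the trace of the inverse metric
  against the Hessian. The factor \<open>\<sigma>\<close> treats maxima and minima together.
\<close>
lemma laplacian_at_extremum:
  assumes u: "smooth_fun G UNIV u" and p: "p \<in> U" and g: "positive_definite (g p)"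
    and \<sigma>: "\<sigma> \<noteq> 0" and max: "\<And>q. \<sigma> * u q \<le> \<sigma> * u p"
  shows "\<sigma> * laplacian G g u p \<le> 0"
proof -
  define F where "F = u \<circ> \<psi>"
  define S where "S = \<kappa> ` U"
  define J where "J = frame_matrix G \<kappa> p"
  define d where "d k x = frechet_derivative F (at x) (axis k 1)" for k :: 3 and x
  define D where "D k = frechet_derivative (d k) (at (\<kappa> p))" for k
  have S: "open S" "\<kappa> p \<in> S" using chart_homeo(2) p unfolding S_def by auto
  have CF: "C_infinity S F" using smooth_fun_chart(1)[OF u] unfolding F_def S_def by simp
  have F: "(F has_derivative frechet_derivative F (at x)) (at x)" if "x \<in> S" for x
    by (rule C_infinity_has_derivative[OF CF that])
  have "C_k (Suc (Suc 0)) S F" using CF unfolding C_infinity_def by blast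
  then have "C_k (Suc 0) S (d k)" for k
    unfolding d_def C_k.simps(2)[of "Suc 0"] by (auto simp: axis_in_Basis_iff)
  then have D: "(d k has_derivative D k) (at (\<kappa> p))" for k
    using S unfolding D_def by (simp add: frechet_derivative_works[THEN iffD1])
  have F_eq: "frechet_derivative F (at x) w = (\<Sum>k\<in>UNIV. w $ k * d k x)" if "x \<in> S" for x w
  proof -
    have lin: "linear (frechet_derivative F (at x))" using F[OF that] by (rule has_derivative_linear)
    have "w = (\<Sum>k\<in>UNIV. w $ k *\<^sub>R axis k 1)" by (simp add: vec_eq_iff sum_3 forall_3 axis_def)
    then have "frechet_derivative F (at x) w = frechet_derivative F (at x) (\<Sum>k\<in>UNIV. w $ k *\<^sub>R axis k 1)"
      by (rule arg_cong)
    also have "\<dots> = (\<Sum>k\<in>UNIV. w $ k * d k x)"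
      by (simp add: linear_sum[OF lin] linear_scale[OF lin] d_def)
    finally show ?thesis .
  qed
  \<comment> \<open>Since the gradient vanishes at \<open>p\<close>, second derivatives along the frame involve only the Hessian and no derivative of the frame.\<close>
  have "(\<lambda>h. \<sigma> * frechet_derivative F (at (\<kappa> p)) h) = (\<lambda>v. 0)"
  proof (rule differential_zero_maxmin[OF S(2,1)])
    show "((\<lambda>x. \<sigma> * F x) has_derivative (\<lambda>h. \<sigma> * frechet_derivative F (at (\<kappa> p)) h)) (at (\<kappa> p))"
      by (rule has_derivative_mult_right[OF F[OF S(2)]])
    show "(\<forall>y\<in>S. \<sigma> * F y \<le> \<sigma> * F (\<kappa> p)) \<or> (\<forall>y\<in>S. \<sigma> * F (\<kappa> p) \<le> \<sigma> * F y)"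
      using max p by (simp add: F_def)
  qed
  then have crit: "frechet_derivative F (at (\<kappa> p)) h = 0" for h using \<sigma> by (metis mult_eq_0_iff)
  then have d0: "d k (\<kappa> p) = 0" for k unfolding d_def .
  have fr: "frame G j u q = (\<Sum>k\<in>UNIV. frame_matrix G \<kappa> q $ k $ j * d k (\<kappa> q))" if q: "q \<in> U" for j q
  proof -
    have "frame G j u q = frechet_derivative F (at (\<kappa> q)) (frame_matrix G \<kappa> q *v axis j 1)"
      unfolding F_def by (rule left_field_smooth[OF u UNIV_I q])
    also have "\<dots> = (\<Sum>k\<in>UNIV. (frame_matrix G \<kappa> q *v axis j 1) $ k * d k (\<kappa> q))"
      by (rule F_eq) (use q in \<open>simp add: S_def\<close>)
    also have "frame_matrix G \<kappa> q *v axis j 1 = (\<chi> k. frame_matrix G \<kappa> q $ k $ j)"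
      using exhaust_3[of j] by (auto simp: mat3)
    finally show ?thesis by simp
  qed
  have fr0: "frame G j u p = 0" for j using fr[OF p] d0 by simp
  have fr2: "frame G i (frame G j u) p = (\<Sum>k\<in>UNIV. J $ k $ j * D k (J *v axis i 1))" for i j
    unfolding J_def
  proof (rule left_field_chart[OF p chart_homeo(1) p, where F = "\<lambda>x. \<Sum>k\<in>UNIV. frame_matrix G \<kappa> (\<psi> x) $ k $ j * d k x"
        and F' = "\<lambda>h. \<Sum>k\<in>UNIV. frame_matrix G \<kappa> p $ k $ j * D k h"])
    show "frame G j u q = (\<Sum>k\<in>UNIV. frame_matrix G \<kappa> (\<psi> (\<kappa> q)) $ k $ j * d k (\<kappa> q))" if "q \<in> U" for q
      using fr[OF that] that by simp
    have "((\<lambda>x. frame_matrix G \<kappa> (\<psi> x) $ k $ j * d k x) has_derivative (\<lambda>h. frame_matrix G \<kappa> p $ k $ j * D k h)) (at (\<kappa> p))" for k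
      using has_derivative_mult_vanishing[OF lipschitz_at_isCont[OF frame_matrix_lipschitz[OF p]] D d0, of k j k] p by simp
    then show "((\<lambda>x. \<Sum>k\<in>UNIV. frame_matrix G \<kappa> (\<psi> x) $ k $ j * d k x) has_derivative
       (\<lambda>h. \<Sum>k\<in>UNIV. frame_matrix G \<kappa> p $ k $ j * D k h)) (at (\<kappa> p))"
      by (intro has_derivative_sum)
  qed
  have second: "\<sigma> * (\<Sum>k\<in>UNIV. w $ k * D k w) \<le> 0" for w
  proof -
    have "open ((\<lambda>s. \<kappa> p + s *\<^sub>R w) -` S)" by (intro open_vimage S continuous_intros)
    moreover have "0 \<in> (\<lambda>s::real. \<kappa> p + s *\<^sub>R w) -` S" using S by simp
    ultimately obtain e where e: "e > 0" "ball 0 e \<subseteq> (\<lambda>s. \<kappa> p + s *\<^sub>R w) -` S" by (rule openE)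
    have inS: "\<kappa> p + s *\<^sub>R w \<in> S" if "\<bar>s\<bar> < e" for s using e(2) that by (auto simp: subset_iff)
    have l: "((\<lambda>s. \<kappa> p + s *\<^sub>R w) has_derivative (\<lambda>h. h *\<^sub>R w)) (at s)" for s
      by (auto intro!: derivative_eq_intros)
    show ?thesis
    proof (rule second_derivative_at_max[OF e(1), where \<phi> = "\<lambda>s. \<sigma> * F (\<kappa> p + s *\<^sub>R w)"
          and \<phi>' = "\<lambda>s. \<sigma> * (\<Sum>k\<in>UNIV. w $ k * d k (\<kappa> p + s *\<^sub>R w))"])
      fix s assume s: "\<bar>s\<bar> < e"
      have "((\<lambda>s. F (\<kappa> p + s *\<^sub>R w)) has_derivative (\<lambda>h. frechet_derivative F (at (\<kappa> p + s *\<^sub>R w)) (h *\<^sub>R w))) (at s)"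
        by (rule has_derivative_compose[OF l F[OF inS[OF s]]])
      moreover have "(\<lambda>h. frechet_derivative F (at (\<kappa> p + s *\<^sub>R w)) (h *\<^sub>R w)) = (*) (\<Sum>k\<in>UNIV. w $ k * d k (\<kappa> p + s *\<^sub>R w))"
        by (rule ext) (simp add: F_eq[OF inS[OF s]] sum_distrib_left mult_ac)
      ultimately have "((\<lambda>s. F (\<kappa> p + s *\<^sub>R w)) has_real_derivative (\<Sum>k\<in>UNIV. w $ k * d k (\<kappa> p + s *\<^sub>R w))) (at s)"
        unfolding has_field_derivative_def by simp
      then show "((\<lambda>s. \<sigma> * F (\<kappa> p + s *\<^sub>R w)) has_real_derivative \<sigma> * (\<Sum>k\<in>UNIV. w $ k * d k (\<kappa> p + s *\<^sub>R w))) (at s)"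
        by (rule DERIV_cmult)
      show "\<sigma> * F (\<kappa> p + s *\<^sub>R w) \<le> \<sigma> * F (\<kappa> p + 0 *\<^sub>R w)" using max p by (simp add: F_def)
    next
      have "((\<lambda>s. d k (\<kappa> p + s *\<^sub>R w)) has_real_derivative D k w) (at 0)" for k
      proof -
        have "(d k has_derivative D k) (at (\<kappa> p + 0 *\<^sub>R w))" using D by simp
        from has_derivative_compose[OF l this]
        have "((\<lambda>s. d k (\<kappa> p + s *\<^sub>R w)) has_derivative (\<lambda>h. D k (h *\<^sub>R w))) (at 0)" .
        moreover have "(\<lambda>h. D k (h *\<^sub>R w)) = (*) (D k w)"
          using linear_scale[OF has_derivative_linear[OF D]] by (intro ext) simp
        ultimately show ?thesis unfolding has_field_derivative_def by simp
      qed
      then show "((\<lambda>s. \<sigma> * (\<Sum>k\<in>UNIV. w $ k * d k (\<kappa> p + s *\<^sub>R w))) has_real_derivative \<sigma> * (\<Sum>k\<in>UNIV. w $ k * D k w)) (at 0)"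
        by (intro DERIV_cmult DERIV_sum)
    qed
  qed
  define B where "B = (\<chi> i j. \<sigma> * frame G i (frame G j u) p)"
  have linD: "linear (D k)" for k using D by (rule has_derivative_linear)
  have "z \<bullet> (B *v z) \<le> 0" for z
  proof -
    have Jz: "D k (J *v z) = (\<Sum>i\<in>UNIV. z $ i * D k (J *v axis i 1))" for k
    proof -
      have "J *v z = (\<Sum>i\<in>UNIV. z $ i *\<^sub>R (J *v axis i 1))" by (simp add: mat3 algebra_simps)
      then show ?thesis by (simp add: linear_sum[OF linD] linear_scale[OF linD])
    qed
    have "z \<bullet> (B *v z) = \<sigma> * (\<Sum>k\<in>UNIV. (J *v z) $ k * D k (J *v z))"
      unfolding Jz by (simp add: B_def fr2 inner_vec_def sum_3 matrix_vector_mult_def algebra_simps)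
    then show ?thesis using second by simp
  qed
  note tr = psd_nsd_trace[OF positive_definite_inverse(2,3)[OF g] this]
  have "\<sigma> * laplacian G g u p = (\<Sum>i\<in>UNIV. \<Sum>j\<in>UNIV. matrix_inv (g p) $ i $ j * B $ i $ j)"
    unfolding laplacian_def fr0 B_def by (simp add: sum_distrib_left mult_ac)
  then show ?thesis using tr by simp
qed

end

text \<open>
  Constants realise the eigenvalue \<open>a R\<close>. For minimality the eigenvalue equation is evaluated at an
  extremum of an eigenfunction, which exists since \<open>M\<close> is compact.
\<close>
theorem first_eigenvalue_constant_scalar_curvature:
  fixes G :: "'g::t2_space lie_group_data" and \<pi> :: "'g \<Rightarrow> 'm::t2_space"
  assumes G: "lie_group G" and M: "compact (UNIV :: 'm set)" and cov: "covering_space UNIV \<pi> (UNIV :: 'm set)"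
    and g: "riemannian_metric G g" and R: "\<And>p. scalar_curvature G g p = R"
  shows "first_eigenvalue G \<pi> g a = a * R"
  unfolding first_eigenvalue_def
proof (rule Least_equality)
  have "frame G j (\<lambda>p. 1) = (\<lambda>p. 0)" for j by (rule ext) simp
  then have l: "laplacian G g (\<lambda>p. 1) p = 0" for p
    by (simp add: laplacian_def)
  show "eigenvalue G \<pi> g a (a * R)"
    unfolding eigenvalue_def
    by (intro exI[of _ "\<lambda>_. 1"]) (simp add: o_def smooth_fun_const[OF G open_UNIV] l R)
next
  fix l assume "eigenvalue G \<pi> g a l"
  then obtain u where u: "smooth_fun G UNIV (u \<circ> \<pi>)" "\<exists>x. u x \<noteq> 0"
    and eq: "\<And>p. - laplacian G g (u \<circ> \<pi>) p + a * R * u (\<pi> p) = l * u (\<pi> p)"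
    unfolding eigenvalue_def R by blast
  have cup: "continuous_on UNIV (u \<circ> \<pi>)"
    by (intro continuous_at_imp_continuous_on ballI smooth_fun_continuous[OF G u(1)] UNIV_I)
  have cu: "continuous_on UNIV u"
  proof (rule continuous_at_imp_continuous_on, rule ballI)
    fix y
    obtain T where T: "open T" "y \<in> T"
      and q: "\<And>a. \<pi> a \<in> T \<Longrightarrow> \<exists>q. continuous_on T q \<and> q (\<pi> a) = a \<and> (\<forall>z\<in>T. \<pi> (q z) = z)"
      using covering_local_section[OF cov] by blast
    obtain b where "y = \<pi> b" using covering_space_imp_surjective[OF cov] by blast
    then obtain q where q: "continuous_on T q" "\<And>z. z \<in> T \<Longrightarrow> \<pi> (q z) = z" using q[of b] T by blast
    have "continuous_on T (\<lambda>z. (u \<circ> \<pi>) (q z))"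
      by (rule continuous_on_compose2[OF cup q(1)]) simp
    then have "continuous_on T u" using q(2) by (simp cong: continuous_on_cong)
    then show "isCont u y" using T by (simp add: continuous_on_eq_continuous_at)
  qed
  have key: "a * R \<le> l" if \<sigma>: "\<sigma> \<noteq> 0" and y: "0 < \<sigma> * u y" for \<sigma> y
  proof -
    have "continuous_on UNIV (\<lambda>x. \<sigma> * u x)" using cu by (intro continuous_intros)
    then obtain x where x: "\<And>z. \<sigma> * u z \<le> \<sigma> * u x"
      using continuous_attains_sup[OF M] by blast
    obtain p where p: "x = \<pi> p" using covering_space_imp_surjective[OF cov] by blast
    obtain U \<kappa> where c: "(U, \<kappa>) \<in> atlas G" "p \<in> U" using lie_group_chart_at[OF G] .
    interpret lie_chart G U \<kappa> by unfold_locales (use G c in auto)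
    have "\<sigma> * laplacian G g (u \<circ> \<pi>) p \<le> 0"
      by (rule laplacian_at_extremum[OF u(1) c(2) riemannian_metric_positive_definite[OF g] \<sigma>])
        (use x p in simp)
    moreover have "\<sigma> * laplacian G g (u \<circ> \<pi>) p = (a * R - l) * (\<sigma> * u x)"
      using arg_cong[OF eq[of p], of "\<lambda>t. \<sigma> * t"] p by (simp add: algebra_simps)
    moreover have "0 < \<sigma> * u x" using y x[of y] by linarith
    ultimately have "a * R - l \<le> 0" by (metis mult_pos_pos not_le)
    then show ?thesis by simp
  qed
  \<comment> \<open>The sign \<open>\<sigma>\<close> turns a nonzero value of \<open>u\<close> into a positive one.\<close>
  obtain y where y: "u y \<noteq> 0" using u(2) by blast
  then show "a * R \<le> l" using key[of 1 y] key[of "- 1" y] by (cases "u y > 0") auto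
qed

section \<open>Conservation of volume\<close>

text \<open>
  A chart ball over which the covering is injective has finite positive volume.
\<close>
lemma volume_local:
  fixes G :: "'g::t2_space lie_group_data" and \<pi> :: "'g \<Rightarrow> 'm::t2_space"
  assumes G: "lie_group G" and cov: "covering_space UNIV \<pi> (UNIV :: 'm set)"
    and g: "\<And>p. g p = A" "det A > 0" and \<mu>: "riemannian_volume G \<pi> g \<mu>"
  obtains W where "open W" "b \<in> W" "open (\<pi> ` W)" "0 < emeasure \<mu> (\<pi> ` W)" "emeasure \<mu> (\<pi> ` W) < \<infinity>"
proof -
  obtain T u q where T: "b \<in> T" "open T" "open u" "homeomorphism T u \<pi> q"
    using covering_space_local_homeomorphism[OF cov UNIV_I, of b] by (metis open_openin subtopology_UNIV)
  obtain U \<kappa> where c: "(U, \<kappa>) \<in> atlas G" "b \<in> U" using lie_group_chart_at[OF G] .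
  interpret lie_chart G U \<kappa> by unfold_locales (use G c in auto)
  have "open (\<kappa> ` (U \<inter> T))" using T chart_homeo(1) by (intro open_chart_image) auto
  moreover have "\<kappa> b \<in> \<kappa> ` (U \<inter> T)" using c T by blast
  ultimately obtain r where r: "r > 0" "cball (\<kappa> b) r \<subseteq> \<kappa> ` (U \<inter> T)" by (metis open_contains_cball)
  define W where "W = \<psi> ` ball (\<kappa> b) r"
  have "cball (\<kappa> b) r \<subseteq> \<kappa> ` U" using r(2) by blast
  then have sub: "ball (\<kappa> b) r \<subseteq> \<kappa> ` U" "cball (\<kappa> b) r \<subseteq> \<kappa> ` U"
    using ball_subset_cball by blast+
  have oW: "open W" unfolding W_def using sub by (intro open_chart_preimage) auto
  have bW: "b \<in> W" unfolding W_def using r c(2) by (intro image_eqI[of _ _ "\<kappa> b"]) auto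
  have WU: "W \<subseteq> U" unfolding W_def using sub by auto
  have WT: "W \<subseteq> T"
  proof
    fix x assume "x \<in> W"
    then obtain y where y: "y \<in> ball (\<kappa> b) r" "x = \<psi> y" unfolding W_def by blast
    then have "y \<in> \<kappa> ` (U \<inter> T)" using r(2) by auto
    then obtain x' where "x' \<in> U \<inter> T" "y = \<kappa> x'" by blast
    then show "x \<in> T" using y by simp
  qed
  have inj: "inj_on \<pi> W"
    using T(4) WT by (metis homeomorphism_def inj_on_inverseI inj_on_subset)
  have "openin (top_of_set u) (\<pi> ` W)"
    by (rule homeomorphism_imp_open_map[OF T(4)]) (use oW WT T(2) in \<open>simp add: openin_open_eq\<close>)
  then have o\<pi>: "open (\<pi> ` W)" using T(3) by (simp add: openin_open_eq)
  have \<kappa>W: "\<kappa> ` W = ball (\<kappa> b) r" unfolding W_def image_image using sub(1) by (auto simp: subset_iff image_iff)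
  \<comment> \<open>The volume density in the chart is continuous and positive, hence bounded on both sides on the closed ball.\<close>
  define dens where "dens x = sqrt (det A) / \<bar>det (frame_matrix G \<kappa> (\<psi> x))\<bar>" for x
  have em: "emeasure \<mu> (\<pi> ` W) = (\<integral>\<^sup>+x\<in>ball (\<kappa> b) r. ennreal (dens x) \<partial>lborel)"
  proof -
    have "\<forall>(U, \<kappa>)\<in>atlas G. \<forall>W. open W \<and> W \<subseteq> U \<and> inj_on \<pi> W \<longrightarrow>
        emeasure \<mu> (\<pi> ` W) =
        (\<integral>\<^sup>+x\<in>\<kappa> ` W. (let p = inv_into U \<kappa> x in
            ennreal (sqrt (det (g p)) / \<bar>det (\<chi> i j. frame G j (\<lambda>q. \<kappa> q $ i) p)\<bar>)) \<partial>lborel)"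
      using \<mu> unfolding riemannian_volume_def by blast
    from bspec[OF this chart, unfolded prod.case, rule_format, of W] oW WU inj
    show ?thesis unfolding \<kappa>W by (simp add: dens_def frame_matrix_def g Let_def)
  qed
  have cont: "continuous_on (cball (\<kappa> b) r) dens"
  proof -
    have e: "continuous_on (cball (\<kappa> b) r) (\<lambda>x. frame_matrix G \<kappa> (\<psi> x) $ i $ j)" for i j
      by (rule continuous_on_subset[OF frame_matrix_continuous sub(2)])
    have "continuous_on (cball (\<kappa> b) r) (\<lambda>x. det (frame_matrix G \<kappa> (\<psi> x)))"
      unfolding det_3 by (intro continuous_on_add continuous_on_diff continuous_on_mult e)
    moreover have "\<bar>det (frame_matrix G \<kappa> (\<psi> x))\<bar> \<noteq> 0" if "x \<in> cball (\<kappa> b) r" for x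
    proof -
      have "x \<in> \<kappa> ` U" using that sub(2) by blast
      then show ?thesis using frame_matrix_det_nonzero[OF \<psi>_in] by simp
    qed
    ultimately show ?thesis unfolding dens_def
      by (intro continuous_on_divide continuous_on_const continuous_on_rabs ballI)
  qed
  have pos: "0 < dens x" if "x \<in> cball (\<kappa> b) r" for x
  proof -
    have "x \<in> \<kappa> ` U" using that sub(2) by blast
    then have "det (frame_matrix G \<kappa> (\<psi> x)) \<noteq> 0" using frame_matrix_det_nonzero[OF \<psi>_in] by simp
    then show ?thesis unfolding dens_def using g(2) by simp
  qed
  have ne: "cball (\<kappa> b) r \<noteq> {}" using r(1) by simp
  obtain x0 where x0: "x0 \<in> cball (\<kappa> b) r" "\<And>y. y \<in> cball (\<kappa> b) r \<Longrightarrow> dens x0 \<le> dens y"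
    using continuous_attains_inf[OF compact_cball ne cont] by blast
  obtain x1 where x1: "x1 \<in> cball (\<kappa> b) r" "\<And>y. y \<in> cball (\<kappa> b) r \<Longrightarrow> dens y \<le> dens x1"
    using continuous_attains_sup[OF compact_cball ne cont] by blast
  have "(\<integral>\<^sup>+x\<in>ball (\<kappa> b) r. ennreal (dens x0) \<partial>lborel) \<le> emeasure \<mu> (\<pi> ` W)"
    unfolding em by (intro nn_integral_mono) (auto simp: indicator_def intro!: ennreal_leI x0)
  then have lo: "ennreal (dens x0) * emeasure lborel (ball (\<kappa> b) r) \<le> emeasure \<mu> (\<pi> ` W)"
    by (simp add: nn_integral_cmult_indicator)
  have "emeasure \<mu> (\<pi> ` W) \<le> (\<integral>\<^sup>+x\<in>ball (\<kappa> b) r. ennreal (dens x1) \<partial>lborel)"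
    unfolding em by (intro nn_integral_mono) (auto simp: indicator_def intro!: ennreal_leI x1)
  then have hi: "emeasure \<mu> (\<pi> ` W) \<le> ennreal (dens x1) * emeasure lborel (ball (\<kappa> b) r)"
    by (simp add: nn_integral_cmult_indicator)
  have eb: "emeasure lborel (ball (\<kappa> b) r) = ennreal (unit_ball_vol (real DIM(real^3)) * r ^ DIM(real^3))"
    using r(1) by (intro emeasure_ball) simp
  have bp: "0 < unit_ball_vol (real DIM(real^3)) * r ^ DIM(real^3)" using r(1) by simp
  show ?thesis
  proof (rule that[OF oW bW o\<pi>])
    have "0 < ennreal (dens x0) * emeasure lborel (ball (\<kappa> b) r)"
      unfolding eb using pos[OF x0(1)] bp by (simp flip: ennreal_mult')
    then show "0 < emeasure \<mu> (\<pi> ` W)" using lo by (rule less_le_trans)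
    have "ennreal (dens x1) * emeasure lborel (ball (\<kappa> b) r) < \<infinity>"
      unfolding eb by (simp add: ennreal_mult_less_top)
    then show "emeasure \<mu> (\<pi> ` W) < \<infinity>" using hi by (rule le_less_trans[rotated])
  qed
qed

text \<open>
  The quotient of integrals is meaningful because the volume of \<open>M\<close> is positive and, by compactness,
  finite.
\<close>
lemma average_scalar_curvature_constant:
  fixes G :: "'g::t2_space lie_group_data" and \<pi> :: "'g \<Rightarrow> 'm::t2_space"
  assumes G: "lie_group G" and M: "compact (UNIV :: 'm set)" and cov: "covering_space UNIV \<pi> (UNIV :: 'm set)"
    and g: "\<And>p. g p = A" "det A > 0" and \<mu>: "riemannian_volume G \<pi> g \<mu>"
    and R: "\<And>p. scalar_curvature G g p = R"
  shows "average_scalar_curvature G \<pi> g \<mu> = R"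
proof -
  have sets: "sets \<mu> = sets borel" using \<mu> unfolding riemannian_volume_def by blast
  then have space: "space \<mu> = UNIV" using sets_eq_imp_space_eq by fastforce
  have "\<exists>W. open W \<and> b \<in> W \<and> open (\<pi> ` W) \<and> 0 < emeasure \<mu> (\<pi> ` W) \<and> emeasure \<mu> (\<pi> ` W) < \<infinity>" for b
    using volume_local[OF G cov g \<mu>, of b] by metis
  then obtain W where W: "\<And>b. open (W b)" "\<And>b. b \<in> W b" "\<And>b. open (\<pi> ` W b)"
    "\<And>b. 0 < emeasure \<mu> (\<pi> ` W b)" "\<And>b. emeasure \<mu> (\<pi> ` W b) < \<infinity>" by metis
  have "UNIV \<subseteq> (\<Union>b\<in>UNIV. \<pi> ` W b)"
  proof
    fix x
    obtain b where "x = \<pi> b" using covering_space_imp_surjective[OF cov] by blast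
    then show "x \<in> (\<Union>b\<in>UNIV. \<pi> ` W b)" using W(2)[of b] by blast
  qed
  then obtain C where C: "finite C" "UNIV \<subseteq> (\<Union>b\<in>C. \<pi> ` W b)"
    using compactE_image[OF M, of UNIV "\<lambda>b. \<pi> ` W b"] W(3) by metis
  have m: "\<pi> ` W b \<in> sets \<mu>" for b using W(3) sets by (simp add: borel_open)
  have "emeasure \<mu> UNIV = emeasure \<mu> (\<Union>b\<in>C. \<pi> ` W b)" using C(2) by (metis top.extremum_uniqueI)
  also have "\<dots> \<le> (\<Sum>b\<in>C. emeasure \<mu> (\<pi> ` W b))"
    by (rule emeasure_subadditive_finite[OF C(1)]) (use m in blast)
  also have "\<dots> < \<infinity>" using W(5) C(1) by (simp add: less_top)
  finally have fin: "emeasure \<mu> UNIV < \<infinity>" .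
  have "0 < emeasure \<mu> (\<pi> ` W undefined)" by (rule W)
  also have "\<dots> \<le> emeasure \<mu> UNIV" by (rule emeasure_mono) (auto simp: sets)
  finally have "0 < measure \<mu> UNIV"
    using fin unfolding measure_def by (simp add: enn2real_positive_iff)
  then show ?thesis
    unfolding average_scalar_curvature_def R by (simp add: space)
qed

lemma cofactor_eq:
  fixes A H :: "real^3^3"
  assumes "H ** A = mat 1"
  shows "det A *\<^sub>R H = vector [
    vector [A$2$2 * A$3$3 - A$2$3 * A$3$2, A$1$3 * A$3$2 - A$1$2 * A$3$3, A$1$2 * A$2$3 - A$1$3 * A$2$2],
    vector [A$2$3 * A$3$1 - A$2$1 * A$3$3, A$1$1 * A$3$3 - A$1$3 * A$3$1, A$1$3 * A$2$1 - A$1$1 * A$2$3],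
    vector [A$2$1 * A$3$2 - A$2$2 * A$3$1, A$1$2 * A$3$1 - A$1$1 * A$3$2, A$1$1 * A$2$2 - A$1$2 * A$2$1]]"
    (is "_ = ?C")
proof -
  have "A ** ?C = det A *\<^sub>R mat 1" by (simp add: mat3 det_3 mat_def algebra_simps)
  then have "H ** (A ** ?C) = H ** (det A *\<^sub>R mat 1)" by simp
  then have "?C = H ** (det A *\<^sub>R mat 1)" by (simp add: matrix_mul_assoc assms)
  also have "\<dots> = det A *\<^sub>R H" by (simp add: mat3 mat_def)
  finally show ?thesis ..
qed

text \<open>
  The derivative of the determinant is the determinant times the trace of \<open>A\<^sup>-\<^sup>1 X\<close>.
\<close>
lemma det_has_derivative_zero:
  fixes A :: "real \<Rightarrow> real^3^3"
  assumes A: "positive_definite (A t)" and X: "(A has_vector_derivative X) (at t within I)"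
    and tr: "(\<Sum>j\<in>UNIV. \<Sum>k\<in>UNIV. matrix_inv (A t) $ j $ k * X $ j $ k) = 0"
  shows "((\<lambda>t. det (A t)) has_real_derivative 0) (at t within I)"
proof -
  have e: "((\<lambda>t. A t $ i $ j) has_real_derivative X $ i $ j) (at t within I)" for i j
    using bounded_linear.has_vector_derivative[OF bounded_linear_compose[OF bounded_linear_vec_nth[of j] bounded_linear_vec_nth[of i]] X]
    by (simp add: has_real_derivative_iff_has_vector_derivative o_def)
  note C = cofactor_eq[OF positive_definite_inverse(1)[OF A]]
  have s: "A t $ i $ j = A t $ j $ i" for i j using A unfolding positive_definite_def by (metis symmetric_entries)
  have "(\<Sum>j\<in>UNIV. \<Sum>k\<in>UNIV. (det (A t) *\<^sub>R matrix_inv (A t)) $ j $ k * X $ j $ k) = 0"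
    using arg_cong[OF tr, of "\<lambda>x. det (A t) * x"] by (simp add: sum_distrib_left mult_ac)
  note z = this[unfolded C]
  show ?thesis unfolding det_3
    by (rule derivative_eq_intros e refl)+
      (use z in \<open>simp add: sum_3 s[of 2 1] s[of 3 1] s[of 3 2] algebra_simps\<close>)
qed

text \<open>
  The logarithmic derivative of the volume element is \<open>2 R - 2 r\<close>, and the average \<open>r\<close> equals \<open>R\<close>.
\<close>
lemma backward_ricci_flow_det_constant:
  fixes G :: "'g::t2_space lie_group_data" and \<pi> :: "'g \<Rightarrow> 'm::t2_space"
  assumes G: "lie_group G" and M: "compact (UNIV :: 'm set)" and cov: "covering_space UNIV \<pi> (UNIV :: 'm set)"
    and R: "\<And>t p. t \<in> time_interval T \<Longrightarrow> scalar_curvature G (g t) p = R t"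
    and flow: "backward_ricci_flow G \<pi> T g" and t: "s \<in> time_interval T" "t \<in> time_interval T"
  shows "det (g s p) = det (g t p)"
proof -
  have d: "((\<lambda>t. det (g t p)) has_real_derivative 0) (at t within time_interval T)" if t: "t \<in> time_interval T" for t
  proof -
    obtain \<mu> where rm: "riemannian_metric G (g t)" and li: "left_invariant G (g t)"
      and \<mu>: "riemannian_volume G \<pi> (g t) \<mu>"
      and X: "((\<lambda>\<tau>. g \<tau> p) has_vector_derivative
                 2 *\<^sub>R ricci G (g t) p - (2 * average_scalar_curvature G \<pi> (g t) \<mu> / 3) *\<^sub>R g t p)
               (at t within time_interval T)"
      using flow t unfolding backward_ricci_flow_def quotient_metric_def by blast
    have pd: "positive_definite (g t p)" using rm by (rule riemannian_metric_positive_definite)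
    have c: "g t q = g t p" for q using li unfolding left_invariant_def by metis
    have av: "average_scalar_curvature G \<pi> (g t) \<mu> = R t"
      by (rule average_scalar_curvature_constant[OF G M cov c positive_definite_inverse(4)[OF pd] \<mu> R[OF t]])
    let ?H = "matrix_inv (g t p)"
    have tr3: "(\<Sum>j\<in>UNIV. \<Sum>k\<in>UNIV. ?H $ j $ k * g t p $ j $ k) = 3"
    proof -
      have "(?H ** g t p) $ j $ j = 1" for j using positive_definite_inverse(1)[OF pd] by (simp add: mat_def)
      then have "(\<Sum>j\<in>UNIV. (?H ** g t p) $ j $ j) = 3" by simp
      moreover have "g t p $ j $ k = g t p $ k $ j" for j k using pd unfolding positive_definite_def by (metis symmetric_entries)
      ultimately show ?thesis by (simp add: matrix_matrix_mult_def)
    qed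
    have "(\<Sum>j\<in>UNIV. \<Sum>k\<in>UNIV. ?H $ j $ k * (2 *\<^sub>R ricci G (g t) p - (2 * R t / 3) *\<^sub>R g t p) $ j $ k)
       = 2 * scalar_curvature G (g t) p - 2 * R t / 3 * (\<Sum>j\<in>UNIV. \<Sum>k\<in>UNIV. ?H $ j $ k * g t p $ j $ k)"
      unfolding scalar_curvature_def by (simp add: sum_3 algebra_simps)
    also have "\<dots> = 0" unfolding tr3 R[OF t] by simp
    finally show ?thesis using X unfolding av by (intro det_has_derivative_zero[where A = "\<lambda>t. g t p" and t = t, OF pd]) auto
  qed
  have "convex (time_interval T)"
    unfolding time_interval_def is_interval_convex_1[symmetric] is_interval_1
    by (auto intro: le_less_trans[of "ereal _" "ereal _"])
  from has_field_derivative_zero_constant[OF this d] t show ?thesis by metis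
qed

section \<open>Integral curves and short curves\<close>

text \<open>
  Banach's fixed point theorem for the integral equation, on bounded continuous functions.
\<close>
lemma picard_lindelof:
  fixes F :: "'a::euclidean_space \<Rightarrow> 'a"
  assumes F: "lipschitz_at F x0" and r0: "r0 > 0"
  obtains h x where "h > 0" "x 0 = x0"
    "\<And>t. t \<in> {0..h} \<Longrightarrow> x t \<in> cball x0 r0 \<and> (x has_vector_derivative F (x t)) (at t within {0..h})"
proof -
  obtain r L where r: "r > 0" "r \<le> r0" and L: "L-lipschitz_on (cball x0 r) F"
  proof -
    obtain r L where "r > 0" "L-lipschitz_on (cball x0 r) F" using F unfolding lipschitz_at_def by blast
    then show ?thesis using r0 by (intro that[of "min r r0" L]) (auto intro: lipschitz_on_subset)
  qed
  have L0: "L \<ge> 0" by (rule lipschitz_on_nonneg[OF L])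
  \<comment> \<open>Precomposing with the projection to the ball extends \<open>F\<close> to a bounded, globally Lipschitz field \<open>E\<close>.\<close>
  define P where "P = closest_point (cball x0 r)"
  have P: "P y \<in> cball x0 r" for y
    unfolding P_def by (rule closest_point_in_set) (use r in auto)
  have P_id: "P y = y" if "y \<in> cball x0 r" for y unfolding P_def using that by (rule closest_point_self)
  have P_lip: "dist (P y) (P z) \<le> dist y z" for y z
    unfolding P_def by (rule closest_point_lipschitz) (use r in auto)
  define E where "E y = F (P y)" for y
  have E_lip: "dist (E y) (E z) \<le> L * dist y z" for y z
  proof -
    have "dist (E y) (E z) \<le> L * dist (P y) (P z)" unfolding E_def by (rule lipschitz_onD[OF L P P])
    also have "\<dots> \<le> L * dist y z" by (intro mult_left_mono P_lip L0)
    finally show ?thesis .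
  qed
  define B where "B = norm (F x0) + L * r"
  have B0: "B \<ge> 0" unfolding B_def using L0 r by simp
  have E_bound: "norm (E y) \<le> B" for y
  proof -
    have "dist (F (P y)) (F x0) \<le> L * dist (P y) x0" by (rule lipschitz_onD[OF L P]) (use r in simp)
    also have "\<dots> \<le> L * r" using P[of y] L0 by (intro mult_left_mono) (auto simp: dist_commute)
    finally have "norm (F (P y) - F x0) \<le> L * r" by (simp add: dist_norm)
    then show ?thesis unfolding E_def B_def using norm_triangle_sub[of "F (P y)" "F x0"] by linarith
  qed
  have E_cont: "continuous_on UNIV E"
    by (rule lipschitz_on_continuous_on[of L]) (intro lipschitz_onI E_lip L0)
  \<comment> \<open>The first bound keeps the solution in the ball, the second makes the integral operator a contraction.\<close>
  define h where "h = min (r / (B + 1)) (1 / (2 * (L + 1)))"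
  have h: "h > 0" "h * B \<le> r" "h * L \<le> 1/2"
  proof -
    show "h > 0" unfolding h_def using r B0 L0 by simp
    have "h * B \<le> r / (B + 1) * B" unfolding h_def using B0 by (intro mult_right_mono) auto
    also have "\<dots> \<le> r" using r B0 by (simp add: field_simps)
    finally show "h * B \<le> r" .
    have "h * L \<le> 1 / (2 * (L + 1)) * L" unfolding h_def using L0 by (intro mult_right_mono) auto
    also have "\<dots> \<le> 1/2" using L0 by (simp add: field_simps)
    finally show "h * L \<le> 1/2" .
  qed
  \<comment> \<open>Functions on the interval are represented by bounded continuous functions that are constant beyond its ends.\<close>
  define cl where "cl t = min h (max 0 t)" for t :: real
  have cl: "cl t \<in> {0..h}" for t unfolding cl_def using h by auto
  have cl_id: "cl t = t" if "t \<in> {0..h}" for t unfolding cl_def using that by auto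
  have cl_cont: "continuous_on UNIV cl" unfolding cl_def by (intro continuous_intros)
  define I where "I u t = x0 + integral {0..t} (\<lambda>s. E (apply_bcontfun u s))" for u :: "real \<Rightarrow>\<^sub>C 'a" and t
  have Eu_cont: "continuous_on S (\<lambda>s. E (apply_bcontfun u s))" for u :: "real \<Rightarrow>\<^sub>C 'a" and S
    by (intro continuous_on_compose2[OF E_cont] continuous_on_apply_bcontfun continuous_on_id) auto
  have Eu_int: "(\<lambda>s. E (apply_bcontfun u s)) integrable_on {a..b}" for u :: "real \<Rightarrow>\<^sub>C 'a" and a b
    by (intro integrable_continuous_interval Eu_cont)
  have I_near: "norm (I u t - x0) \<le> t * B" if t: "t \<in> {0..h}" for u t
  proof -
    have "norm (integral {0..t} (\<lambda>s. E (apply_bcontfun u s))) \<le> integral {0..t} (\<lambda>s. B)"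
      by (intro integral_norm_bound_integral Eu_int E_bound) auto
    then show ?thesis unfolding I_def using t by simp
  qed
  have I_cont: "continuous_on {0..h} (I u)" for u
    unfolding I_def by (intro continuous_intros indefinite_integral_continuous_1 Eu_int)
  define \<Phi> where "\<Phi> u = Bcontfun (\<lambda>t. I u (cl t))" for u
  have in_bc: "(\<lambda>t. I u (cl t)) \<in> bcontfun" for u
  proof (rule bcontfun_normI)
    show "continuous_on UNIV (\<lambda>t. I u (cl t))"
      by (rule continuous_on_compose2[OF I_cont cl_cont]) (use cl in blast)
    fix t
    have "norm (I u (cl t) - x0) \<le> cl t * B" by (rule I_near[OF cl])
    also have "\<dots> \<le> h * B" using cl[of t] B0 by (intro mult_right_mono) auto
    finally show "norm (I u (cl t)) \<le> norm x0 + h * B"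
      using norm_triangle_sub[of "I u (cl t)" x0] by linarith
  qed
  have \<Phi>: "apply_bcontfun (\<Phi> u) t = I u (cl t)" for u t
    unfolding \<Phi>_def by (simp add: Bcontfun_inverse[OF in_bc])
  have contr: "dist (\<Phi> u) (\<Phi> v) \<le> 1/2 * dist u v" for u v
  proof (rule dist_bound)
    fix t
    have "dist (apply_bcontfun (\<Phi> u) t) (apply_bcontfun (\<Phi> v) t)
        = norm (integral {0..cl t} (\<lambda>s. E (apply_bcontfun u s) - E (apply_bcontfun v s)))"
      unfolding \<Phi> I_def dist_norm by (simp add: integral_diff[OF Eu_int Eu_int])
    also have "\<dots> \<le> integral {0..cl t} (\<lambda>s. L * dist u v)"
    proof (intro integral_norm_bound_integral integrable_diff Eu_int integrable_const_ivl)
      fix s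
      have "norm (E (apply_bcontfun u s) - E (apply_bcontfun v s)) \<le> L * dist (apply_bcontfun u s) (apply_bcontfun v s)"
        using E_lip by (simp add: dist_norm)
      also have "\<dots> \<le> L * dist u v" by (intro mult_left_mono L0 dist_bounded)
      finally show "norm (E (apply_bcontfun u s) - E (apply_bcontfun v s)) \<le> L * dist u v" .
    qed
    also have "\<dots> = cl t * L * dist u v" using cl[of t] by simp
    also have "\<dots> \<le> h * L * dist u v" using cl[of t] L0 by (intro mult_right_mono) auto
    also have "\<dots> \<le> 1/2 * dist u v" using h by (intro mult_right_mono) auto
    finally show "dist (apply_bcontfun (\<Phi> u) t) (apply_bcontfun (\<Phi> v) t) \<le> 1/2 * dist u v" .
  qed
  have "\<exists>!u. \<Phi> u = u" by (rule banach_fix_type[of "1/2"]) (use contr in auto)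
  then obtain u where u: "\<Phi> u = u" by blast
  define x where "x = apply_bcontfun u"
  have x_eq: "x t = I u t" if "t \<in> {0..h}" for t
    using \<Phi>[of u t] cl_id[OF that] unfolding u x_def by simp
  have x_near: "x t \<in> cball x0 r" if t: "t \<in> {0..h}" for t
  proof -
    have "norm (x t - x0) \<le> t * B" using I_near[OF t] x_eq[OF t] by simp
    also have "\<dots> \<le> h * B" using t B0 by (intro mult_right_mono) auto
    finally show ?thesis using h(2) by (simp add: dist_norm norm_minus_commute)
  qed
  show ?thesis
  proof (rule that[OF h(1)])
    show "x 0 = x0" using x_eq[of 0] h by (simp add: I_def)
    fix t assume t: "t \<in> {0..h}"
    have "(I u has_vector_derivative 0 + E (apply_bcontfun u t)) (at t within {0..h})"
      unfolding I_def by (intro has_vector_derivative_add has_vector_derivative_const integral_has_vector_derivative Eu_cont t)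
    moreover have "E (apply_bcontfun u t) = F (x t)" using x_near[OF t] by (simp add: E_def x_def P_id)
    ultimately have "(I u has_vector_derivative F (x t)) (at t within {0..h})" by simp
    then have "(x has_vector_derivative F (x t)) (at t within {0..h})"
      by (rule has_vector_derivative_transform[OF t, rotated]) (use x_eq in simp)
    moreover have "x t \<in> cball x0 r0" using x_near[OF t] r by auto
    ultimately show "x t \<in> cball x0 r0 \<and> (x has_vector_derivative F (x t)) (at t within {0..h})" by simp
  qed
qed

context lie_chart
begin

text \<open>
  In coordinates the field is the frame matrix applied to its components, which is locally Lipschitz.
\<close>
lemma integral_curve:
  assumes p: "p \<in> U" and Y: "smooth_field G V Y" "p \<in> V" and r0: "r0 > 0"
  obtains h x where "h > 0" "x 0 = \<kappa> p"
    "\<And>t. t \<in> {0..h} \<Longrightarrow> x t \<in> cball (\<kappa> p) r0 \<and>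
      (x has_vector_derivative frame_matrix G \<kappa> (\<psi> (x t)) *v Y (\<psi> (x t))) (at t within {0..h})"
proof -
  have Yl: "lipschitz_at (\<lambda>x. Y (\<psi> x) $ k) (\<kappa> p)" for k
    using smooth_fun_lipschitz_at[OF Y(1)[unfolded smooth_field_def, rule_format, of k] Y(2) p] by (simp add: o_def)
  have "lipschitz_at (\<lambda>x. (frame_matrix G \<kappa> (\<psi> x) *v Y (\<psi> x)) $ i) (\<kappa> p)" for i
    unfolding matrix_vector_mult_def vec_lambda_beta sum_3
    by (intro lipschitz_at_add lipschitz_at_mult frame_matrix_lipschitz p Yl)
  then have "lipschitz_at (\<lambda>x. frame_matrix G \<kappa> (\<psi> x) *v Y (\<psi> x)) (\<kappa> p)" by (rule lipschitz_at_vec)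
  from picard_lindelof[OF this r0] show ?thesis using that by blast
qed

text \<open>
  The integral curve up to time \<open>s\<close>, reparametrised to the unit interval.
\<close>
lemma horizontal_integral_curve:
  assumes x: "\<And>t. t \<in> {0..h} \<Longrightarrow> x t \<in> \<kappa> ` (U \<inter> V) \<and>
      (x has_vector_derivative frame_matrix G \<kappa> (\<psi> (x t)) *v Y (\<psi> (x t))) (at t within {0..h})"
    and Y: "smooth_field G V Y" and D: "\<And>q. q \<in> V \<Longrightarrow> Y q \<in> D q" "\<And>q. subspace (D q)"
    and s: "0 < s" "s \<le> h"
  shows "horizontal_curve G D (\<lambda>t. \<psi> (x (s * t))) (\<lambda>t. s *\<^sub>R Y (\<psi> (x (s * t))))"
proof -
  have st: "s * t \<in> {0..h}" if "t \<in> {0..1}" for t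
  proof -
    have "s * t \<le> s" using mult_left_mono[of t 1 s] that s by simp
    then have "s * t \<le> h" using s by linarith
    then show ?thesis using that s by simp
  qed
  have UV: "\<psi> (x (s * t)) \<in> U \<inter> V" "x (s * t) \<in> \<kappa> ` U" if "t \<in> {0..1}" for t
    using x[OF st[OF that]] by auto
  have xc: "continuous_on {0..h} x"
    using x by (intro continuous_on_vector_derivative[of _ x]) blast
  have xs: "continuous_on {0..1} (\<lambda>t. x (s * t))"
    by (rule continuous_on_compose2[OF xc]) (use st in \<open>auto intro!: continuous_intros\<close>)
  have gc: "continuous_on {0..1} (\<lambda>t. \<psi> (x (s * t)))"
    by (rule continuous_on_compose2[OF chart_continuous(2) xs]) (use UV in auto)
  have Yc: "continuous_on (\<kappa> ` (V \<inter> U)) (\<lambda>x. Y (\<psi> x) $ k)" for k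
  proof -
    have "C_k 0 (\<kappa> ` (V \<inter> U)) ((\<lambda>q. Y q $ k) \<circ> \<psi>)"
      using smooth_fun_chart(1)[OF Y[unfolded smooth_field_def, rule_format, of k]] unfolding C_infinity_def by blast
    then show ?thesis by (simp add: o_def)
  qed
  have vc: "continuous_on {0..1} (\<lambda>t. s *\<^sub>R Y (\<psi> (x (s * t))))"
  proof -
    have "continuous_on {0..1} (\<lambda>t. Y (\<psi> (x (s * t))) $ k)" for k
      by (rule continuous_on_compose2[OF Yc xs]) (use x st in \<open>auto simp: Int_commute\<close>)
    then have "continuous_on {0..1} (\<lambda>t. \<chi> k. Y (\<psi> (x (s * t))) $ k)" by (rule continuous_on_vec_lambda)
    then have "continuous_on {0..1} (\<lambda>t. Y (\<psi> (x (s * t))))" by simp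
    then show ?thesis by (rule continuous_on_scaleR[OF continuous_on_const])
  qed
  have vel: "has_velocity G (\<lambda>t. \<psi> (x (s * t))) t (s *\<^sub>R Y (\<psi> (x (s * t))))" if t: "t \<in> {0..1}" for t
    unfolding has_velocity_def
  proof (intro allI impI)
    fix Q f assume f: "smooth_fun G Q f \<and> \<psi> (x (s * t)) \<in> Q"
    let ?J = "frame_matrix G \<kappa> (\<psi> (x (s * t)))"
    have q: "\<psi> (x (s * t)) \<in> U" "\<kappa> (\<psi> (x (s * t))) = x (s * t)" using UV[OF t] by auto
    have 1: "((\<lambda>t. s * t) has_vector_derivative s) (at t within {0..1})"
      by (auto intro!: derivative_eq_intros simp: has_vector_derivative_def)
    have 2: "(x has_vector_derivative ?J *v Y (\<psi> (x (s * t)))) (at (s * t) within (\<lambda>t. s * t) ` {0..1})"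
      by (rule has_vector_derivative_within_subset[OF conjunct2[OF x[OF st[OF t]]]]) (use st in auto)
    have "(x \<circ> (\<lambda>t. s * t) has_vector_derivative s *\<^sub>R (?J *v Y (\<psi> (x (s * t))))) (at t within {0..1})"
      by (rule vector_diff_chain_within[OF 1 2])
    then have 3: "((\<lambda>t. x (s * t)) has_derivative (\<lambda>h. h *\<^sub>R (?J *v (s *\<^sub>R Y (\<psi> (x (s * t))))))) (at t within {0..1})"
      unfolding has_vector_derivative_def by (simp add: o_def matrix_vector_mult_scaleR)
    have "x (s * t) \<in> \<kappa> ` (Q \<inter> U)" using f q by (metis IntI imageI)
    then have 4: "(f \<circ> \<psi> has_derivative frechet_derivative (f \<circ> \<psi>) (at (x (s * t)))) (at (x (s * t)))"
      using C_infinity_has_derivative[OF smooth_fun_chart(1)] f by blast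
    have "((\<lambda>t. (f \<circ> \<psi>) (x (s * t))) has_derivative
        (\<lambda>h. frechet_derivative (f \<circ> \<psi>) (at (x (s * t))) (h *\<^sub>R (?J *v (s *\<^sub>R Y (\<psi> (x (s * t)))))))) (at t within {0..1})"
      by (rule has_derivative_compose[OF 3 4])
    moreover have "left_field G (s *\<^sub>R Y (\<psi> (x (s * t)))) f (\<psi> (x (s * t)))
        = frechet_derivative (f \<circ> \<psi>) (at (x (s * t))) (?J *v (s *\<^sub>R Y (\<psi> (x (s * t)))))"
      using left_field_smooth[of Q f "\<psi> (x (s * t))"] f q by simp
    moreover have "(\<lambda>h. frechet_derivative (f \<circ> \<psi>) (at (x (s * t))) (h *\<^sub>R w))
        = (*) (frechet_derivative (f \<circ> \<psi>) (at (x (s * t))) w)" for w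
      by (rule ext) (simp add: linear_scale[OF has_derivative_linear[OF 4]])
    ultimately show "(f \<circ> (\<lambda>t. \<psi> (x (s * t))) has_real_derivative
        left_field G (s *\<^sub>R Y (\<psi> (x (s * t)))) f (\<psi> (x (s * t)))) (at t within {0..1})"
      unfolding has_field_derivative_def by (simp add: o_def)
  qed
  have "bounded ((\<lambda>t. s *\<^sub>R Y (\<psi> (x (s * t)))) ` {0..1})"
    by (intro compact_imp_bounded compact_continuous_image vc) simp
  moreover have "s *\<^sub>R Y (\<psi> (x (s * t))) \<in> D (\<psi> (x (s * t)))" if "t \<in> {0..1}" for t
    using D UV[OF that] by (intro subspace_scale) auto
  ultimately show ?thesis unfolding horizontal_curve_def
    using gc vc vel by (intro conjI exI[of _ "{}"]) auto
qed

text \<open>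
  A first-exit argument: until it leaves the ball, the curve stays in a compact smaller ball whose
  radius is the length bound, so it cannot leave.
\<close>
lemma short_curve_stays:
  fixes N :: "real \<Rightarrow> real" and d :: "real \<Rightarrow> real^3"
  assumes p: "p \<in> U" and r: "r > 0" "cball (\<kappa> p) r \<subseteq> \<kappa> ` U"
    and c: "continuous_on {0..1} c" "c 0 = p" and t2: "\<And>K. compact K \<Longrightarrow> closed (K :: 'g set)"
    and S: "finite S"
    and d: "\<And>s. s \<in> {0..1} - S \<Longrightarrow> c s \<in> \<psi> ` cball (\<kappa> p) r \<Longrightarrow>
      ((\<lambda>s. \<kappa> (c s)) has_vector_derivative d s) (at s within {0..1}) \<and> norm (d s) \<le> N s"
    and N: "\<And>s. 0 \<le> N s" "N integrable_on {0..1}" "integral {0..1} N < r"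
  shows "\<And>s. s \<in> {0..1} \<Longrightarrow> c s \<in> \<psi> ` ball (\<kappa> p) r"
    and "(d has_integral \<kappa> (c 1) - \<kappa> p) {0..1}"
proof -
  let ?B = "\<psi> ` ball (\<kappa> p) r"
  have bU: "ball (\<kappa> p) r \<subseteq> \<kappa> ` U" using r(2) by auto
  have oB: "open ?B" by (rule open_chart_preimage[OF open_ball bU])
  have BU: "?B \<subseteq> U" using bU by auto
  have \<rho>0: "0 \<le> integral {0..1} N" by (rule integral_nonneg[OF N(2)]) (use N(1) in auto)
  have ftc: "(d has_integral \<kappa> (c t) - \<kappa> p) {0..t}" "\<kappa> (c t) \<in> cball (\<kappa> p) (integral {0..1} N)"
    if t: "t \<in> {0..1}" and stay: "\<And>s. s \<in> {0..t} \<Longrightarrow> c s \<in> ?B" for t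
  proof -
    have sub: "{0..t} \<subseteq> {0..1}" using t by auto
    have "continuous_on {0..t} (\<lambda>s. \<kappa> (c s))"
      by (rule continuous_on_compose2[OF chart_continuous(1) continuous_on_subset[OF c(1) sub]])
        (use stay BU in blast)
    moreover have dw: "((\<lambda>s. \<kappa> (c s)) has_vector_derivative d s) (at s within {0..t})" if "s \<in> {0..t} - S" for s
    proof -
      have "c s \<in> \<psi> ` cball (\<kappa> p) r" using stay[of s] that by auto
      then show ?thesis using d[of s] that sub has_vector_derivative_within_subset by blast
    qed
    moreover have "((\<lambda>s. \<kappa> (c s)) has_vector_derivative d s) (at s)"
        if "s \<in> {0..t} - insert 0 (insert t S)" for s
    proof -
      have "((\<lambda>s. \<kappa> (c s)) has_vector_derivative d s) (at s within {0..t})"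
        using dw that by blast
      then show ?thesis using that by (simp add: at_within_Icc_at)
    qed
    ultimately have "(d has_integral \<kappa> (c t) - \<kappa> (c 0)) {0..t}"
      using t S by (intro fundamental_theorem_of_calculus_strong[of "insert 0 (insert t S)"]) auto
    then show 1: "(d has_integral \<kappa> (c t) - \<kappa> p) {0..t}" using c(2) by simp
    have Nt: "N integrable_on {0..t}" by (rule integrable_on_subinterval[OF N(2) sub])
    define N' where "N' = (\<lambda>s. if s \<in> S then norm (d s) else N s)"
    have N': "N' integrable_on {0..t}" "integral {0..t} N' = integral {0..t} N"
      using integrable_spike_finite[OF S _ Nt, of N'] integral_spike[of S "{0..t}" N' N] S
      by (auto simp: N'_def negligible_finite)
    have "norm (integral {0..t} d) \<le> integral {0..t} N'"
    proof (rule integral_norm_bound_integral[OF has_integral_integrable[OF 1] N'(1)])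
      fix s assume s: "s \<in> {0..t}"
      show "norm (d s) \<le> N' s"
      proof (cases "s \<in> S")
        case False
        have "c s \<in> \<psi> ` cball (\<kappa> p) r" using stay[OF s] by auto
        then show ?thesis using d[of s] s sub False by (auto simp: N'_def)
      qed (simp add: N'_def)
    qed
    also have "\<dots> \<le> integral {0..1} N"
      unfolding N'(2) by (rule integral_subset_le[OF sub Nt N(2)]) (use N(1) in auto)
    finally show "\<kappa> (c t) \<in> cball (\<kappa> p) (integral {0..1} N)"
      using integral_unique[OF 1] by (simp add: dist_norm norm_minus_commute)
  qed
  show stay: "c s \<in> ?B" if s: "s \<in> {0..1}" for s
  proof (rule ccontr)
    assume ns: "c s \<notin> ?B"
    \<comment> \<open>The first exit time.\<close>
    define E where "E = {0..1} \<inter> c -` (- ?B)"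
    have "closed E" unfolding E_def using c(1) oB by (intro continuous_closed_preimage) auto
    moreover have "E \<noteq> {}" "bdd_below E" using ns s unfolding E_def by (auto intro!: bdd_belowI[of _ 0])
    ultimately have tE: "Inf E \<in> E" by (intro closed_contains_Inf)
    define t where "t = Inf E"
    have t: "t \<in> {0..1}" "c t \<notin> ?B" using tE unfolding t_def E_def by auto
    have before: "c u \<in> ?B" if "u \<in> {0..1}" "u < t" for u
    proof (rule ccontr)
      assume "c u \<notin> ?B"
      then have "u \<in> E" using that unfolding E_def by auto
      then have "t \<le> u" unfolding t_def using \<open>bdd_below E\<close> by (rule cInf_lower)
      then show False using that by simp
    qed
    have p0: "c 0 \<in> ?B" using c(2) p r(1) by (auto intro!: image_eqI[of _ _ "\<kappa> p"])
    then have "t \<noteq> 0" using t by metis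
    then have t0: "0 < t" using t by simp
    let ?K = "\<psi> ` cball (\<kappa> p) (integral {0..1} N)"
    have KB: "cball (\<kappa> p) (integral {0..1} N) \<subseteq> ball (\<kappa> p) r" using N(3) by auto
    have "compact ?K"
      by (intro compact_continuous_image continuous_on_subset[OF chart_continuous(2)] compact_cball)
        (use KB bU in blast)
    then have cK: "closed ?K" by (rule t2)
    have inK: "c u \<in> ?K" if u: "u \<in> {0..<t}" for u
    proof -
      have "\<kappa> (c u) \<in> cball (\<kappa> p) (integral {0..1} N)"
        by (rule ftc(2)) (use u t before in auto)
      moreover have "c u \<in> U" using before[of u] u t BU by auto
      ultimately show ?thesis by (intro image_eqI[of _ _ "\<kappa> (c u)"]) auto
    qed
    have "closedin (top_of_set {0..1}) ({0..1} \<inter> c -` ?K)"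
      by (rule continuous_closedin_preimage[OF c(1) cK])
    then have "closed ({0..1} \<inter> c -` ?K)" by (simp add: closedin_closed_eq)
    moreover have "{0..<t} \<subseteq> {0..1} \<inter> c -` ?K" using inK t by auto
    ultimately have "closure {0..<t} \<subseteq> {0..1} \<inter> c -` ?K" by (rule closure_minimal[rotated])
    moreover have "t \<in> closure {0..<t}" using t0 by (simp add: closure_atLeastLessThan)
    ultimately have "c t \<in> ?K" by blast
    then show False using t(2) KB by blast
  qed
  show "(d has_integral \<kappa> (c 1) - \<kappa> p) {0..1}" by (rule ftc(1)) (use stay in auto)
qed

end

section \<open>Displacement along horizontal curves\<close>

lemma continuous_bounded_integrable:
  fixes f :: "real \<Rightarrow> real"
  assumes S: "finite S" and c: "continuous_on ({a..b} - S) f" and B: "\<And>s. s \<in> {a..b} - S \<Longrightarrow> \<bar>f s\<bar> \<le> C"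
  shows "f integrable_on {a..b}"
proof -
  let ?F = "\<lambda>x. indicator ({a..b} - S) x *\<^sub>R f x"
  have m: "{a..b} - S \<in> sets borel" using S by (simp add: sets.Diff borel_closed finite_imp_closed)
  have "integrable lborel ?F"
  proof (rule Bochner_Integration.integrable_bound[of _ "\<lambda>x. indicator {a..b} x *\<^sub>R C"])
    show "integrable lborel (\<lambda>x. indicator {a..b} x *\<^sub>R C)"
      by (intro integrable_scaleR_left integrable_real_indicator emeasure_bounded_finite) simp_all
    show "?F \<in> borel_measurable lborel"
      using borel_measurable_continuous_on_indicator[OF m c] by simp
    show "AE x in lborel. norm (?F x) \<le> norm (indicator {a..b} x *\<^sub>R C)"
      using B by (intro AE_I2) (fastforce simp: indicator_def)
  qed
  then have "?F integrable_on UNIV" by (rule integrable_on_lborel)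
  then have "?F integrable_on {a..b}" by (rule integrable_on_subinterval) simp
  then show ?thesis by (rule integrable_spike_finite[OF S, rotated]) auto
qed

lemma norm_matrix_vector_le: "norm (A *v w) \<le> 3 * norm A * norm w" for A :: "real^3^3"
proof -
  have "norm (A *v w) \<le> (\<Sum>i\<in>UNIV. \<bar>(A *v w) $ i\<bar>)" by (rule norm_le_l1_cart)
  also have "\<dots> \<le> (\<Sum>i\<in>(UNIV :: 3 set). norm A * norm w)"
  proof (rule sum_mono)
    fix i
    have "\<bar>(A *v w) $ i\<bar> \<le> norm (A $ i) * norm w"
      unfolding matrix_vector_mul_component by (rule Cauchy_Schwarz_ineq2)
    also have "\<dots> \<le> norm A * norm w" by (intro mult_right_mono Finite_Cartesian_Product.norm_nth_le) simp
    finally show "\<bar>(A *v w) $ i\<bar> \<le> norm A * norm w" .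
  qed
  finally show ?thesis by simp
qed

text \<open>
  Locally, squared speeds on \<open>D\<close> are given by a continuous matrix field on the whole tangent space.
  This makes speeds of horizontal curves continuous functions between the break points.
\<close>
definition local_quadratic_form ::
  "('g::topological_space \<Rightarrow> (real^3) set) \<Rightarrow> ('g \<Rightarrow> real^3 \<Rightarrow> real^3 \<Rightarrow> real) \<Rightarrow> bool" where
  "local_quadratic_form D h \<longleftrightarrow> (\<forall>q0. \<exists>Q M. open Q \<and> q0 \<in> Q \<and> continuous_on Q M \<and>
     (\<forall>q\<in>Q. \<forall>w\<in>D q. h q w w = w \<bullet> ((M q :: real^3^3) *v w)))"

text \<open>
  The speed is continuous off a finite set and locally bounded; a bisection of the unit interval
  reduces the claim to subintervals on which one matrix field \<open>M\<close> applies.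
\<close>
lemma speed_integrable:
  assumes h: "local_quadratic_form D h" and \<gamma>: "horizontal_curve G D \<gamma> v"
  shows "(\<lambda>s. sqrt (h (\<gamma> s) (v s) (v s))) integrable_on {0..1}"
proof -
  obtain S where S: "finite S" "continuous_on ({0..1} - S) v" "\<And>s. s \<in> {0..1} - S \<Longrightarrow> v s \<in> D (\<gamma> s)"
    and gc: "continuous_on {0..1} \<gamma>" and b: "bounded (v ` {0..1})"
    using \<gamma> unfolding horizontal_curve_def by blast
  obtain V where V: "\<And>s. s \<in> {0..1} \<Longrightarrow> norm (v s) \<le> V" using b unfolding bounded_iff by blast
  have V0: "0 \<le> V" using V[of 0] norm_ge_zero[of "v 0"] by (meson atLeastAtMost_iff order_refl order_trans zero_le_one)
  let ?f = "\<lambda>s. sqrt (h (\<gamma> s) (v s) (v s))"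
  have "0 \<le> a \<longrightarrow> b \<le> 1 \<longrightarrow> ?f integrable_on {a..b}" if "a \<le> b" for a b
    using that
  proof (induction a b rule: Bolzano)
    case (trans a b c)
    then show ?case by (auto intro: Henstock_Kurzweil_Integration.integrable_combine)
  next
    case (local x)
    show ?case
    proof (cases "x \<in> {0..1}")
    case False
    then show ?thesis by (intro exI[of _ 1]) auto
    next
    case x: True
    obtain Q M where Q: "open Q" "\<gamma> x \<in> Q" "continuous_on Q M" "\<And>q w. q \<in> Q \<Longrightarrow> w \<in> D q \<Longrightarrow> h q w w = w \<bullet> (M q *v w)"
      using h unfolding local_quadratic_form_def by meson
    obtain A where A: "open A" "A \<inter> {0..1} = \<gamma> -` Q \<inter> {0..1}"
      using gc Q(1) unfolding continuous_on_open_invariant by blast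
    have Mc: "continuous_on (A \<inter> {0..1}) (\<lambda>s. M (\<gamma> s))"
      by (rule continuous_on_compose2[OF Q(3)]) (use A gc in \<open>auto intro: continuous_on_subset\<close>)
    have xA: "x \<in> A" using A(2) x Q(2) by blast
    then obtain e where e: "e > 0" "cball x e \<subseteq> A" using A(1) open_contains_cball by blast
    have "compact (cball x e \<inter> {0..1})" by (intro compact_Int_closed compact_cball) simp
    moreover have "continuous_on (cball x e \<inter> {0..1}) (\<lambda>s. M (\<gamma> s))"
      by (rule continuous_on_subset[OF Mc]) (use e in auto)
    ultimately have "bounded ((\<lambda>s. M (\<gamma> s)) ` (cball x e \<inter> {0..1}))"
      by (intro compact_imp_bounded compact_continuous_image)
    then obtain B where B: "\<And>s. s \<in> cball x e \<Longrightarrow> s \<in> {0..1} \<Longrightarrow> norm (M (\<gamma> s)) \<le> B" unfolding bounded_iff by blast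
    have B0: "B \<ge> 0" using B[of x] x e norm_ge_zero[of "M (\<gamma> x)"] by (meson centre_in_cball less_eq_real_def order_trans)
    have "?f integrable_on {a..b}" if ab: "a \<le> x" "x \<le> b" "b - a < e" "0 \<le> a" "b \<le> 1" for a b
    proof (rule continuous_bounded_integrable[OF S(1)])
      have in1: "s \<in> cball x e" "s \<in> {0..1}" if "s \<in> {a..b}" for s
        using that ab by (auto simp: dist_real_def)
      have inA: "s \<in> A \<inter> {0..1}" if "s \<in> {a..b}" for s using in1[OF that] e by auto
      have eq: "h (\<gamma> s) (v s) (v s) = v s \<bullet> (M (\<gamma> s) *v v s)" if s: "s \<in> {a..b} - S" for s
        using inA[of s] A(2) s S(3)[of s] by (intro Q(4)) auto
      have 1: "continuous_on ({a..b} - S) v" by (rule continuous_on_subset[OF S(2)]) (use in1 in auto)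
      have 2: "continuous_on ({a..b} - S) (\<lambda>s. M (\<gamma> s))" by (rule continuous_on_subset[OF Mc]) (use inA in auto)
      have vi: "continuous_on ({a..b} - S) (\<lambda>s. v s $ i)" for i by (intro continuous_intros 1)
      have Mi: "continuous_on ({a..b} - S) (\<lambda>s. M (\<gamma> s) $ i $ j)" for i j by (intro continuous_intros 2)
      have "continuous_on ({a..b} - S) (\<lambda>s. v s \<bullet> (M (\<gamma> s) *v v s))"
        unfolding inner_vec_def sum_3 matrix_vector_mult_def vec_lambda_beta inner_real_def
        by (intro continuous_on_add continuous_on_mult vi Mi)
      then have "continuous_on ({a..b} - S) (\<lambda>s. sqrt (v s \<bullet> (M (\<gamma> s) *v v s)))" by (rule continuous_on_real_sqrt)
      then show "continuous_on ({a..b} - S) ?f" by (rule continuous_on_eq) (simp add: eq)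
      fix s assume s: "s \<in> {a..b} - S"
      have s1: "s \<in> {a..b}" using s by simp
      have "\<bar>v s \<bullet> (M (\<gamma> s) *v v s)\<bar> \<le> norm (v s) * norm (M (\<gamma> s) *v v s)" by (rule Cauchy_Schwarz_ineq2)
      also have "\<dots> \<le> norm (v s) * (3 * norm (M (\<gamma> s)) * norm (v s))" by (intro mult_left_mono norm_matrix_vector_le) simp
      also have "\<dots> \<le> V * (3 * B * V)"
        using V[OF in1(2)[OF s1]] B[OF in1[OF s1]] B0 V0 by (intro mult_mono) auto
      finally have "\<bar>v s \<bullet> (M (\<gamma> s) *v v s)\<bar> \<le> V * (3 * B * V)" .
      then have "sqrt (v s \<bullet> (M (\<gamma> s) *v v s)) \<le> sqrt (V * (3 * B * V))"
          "sqrt (- (v s \<bullet> (M (\<gamma> s) *v v s))) \<le> sqrt (V * (3 * B * V))" by (auto intro: real_sqrt_le_mono)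
      then show "\<bar>?f s\<bar> \<le> sqrt (V * (3 * B * V))"
        unfolding eq[OF s] real_sqrt_minus by (rule abs_leI)
    qed
    then show ?thesis using e(1) by blast
    qed
  qed
  from this[of 0 1] show ?thesis by simp
qed

text \<open>
  The part of invariance under deck transformations shared by Riemannian and sub-Riemannian structures.
\<close>
definition deck_invariant ::
  "'g::topological_space lie_group_data \<Rightarrow> ('g \<Rightarrow> 'm) \<Rightarrow> ('g \<Rightarrow> (real^3) set) \<Rightarrow> ('g \<Rightarrow> real^3 \<Rightarrow> real^3 \<Rightarrow> real) \<Rightarrow> bool" where
  "deck_invariant G \<pi> D h \<longleftrightarrow> (\<forall>\<delta>\<in>deck \<pi>. smooth_map G \<delta> \<and>
     (\<forall>q. \<exists>A. is_differential G \<delta> q A \<and>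
        (\<forall>w\<in>D q. A *v w \<in> D (\<delta> q) \<and> h (\<delta> q) (A *v w) (A *v w) = h q w w)))"

context lie_chart
begin

text \<open>
  Coordinate velocities, measured by \<open>\<phi>\<close>, are bounded by the speed. Here \<open>\<phi>\<close> is the norm or a covector.
\<close>
definition velocity_bound :: "('g \<Rightarrow> (real^3) set) \<Rightarrow> ('g \<Rightarrow> real^3 \<Rightarrow> real^3 \<Rightarrow> real) \<Rightarrow> real^3 \<Rightarrow> real \<Rightarrow> (real^3 \<Rightarrow> real) \<Rightarrow> real \<Rightarrow> bool" where
  "velocity_bound D h x0 r \<phi> C \<longleftrightarrow> (\<forall>x\<in>cball x0 r. \<forall>w\<in>D (\<psi> x).
      \<phi> (frame_matrix G \<kappa> (\<psi> x) *v w) \<le> C * sqrt (h (\<psi> x) w w))"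

text \<open>
  The curve \<open>\<delta> \<circ> \<gamma>\<close> is followed in the chart at \<open>p\<close>. Its coordinates are smooth functions of \<open>\<gamma>\<close>
  pulled back by \<open>\<delta>\<close>, so their derivatives are obtained from the velocity of \<open>\<gamma>\<close> and the differential
  of \<open>\<delta>\<close>, which preserves \<open>D\<close> and \<open>h\<close>; the displacement is the integral of these derivatives.
\<close>
lemma curve_displacement:
  assumes p: "p \<in> U" and r: "r > 0" "cball (\<kappa> p) r \<subseteq> \<kappa> ` U"
    and t2: "\<And>K. compact K \<Longrightarrow> closed (K :: 'g set)"
    and D: "deck_invariant G \<pi> D h" "local_quadratic_form D h"
    and hpos: "\<And>q w. w \<in> D q \<Longrightarrow> 0 \<le> h q w w"
    and C: "0 \<le> C" "velocity_bound D h (\<kappa> p) r norm C"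
    and \<delta>: "\<delta> \<in> deck \<pi>" "\<delta> (\<gamma> 0) = p" and \<gamma>: "horizontal_curve G D \<gamma> v"
    and L: "C * curve_length h \<gamma> v < r"
  shows "\<delta> (\<gamma> 1) \<in> \<psi> ` ball (\<kappa> p) r"
    and "norm (\<kappa> (\<delta> (\<gamma> 1)) - \<kappa> p) \<le> C * curve_length h \<gamma> v"
    and "\<And>r' \<eta>. velocity_bound D h (\<kappa> p) r' (\<lambda>x. \<bar>\<nu> \<bullet> x\<bar>) \<eta> \<Longrightarrow> C * curve_length h \<gamma> v < r' \<Longrightarrow> r' \<le> r \<Longrightarrow>
       \<bar>\<nu> \<bullet> (\<kappa> (\<delta> (\<gamma> 1)) - \<kappa> p)\<bar> \<le> \<eta> * curve_length h \<gamma> v"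
proof -
  obtain S where S: "finite S" "\<And>s. s \<in> {0..1} - S \<Longrightarrow> has_velocity G \<gamma> s (v s)" "\<And>s. s \<in> {0..1} - S \<Longrightarrow> v s \<in> D (\<gamma> s)"
    and c: "continuous_on {0..1} \<gamma>"
    using \<gamma> unfolding horizontal_curve_def by blast
  have sm: "smooth_map G \<delta>" using D(1) \<delta>(1) unfolding deck_invariant_def by blast
  have "\<forall>q. \<exists>A. is_differential G \<delta> q A \<and>
        (\<forall>w\<in>D q. A *v w \<in> D (\<delta> q) \<and> h (\<delta> q) (A *v w) (A *v w) = h q w w)"
    using D(1) \<delta>(1) unfolding deck_invariant_def by blast
  then obtain A where A: "\<And>q. is_differential G \<delta> q (A q)"
    "\<And>q w. w \<in> D q \<Longrightarrow> A q *v w \<in> D (\<delta> q)" "\<And>q w. w \<in> D q \<Longrightarrow> h (\<delta> q) (A q *v w) (A q *v w) = h q w w"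
    by metis
  have \<delta>c: "continuous_on UNIV \<delta>" using \<delta>(1) unfolding deck_def homeomorphism_def by blast
  define cu where "cu s = \<delta> (\<gamma> s)" for s
  have cc: "continuous_on {0..1} cu" unfolding cu_def by (rule continuous_on_compose2[OF \<delta>c c]) simp
  define f where "f s = sqrt (h (\<gamma> s) (v s) (v s))" for s
  define w where "w s = A (\<gamma> s) *v v s" for s
  \<comment> \<open>At the finitely many break points the velocity is arbitrary; it is replaced by zero.\<close>
  define d where "d s = (if s \<in> S then 0 else frame_matrix G \<kappa> (cu s) *v w s)" for s
  define N where "N s = (if s \<in> S then 0 else C * \<bar>f s\<bar>)" for s
  have fi: "f integrable_on {0..1}" unfolding f_def by (rule speed_integrable[OF D(2) \<gamma>])
  have f0: "0 \<le> f s" if "s \<in> {0..1} - S" for s unfolding f_def using hpos[OF S(3)[OF that]] by simp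
  have wD: "w s \<in> D (cu s)" "sqrt (h (cu s) (w s) (w s)) = f s" if "s \<in> {0..1} - S" for s
    unfolding w_def cu_def f_def using A(2,3)[OF S(3)[OF that]] by simp_all
  have Nf: "N s = C * f s" if "s \<in> {0..1} - S" for s using f0[OF that] that by (simp add: N_def)
  have Cfi: "(\<lambda>s. C * f s) integrable_on {0..1}" using integrable_cmul[OF fi, of C] by simp
  have Ni: "N integrable_on {0..1}" by (rule integrable_spike_finite[OF S(1) _ Cfi]) (use Nf in auto)
  have "integral {0..1} N = integral {0..1} (\<lambda>s. C * f s)"
    by (rule integral_spike[of S]) (use S(1) Nf in \<open>auto simp: negligible_finite\<close>)
  then have NL: "integral {0..1} N = C * curve_length h \<gamma> v"
    unfolding curve_length_def f_def by simp
  have der: "((\<lambda>s. \<kappa> (cu s)) has_vector_derivative d s) (at s within {0..1})"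
    if s: "s \<in> {0..1} - S" and cU: "cu s \<in> U" for s
  proof -
    have "((\<lambda>s. \<kappa> (cu s) $ i) has_real_derivative d s $ i) (at s within {0..1})" for i
    proof -
      have sf: "smooth_fun G (\<delta> -` U) ((\<lambda>q. \<kappa> q $ i) \<circ> \<delta>)"
        using sm smooth_fun_coordinate[of i] unfolding smooth_map_def by blast
      have "((\<lambda>q. \<kappa> q $ i) \<circ> \<delta> \<circ> \<gamma> has_real_derivative left_field G (v s) ((\<lambda>q. \<kappa> q $ i) \<circ> \<delta>) (\<gamma> s)) (at s within {0..1})"
        using S(2)[OF s] sf cU unfolding has_velocity_def cu_def by blast
      moreover have "left_field G (v s) ((\<lambda>q. \<kappa> q $ i) \<circ> \<delta>) (\<gamma> s) = left_field G (w s) (\<lambda>q. \<kappa> q $ i) (cu s)"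
        using A(1)[of "\<gamma> s"] smooth_fun_coordinate[of i] cU unfolding is_differential_def w_def cu_def by blast
      moreover have "left_field G (w s) (\<lambda>q. \<kappa> q $ i) (cu s) = (frame_matrix G \<kappa> (cu s) *v w s) $ i"
        by (rule left_field_chart[OF cU chart_homeo(1) cU, where F = "\<lambda>x. x $ i" and F' = "\<lambda>x. x $ i"])
          (simp, rule bounded_linear_imp_has_derivative[OF bounded_linear_vec_nth])
      ultimately show ?thesis using s by (simp add: d_def cu_def o_def)
    qed
    then have comp: "((\<lambda>s. \<kappa> (cu s) $ i) has_derivative (\<lambda>h. h * d s $ i)) (at s within {0..1})" for i
      unfolding has_field_derivative_def mult_commute_abs .
    show ?thesis
      unfolding has_vector_derivative_def
    proof (subst has_derivative_componentwise_within, intro ballI)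
      fix b :: "real^3" assume "b \<in> Basis"
      then obtain i where b: "b = axis i 1" unfolding Basis_vec_def by auto
      show "((\<lambda>s. \<kappa> (cu s) \<bullet> b) has_derivative (\<lambda>h. (h *\<^sub>R d s) \<bullet> b)) (at s within {0..1})"
        using comp[of i] unfolding b by (simp add: inner_axis)
    qed
  qed
  have inU: "q \<in> U" "\<kappa> q \<in> cball (\<kappa> p) r'" "\<psi> (\<kappa> q) = q" if asm: "q \<in> \<psi> ` cball (\<kappa> p) r'" "r' \<le> r" for q r'
  proof -
    obtain x where x: "x \<in> cball (\<kappa> p) r'" "q = \<psi> x" using asm(1) by blast
    moreover have "x \<in> cball (\<kappa> p) r" using x(1) asm(2) by simp
    ultimately have xU: "x \<in> \<kappa> ` U" using r(2) by blast
    then show "q \<in> U" "\<kappa> q \<in> cball (\<kappa> p) r'" "\<psi> (\<kappa> q) = q" using x by simp_all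
  qed
  have stays: "(\<forall>s\<in>{0..1}. cu s \<in> \<psi> ` ball (\<kappa> p) r') \<and> (d has_integral \<kappa> (cu 1) - \<kappa> p) {0..1}"
    if r': "C * curve_length h \<gamma> v < r'" "r' \<le> r" "0 < r'" for r'
  proof -
    have sub: "cball (\<kappa> p) r' \<subseteq> \<kappa> ` U" using r(2) r'(2) by auto
    have dd: "((\<lambda>s. \<kappa> (cu s)) has_vector_derivative d s) (at s within {0..1}) \<and> norm (d s) \<le> N s"
      if s: "s \<in> {0..1} - S" "cu s \<in> \<psi> ` cball (\<kappa> p) r'" for s
    proof -
      note i = inU[OF s(2) r'(2)]
      have "\<kappa> (cu s) \<in> cball (\<kappa> p) r" using i(2) r'(2) by auto
      moreover have "w s \<in> D (\<psi> (\<kappa> (cu s)))" using wD(1)[OF s(1)] i(3) by simp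
      ultimately have "norm (frame_matrix G \<kappa> (\<psi> (\<kappa> (cu s))) *v w s) \<le> C * sqrt (h (\<psi> (\<kappa> (cu s))) (w s) (w s))"
        using C(2) unfolding velocity_bound_def by blast
      then have "norm (d s) \<le> N s" using s(1) wD(2)[OF s(1)] Nf[OF s(1)] i(3) by (simp add: d_def)
      then show ?thesis using der[OF s(1) i(1)] by simp
    qed
    have N0: "0 \<le> N s" for s using C(1) by (simp add: N_def)
    have c0: "cu 0 = p" using \<delta>(2) by (simp add: cu_def)
    have NL': "integral {0..1} N < r'" using r'(1) NL by simp
    show ?thesis
      using short_curve_stays[OF p r'(3) sub cc c0 t2 S(1) dd N0 Ni NL'] by blast
  qed
  have L0: "0 \<le> curve_length h \<gamma> v"
  proof -
    have "integral {0..1} f = integral {0..1} (\<lambda>s. if s \<in> S then 0 else f s)"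
      by (rule integral_spike[of S]) (use S(1) in \<open>auto simp: negligible_finite\<close>)
    moreover have "(\<lambda>s. if s \<in> S then 0 else f s) integrable_on {0..1}"
      by (rule integrable_spike_finite[OF S(1) _ fi]) auto
    ultimately show ?thesis unfolding curve_length_def f_def[symmetric]
      using f0 by (auto intro!: integral_nonneg)
  qed
  note st = stays[OF L order_refl r(1)]
  have 1: "(d has_integral \<kappa> (cu 1) - \<kappa> p) {0..1}" using st by blast
  have in1: "cu s \<in> \<psi> ` ball (\<kappa> p) r" if "s \<in> {0..1}" for s using st that by blast
  show "\<delta> (\<gamma> 1) \<in> \<psi> ` ball (\<kappa> p) r" using in1[of 1] by (simp add: cu_def)
  have bd: "norm (d s) \<le> N s" if s: "s \<in> {0..1}" for s
  proof (cases "s \<in> S")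
    case False
    have "cu s \<in> \<psi> ` cball (\<kappa> p) r" using in1[OF s] by auto
    note i = inU[OF this order_refl]
    have "w s \<in> D (\<psi> (\<kappa> (cu s)))" using wD(1)[of s] s False i(3) by simp
    then have "norm (frame_matrix G \<kappa> (\<psi> (\<kappa> (cu s))) *v w s) \<le> C * sqrt (h (\<psi> (\<kappa> (cu s))) (w s) (w s))"
      using C(2) i(2) unfolding velocity_bound_def by blast
    then show ?thesis using s False wD(2)[of s] Nf[of s] i(3) by (simp add: d_def)
  qed (simp add: d_def N_def)
  have "norm (integral {0..1} d) \<le> integral {0..1} N"
    by (rule integral_norm_bound_integral[OF has_integral_integrable[OF 1] Ni bd])
  then show "norm (\<kappa> (\<delta> (\<gamma> 1)) - \<kappa> p) \<le> C * curve_length h \<gamma> v"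
    using integral_unique[OF 1] NL by (simp add: cu_def)
  show "\<bar>\<nu> \<bullet> (\<kappa> (\<delta> (\<gamma> 1)) - \<kappa> p)\<bar> \<le> \<eta> * curve_length h \<gamma> v"
    if vb: "velocity_bound D h (\<kappa> p) r' (\<lambda>x. \<bar>\<nu> \<bullet> x\<bar>) \<eta>" and r': "C * curve_length h \<gamma> v < r'" "r' \<le> r" for r' \<eta>
  proof -
    have r0: "0 < r'" using r'(1) L0 C(1) by (meson le_less_trans mult_nonneg_nonneg)
    have in': "cu s \<in> \<psi> ` ball (\<kappa> p) r'" if "s \<in> {0..1}" for s using stays[OF r' r0] that by blast
    define N' where "N' s = (if s \<in> S then 0 else \<eta> * f s)" for s
    have fi': "(\<lambda>s. \<eta> * f s) integrable_on {0..1}" using integrable_cmul[OF fi, of \<eta>] by simp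
    have Ni': "N' integrable_on {0..1}" by (rule integrable_spike_finite[OF S(1) _ fi']) (auto simp: N'_def)
    have "integral {0..1} N' = integral {0..1} (\<lambda>s. \<eta> * f s)"
      by (rule integral_spike[of S]) (use S(1) in \<open>auto simp: negligible_finite N'_def\<close>)
    then have NL': "integral {0..1} N' = \<eta> * curve_length h \<gamma> v"
      unfolding curve_length_def f_def by simp
    have 2: "((\<lambda>s. \<nu> \<bullet> d s) has_integral \<nu> \<bullet> (\<kappa> (cu 1) - \<kappa> p)) {0..1}"
      using has_integral_linear[OF 1 bounded_linear_inner_right[of \<nu>]] by (simp add: o_def)
    have "norm (integral {0..1} (\<lambda>s. \<nu> \<bullet> d s)) \<le> integral {0..1} N'"
    proof (rule integral_norm_bound_integral[OF has_integral_integrable[OF 2] Ni'])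
      fix s assume s: "s \<in> {0..1::real}"
      show "norm (\<nu> \<bullet> d s) \<le> N' s"
      proof (cases "s \<in> S")
        case False
        have "cu s \<in> \<psi> ` cball (\<kappa> p) r'" using in'[OF s] by auto
        note i = inU[OF this r'(2)]
        have "w s \<in> D (\<psi> (\<kappa> (cu s)))" using wD(1)[of s] s False i(3) by simp
        then have "\<bar>\<nu> \<bullet> (frame_matrix G \<kappa> (\<psi> (\<kappa> (cu s))) *v w s)\<bar> \<le> \<eta> * sqrt (h (\<psi> (\<kappa> (cu s))) (w s) (w s))"
          using vb i(2) unfolding velocity_bound_def by blast
        then show ?thesis using s False wD(2)[of s] i(3) by (simp add: d_def N'_def)
      qed (simp add: d_def N'_def)
    qed
    then show ?thesis using integral_unique[OF 2] NL' by (simp add: cu_def)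
  qed
qed

end

section \<open>Local geometry of sub-Riemannian structures\<close>

text \<open>
  The vector whose inner product with \<open>w\<close> is the coefficient of \<open>Y\<close> in \<open>w = \<alpha> Y + \<beta> Z\<close> (Cramer's rule for
  the Gram matrix).
\<close>
definition plane_coordinate :: "real^3 \<Rightarrow> real^3 \<Rightarrow> real^3" where
  "plane_coordinate Y Z = (1 / ((Y \<bullet> Y) * (Z \<bullet> Z) - (Y \<bullet> Z)\<^sup>2)) *\<^sub>R ((Z \<bullet> Z) *\<^sub>R Y - (Y \<bullet> Z) *\<^sub>R Z)"

lemma plane_gram_nonzero:
  fixes Y Z :: "real^3"
  assumes "dim (span {Y, Z}) = 2"
  shows "(Y \<bullet> Y) * (Z \<bullet> Z) - (Y \<bullet> Z)\<^sup>2 \<noteq> 0"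
proof
  assume 0: "(Y \<bullet> Y) * (Z \<bullet> Z) - (Y \<bullet> Z)\<^sup>2 = 0"
  let ?u = "(Z \<bullet> Z) *\<^sub>R Y - (Y \<bullet> Z) *\<^sub>R Z"
  have "?u \<bullet> ?u = (Z \<bullet> Z) * ((Y \<bullet> Y) * (Z \<bullet> Z) - (Y \<bullet> Z)\<^sup>2)"
    by (simp add: inner_diff_left inner_diff_right inner_commute power2_eq_square algebra_simps)
  then have u: "(Z \<bullet> Z) *\<^sub>R Y = (Y \<bullet> Z) *\<^sub>R Z" using 0 by simp
  have "\<exists>X. span {Y, Z} \<subseteq> span {X}"
  proof (cases "Z = 0")
    case True
    then show ?thesis by (intro exI[of _ Y]) (simp add: insert_commute span_insert_0)
  next
    case False
    then have "Y = ((Y \<bullet> Z) / (Z \<bullet> Z)) *\<^sub>R Z"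
      using arg_cong[OF u, of "\<lambda>x. (1 / (Z \<bullet> Z)) *\<^sub>R x"] by simp
    then have "Y \<in> span {Z}" by (metis span_base span_scale singletonI)
    then show ?thesis using span_minimal[of "{Y, Z}" "span {Z}"] by (intro exI[of _ Z]) (simp add: span_base)
  qed
  then obtain X where "span {Y, Z} \<subseteq> span {X}" by blast
  then have "dim (span {Y, Z}) \<le> dim (span {X})" by (rule dim_subset)
  also have "\<dots> \<le> card {X}" unfolding dim_span by (rule dim_le_card') simp
  finally show False using assms by simp
qed

lemma plane_form:
  fixes Y Z :: "real^3"
  assumes dim: "dim (span {Y, Z}) = 2" and h: "inner_product_on (span {Y, Z}) h"
  shows "w \<in> span {Y, Z} \<Longrightarrow> w = (plane_coordinate Y Z \<bullet> w) *\<^sub>R Y + (plane_coordinate Z Y \<bullet> w) *\<^sub>R Z"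
    and "w \<in> span {Y, Z} \<Longrightarrow> h w w = (plane_coordinate Y Z \<bullet> w)\<^sup>2 * h Y Y
       + 2 * (plane_coordinate Y Z \<bullet> w) * (plane_coordinate Z Y \<bullet> w) * h Y Z + (plane_coordinate Z Y \<bullet> w)\<^sup>2 * h Z Z"
    and "0 < h Y Y + h Z Z" "0 < h Y Y * h Z Z - (h Y Z)\<^sup>2"
proof -
  let ?V = "span {Y, Z}"
  define \<Delta> where "\<Delta> = (Y \<bullet> Y) * (Z \<bullet> Z) - (Y \<bullet> Z)\<^sup>2"
  have \<Delta>: "\<Delta> \<noteq> 0" using plane_gram_nonzero[OF dim] unfolding \<Delta>_def .
  have YZ: "Y \<in> ?V" "Z \<in> ?V" "0 \<in> ?V" by (simp_all add: span_base span_zero)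
  have sym: "h v w = h w v" if "v \<in> ?V" "w \<in> ?V" for v w
    using h that unfolding inner_product_on_def by blast
  have pos: "0 < h v v" if "v \<in> ?V" "v \<noteq> 0" for v
    using h that unfolding inner_product_on_def by blast
  have lin: "h (u + c *\<^sub>R v) w = h u w + c * h v w" if "u \<in> ?V" "v \<in> ?V" "w \<in> ?V" for u v w c
    using h that unfolding inner_product_on_def by blast
  have h0: "h 0 w = 0" if "w \<in> ?V" for w using lin[OF YZ(3,3) that, of 1] by simp
  have l2: "h (a *\<^sub>R Y + b *\<^sub>R Z) w = a * h Y w + b * h Z w" if "w \<in> ?V" for a b w
  proof -
    have "a *\<^sub>R Y \<in> ?V" by (intro span_scale YZ)
    then have "h (a *\<^sub>R Y + b *\<^sub>R Z) w = h (a *\<^sub>R Y) w + b * h Z w" using lin YZ that by blast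
    moreover have "h (0 + a *\<^sub>R Y) w = h 0 w + a * h Y w" using lin[OF YZ(3) YZ(1) that] .
    ultimately show ?thesis using h0[OF that] by simp
  qed
  have quad: "h (a *\<^sub>R Y + b *\<^sub>R Z) (a *\<^sub>R Y + b *\<^sub>R Z) = a\<^sup>2 * h Y Y + 2 * a * b * h Y Z + b\<^sup>2 * h Z Z" for a b
  proof -
    have w: "a *\<^sub>R Y + b *\<^sub>R Z \<in> ?V" by (intro span_add span_scale YZ)
    have "h Y (a *\<^sub>R Y + b *\<^sub>R Z) = a * h Y Y + b * h Y Z"
      using sym[OF YZ(1) w] l2[OF YZ(1)] sym[OF YZ(1,2)] by simp
    moreover have "h Z (a *\<^sub>R Y + b *\<^sub>R Z) = a * h Y Z + b * h Z Z"
      using sym[OF YZ(2) w] l2[OF YZ(2)] by simp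
    ultimately show ?thesis using l2[OF w] by (simp add: power2_eq_square algebra_simps)
  qed
  have indep: "a *\<^sub>R Y + b *\<^sub>R Z \<noteq> 0" if "a \<noteq> 0 \<or> b \<noteq> 0" for a b
  proof
    assume 0: "a *\<^sub>R Y + b *\<^sub>R Z = 0"
    have 1: "a * (Y \<bullet> Y) + b * (Y \<bullet> Z) = 0" "a * (Y \<bullet> Z) + b * (Z \<bullet> Z) = 0"
      using arg_cong[OF 0, of "\<lambda>x. Y \<bullet> x"] arg_cong[OF 0, of "\<lambda>x. Z \<bullet> x"]
      by (simp_all add: inner_add_right inner_commute)
    have "a * \<Delta> = (Z \<bullet> Z) * (a * (Y \<bullet> Y) + b * (Y \<bullet> Z)) - (Y \<bullet> Z) * (a * (Y \<bullet> Z) + b * (Z \<bullet> Z))"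
      "b * \<Delta> = (Y \<bullet> Y) * (a * (Y \<bullet> Z) + b * (Z \<bullet> Z)) - (Y \<bullet> Z) * (a * (Y \<bullet> Y) + b * (Y \<bullet> Z))"
      unfolding \<Delta>_def by (simp_all add: power2_eq_square algebra_simps)
    then show False using \<Delta> that unfolding 1 by simp
  qed
  have Y0: "Y \<noteq> 0" "Z \<noteq> 0" using indep[of 1 0] indep[of 0 1] by auto
  have EK: "0 < h Y Y" "0 < h Z Z" using pos YZ Y0 by auto
  then show "0 < h Y Y + h Z Z" by simp
  have "0 < h ((- h Y Z) *\<^sub>R Y + h Y Y *\<^sub>R Z) ((- h Y Z) *\<^sub>R Y + h Y Y *\<^sub>R Z)"
    by (intro pos span_add span_scale YZ indep) (use EK in simp)
  also have "\<dots> = h Y Y * (h Y Y * h Z Z - (h Y Z)\<^sup>2)"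
    unfolding quad by (simp add: power2_eq_square algebra_simps)
  finally show "0 < h Y Y * h Z Z - (h Y Z)\<^sup>2" using EK by (simp add: zero_less_mult_iff)
  show dec: "w = (plane_coordinate Y Z \<bullet> w) *\<^sub>R Y + (plane_coordinate Z Y \<bullet> w) *\<^sub>R Z" if wV: "w \<in> ?V" for w
  proof -
    obtain a where "w - a *\<^sub>R Y \<in> span {Z}" using wV by (auto simp: span_breakdown_eq[of w Y])
    then obtain b where "w - a *\<^sub>R Y = b *\<^sub>R Z" by (auto simp: span_singleton)
    then have w: "w = a *\<^sub>R Y + b *\<^sub>R Z" by (simp add: diff_eq_eq add.commute)
    have "((Z \<bullet> Z) *\<^sub>R Y - (Y \<bullet> Z) *\<^sub>R Z) \<bullet> w = a * \<Delta>" "((Y \<bullet> Y) *\<^sub>R Z - (Z \<bullet> Y) *\<^sub>R Y) \<bullet> w = b * \<Delta>"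
      unfolding w \<Delta>_def by (simp_all add: inner_diff_left inner_add_right inner_commute power2_eq_square algebra_simps)
    moreover have "(Z \<bullet> Z) * (Y \<bullet> Y) - (Z \<bullet> Y)\<^sup>2 = \<Delta>" unfolding \<Delta>_def by (simp add: inner_commute)
    ultimately have "plane_coordinate Y Z \<bullet> w = a" "plane_coordinate Z Y \<bullet> w = b"
      unfolding plane_coordinate_def \<Delta>_def[symmetric] using \<Delta> by (simp_all add: \<Delta>_def[symmetric])
    then show ?thesis using w by simp
  qed
  show "h w w = (plane_coordinate Y Z \<bullet> w)\<^sup>2 * h Y Y
       + 2 * (plane_coordinate Y Z \<bullet> w) * (plane_coordinate Z Y \<bullet> w) * h Y Z + (plane_coordinate Z Y \<bullet> w)\<^sup>2 * h Z Z"
    if "w \<in> ?V"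
    using quad dec[OF that] by metis
qed

lemma quadratic_form_lower_bound:
  fixes E F K a b :: real
  assumes "0 < E + K" "0 < E * K - F\<^sup>2"
  shows "(E * K - F\<^sup>2) / (E + K) * (a\<^sup>2 + b\<^sup>2) \<le> a\<^sup>2 * E + 2 * a * b * F + b\<^sup>2 * K"
proof -
  have "(E + K) * (a\<^sup>2 * E + 2 * a * b * F + b\<^sup>2 * K) - (E * K - F\<^sup>2) * (a\<^sup>2 + b\<^sup>2) = (E * a + F * b)\<^sup>2 + (F * a + K * b)\<^sup>2"
    by (simp add: power2_eq_square algebra_simps)
  then have "(E * K - F\<^sup>2) * (a\<^sup>2 + b\<^sup>2) \<le> (E + K) * (a\<^sup>2 * E + 2 * a * b * F + b\<^sup>2 * K)"
    using zero_le_power2[of "E * a + F * b"] zero_le_power2[of "F * a + K * b"] by linarith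
  then show ?thesis using assms(1) by (simp add: pos_divide_le_eq mult.commute)
qed

lemma smooth_field_continuous:
  fixes Y :: "'g::t2_space \<Rightarrow> real^3"
  assumes "lie_group G" "smooth_field G U Y" "q \<in> U"
  shows "isCont Y q"
  unfolding isCont_def
  by (rule vec_tendstoI) (use smooth_fun_continuous[OF assms(1) assms(2)[unfolded smooth_field_def, rule_format] assms(3)] in \<open>simp add: isCont_def\<close>)

lemma sub_riemannian_frame:
  assumes "sub_riemannian_structure G \<pi> D h"
  obtains U Y Z where "p \<in> U" "smooth_field G U Y" "smooth_field G U Z" "\<And>q. q \<in> U \<Longrightarrow> D q = span {Y q, Z q}"
    "smooth_fun G U (\<lambda>q. h q (Y q) (Y q))" "smooth_fun G U (\<lambda>q. h q (Y q) (Z q))" "smooth_fun G U (\<lambda>q. h q (Z q) (Z q))"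
    "\<And>q. q \<in> U \<Longrightarrow> dim (span {Y q, Z q}) = 2" "\<And>q. q \<in> U \<Longrightarrow> inner_product_on (span {Y q, Z q}) (h q)"
proof -
  have "\<forall>p. \<exists>U Y Z. p \<in> U \<and> smooth_field G U Y \<and> smooth_field G U Z \<and>
          (\<forall>q\<in>U. D q = span {Y q, Z q}) \<and>
          smooth_fun G U (\<lambda>q. h q (Y q) (Y q)) \<and> smooth_fun G U (\<lambda>q. h q (Y q) (Z q)) \<and>
          smooth_fun G U (\<lambda>q. h q (Z q) (Z q))"
    and d: "\<And>p. dim (D p) = 2" "\<And>p. inner_product_on (D p) (h p)"
    using assms unfolding sub_riemannian_structure_def by simp_all
  from spec[OF this(1), of p] obtain U Y Z where U: "p \<in> U" "smooth_field G U Y" "smooth_field G U Z"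
    and D: "\<forall>q\<in>U. D q = span {Y q, Z q}" and
    E: "smooth_fun G U (\<lambda>q. h q (Y q) (Y q))" "smooth_fun G U (\<lambda>q. h q (Y q) (Z q))" "smooth_fun G U (\<lambda>q. h q (Z q) (Z q))"
    by (elim exE conjE)
  have "dim (span {Y q, Z q}) = 2" "inner_product_on (span {Y q, Z q}) (h q)" if q: "q \<in> U" for q
    using d[of q] bspec[OF D q] by simp_all
  with U bspec[OF D] E show ?thesis by (rule that)
qed

lemma sub_riemannian_local_quadratic_form:
  fixes G :: "'g::t2_space lie_group_data"
  assumes G: "lie_group G" and sr: "sub_riemannian_structure G \<pi> D h"
  shows "local_quadratic_form D h"
  unfolding local_quadratic_form_def
proof
  fix p
  obtain U Y Z where U: "p \<in> U" "smooth_field G U Y" "smooth_field G U Z" and D: "\<And>q. q \<in> U \<Longrightarrow> D q = span {Y q, Z q}"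
    and E: "smooth_fun G U (\<lambda>q. h q (Y q) (Y q))" "smooth_fun G U (\<lambda>q. h q (Y q) (Z q))" "smooth_fun G U (\<lambda>q. h q (Z q) (Z q))"
    and dim: "\<And>q. q \<in> U \<Longrightarrow> dim (span {Y q, Z q}) = 2" and ip: "\<And>q. q \<in> U \<Longrightarrow> inner_product_on (span {Y q, Z q}) (h q)"
    using sub_riemannian_frame[OF sr, of p] by blast
  have oU: "open U" using E(1) unfolding smooth_fun_def by blast
  \<comment> \<open>The form is evaluated on the two coordinates of \<open>w\<close> in the frame \<open>Y, Z\<close>, which are linear in \<open>w\<close> and continuous in \<open>q\<close>.\<close>
  define a where "a q = plane_coordinate (Y q) (Z q)" for q
  define b where "b q = plane_coordinate (Z q) (Y q)" for q
  define M :: "'g \<Rightarrow> real^3^3" where "M q = (\<chi> i j. a q $ i * a q $ j * h q (Y q) (Y q)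
     + (a q $ i * b q $ j + b q $ i * a q $ j) * h q (Y q) (Z q) + b q $ i * b q $ j * h q (Z q) (Z q))" for q
  have Yc: "continuous_on U Y" "continuous_on U Z"
    using smooth_field_continuous[OF G U(2)] smooth_field_continuous[OF G U(3)] by (auto intro!: continuous_at_imp_continuous_on)
  have g: "(Y q \<bullet> Y q) * (Z q \<bullet> Z q) - (Y q \<bullet> Z q)\<^sup>2 \<noteq> 0" "(Z q \<bullet> Z q) * (Y q \<bullet> Y q) - (Z q \<bullet> Y q)\<^sup>2 \<noteq> 0"
    if "q \<in> U" for q using plane_gram_nonzero[OF dim[OF that]] by (simp_all add: inner_commute mult.commute)
  have ac: "continuous_on U a" "continuous_on U b"
    unfolding a_def b_def plane_coordinate_def
    by (intro continuous_on_scaleR continuous_on_divide continuous_on_diff continuous_on_mult continuous_on_inner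
        continuous_on_power continuous_on_const Yc; use g in blast)+
  have Ec: "continuous_on U (\<lambda>q. h q (Y q) (Y q))" "continuous_on U (\<lambda>q. h q (Y q) (Z q))" "continuous_on U (\<lambda>q. h q (Z q) (Z q))"
    using smooth_fun_continuous[OF G E(1)] smooth_fun_continuous[OF G E(2)] smooth_fun_continuous[OF G E(3)]
    by (auto intro!: continuous_at_imp_continuous_on)
  have ai: "continuous_on U (\<lambda>q. a q $ i)" "continuous_on U (\<lambda>q. b q $ i)" for i
    by (intro continuous_intros ac)+
  have "continuous_on U M" unfolding M_def
    by (intro continuous_on_vec_lambda continuous_on_add continuous_on_mult ai Ec)
  moreover have "h q w w = w \<bullet> (M q *v w)" if q: "q \<in> U" and w: "w \<in> D q" for q w
  proof -
    have "w \<in> span {Y q, Z q}" using w D[OF q] by simp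
    from plane_form(2)[OF dim[OF q] ip[OF q] this]
    have "h q w w = (a q \<bullet> w)\<^sup>2 * h q (Y q) (Y q) + 2 * (a q \<bullet> w) * (b q \<bullet> w) * h q (Y q) (Z q) + (b q \<bullet> w)\<^sup>2 * h q (Z q) (Z q)"
      by (simp add: a_def b_def)
    also have "\<dots> = w \<bullet> (M q *v w)"
      by (simp add: M_def inner_vec_def sum_3 matrix_vector_mult_def power2_eq_square algebra_simps)
    finally show ?thesis .
  qed
  ultimately show "\<exists>Q M. open Q \<and> p \<in> Q \<and> continuous_on Q M \<and>
     (\<forall>q\<in>Q. \<forall>w\<in>D q. h q w w = w \<bullet> ((M q :: real^3^3) *v w))"
    using oU U(1) by blast
qed

context lie_chart
begin

text \<open>
  The Gram matrix of \<open>h\<close> in a local frame of the distribution is continuous and positive definite, so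
on a compact ball its smallest eigenvalue stays away from zero.
\<close>
lemma sub_riemannian_velocity_frame:
  assumes p: "p \<in> U" and sr: "sub_riemannian_structure G \<pi> D h"
  obtains r c X1 X2 where "r > 0" "cball (\<kappa> p) r \<subseteq> \<kappa> ` U" "c > 0"
    "continuous_on (cball (\<kappa> p) r) X1" "continuous_on (cball (\<kappa> p) r) X2"
    "\<And>x. x \<in> cball (\<kappa> p) r \<Longrightarrow> \<exists>Y\<in>D (\<psi> x). X1 x = frame_matrix G \<kappa> (\<psi> x) *v Y"
    "\<And>x. x \<in> cball (\<kappa> p) r \<Longrightarrow> \<exists>Y\<in>D (\<psi> x). X2 x = frame_matrix G \<kappa> (\<psi> x) *v Y"
    "\<And>x w. x \<in> cball (\<kappa> p) r \<Longrightarrow> w \<in> D (\<psi> x) \<Longrightarrow>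
      \<exists>a b. frame_matrix G \<kappa> (\<psi> x) *v w = a *\<^sub>R X1 x + b *\<^sub>R X2 x \<and> \<bar>a\<bar> + \<bar>b\<bar> \<le> c * sqrt (h (\<psi> x) w w)"
proof -
  obtain V Y Z where V: "p \<in> V" "smooth_field G V Y" "smooth_field G V Z" and D: "\<And>q. q \<in> V \<Longrightarrow> D q = span {Y q, Z q}"
    and E: "smooth_fun G V (\<lambda>q. h q (Y q) (Y q))" "smooth_fun G V (\<lambda>q. h q (Y q) (Z q))" "smooth_fun G V (\<lambda>q. h q (Z q) (Z q))"
    and dim: "\<And>q. q \<in> V \<Longrightarrow> dim (span {Y q, Z q}) = 2" and ip: "\<And>q. q \<in> V \<Longrightarrow> inner_product_on (span {Y q, Z q}) (h q)"
    using sub_riemannian_frame[OF sr, of p] by blast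
  have cont: "continuous_on (\<kappa> ` (V \<inter> U)) (\<lambda>x. f (\<psi> x))" if f: "smooth_fun G V f" for f
  proof -
    have "C_k 0 (\<kappa> ` (V \<inter> U)) (f \<circ> \<psi>)" using smooth_fun_chart(1)[OF f] unfolding C_infinity_def by blast
    then show ?thesis by (simp add: o_def)
  qed
  have "open (\<kappa> ` (V \<inter> U))" by (rule smooth_fun_chart(2)[OF E(1)])
  moreover have "\<kappa> p \<in> \<kappa> ` (V \<inter> U)" using V(1) p by blast
  ultimately obtain r where r: "r > 0" "cball (\<kappa> p) r \<subseteq> \<kappa> ` (V \<inter> U)" by (meson open_contains_cball)
  let ?B = "cball (\<kappa> p) r"
  have rU: "?B \<subseteq> \<kappa> ` U" using r(2) by blast
  have inV: "\<psi> x \<in> V" if xB: "x \<in> ?B" for x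
  proof -
    have "x \<in> \<kappa> ` (V \<inter> U)" using r(2) xB by (rule subsetD)
    then obtain q where "q \<in> V \<inter> U" "x = \<kappa> q" by blast
    then show ?thesis by simp
  qed
  define X1 where "X1 x = frame_matrix G \<kappa> (\<psi> x) *v Y (\<psi> x)" for x
  define X2 where "X2 x = frame_matrix G \<kappa> (\<psi> x) *v Z (\<psi> x)" for x
  have Jc: "continuous_on ?B (\<lambda>x. frame_matrix G \<kappa> (\<psi> x) $ i $ j)" for i j
    by (rule continuous_on_subset[OF frame_matrix_continuous rU])
  have Fc: "continuous_on ?B (\<lambda>x. W (\<psi> x) $ k)" if "smooth_field G V W" for W k
    using continuous_on_subset[OF cont[OF that[unfolded smooth_field_def, rule_format, of k]] r(2)] .
  have Xc: "continuous_on ?B X1" "continuous_on ?B X2"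
    unfolding X1_def X2_def matrix_vector_mult_def sum_3
    by (intro continuous_on_vec_lambda continuous_on_add continuous_on_mult Jc Fc V)+
  \<comment> \<open>Determinant over trace bounds the smallest eigenvalue of the Gram matrix from below.\<close>
  define m where "m x = (h (\<psi> x) (Y (\<psi> x)) (Y (\<psi> x)) * h (\<psi> x) (Z (\<psi> x)) (Z (\<psi> x)) - (h (\<psi> x) (Y (\<psi> x)) (Z (\<psi> x)))\<^sup>2)
      / (h (\<psi> x) (Y (\<psi> x)) (Y (\<psi> x)) + h (\<psi> x) (Z (\<psi> x)) (Z (\<psi> x)))" for x
  have pf: "0 < h q (Y q) (Y q) + h q (Z q) (Z q)" "0 < h q (Y q) (Y q) * h q (Z q) (Z q) - (h q (Y q) (Z q))\<^sup>2" if "q \<in> V" for q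
    using plane_form(3,4)[OF dim[OF that] ip[OF that]] by simp_all
  have mpos: "0 < m x" if "x \<in> ?B" for x unfolding m_def using pf[OF inV[OF that]] by (intro divide_pos_pos)
  have nz: "h (\<psi> x) (Y (\<psi> x)) (Y (\<psi> x)) + h (\<psi> x) (Z (\<psi> x)) (Z (\<psi> x)) \<noteq> 0" if "x \<in> ?B" for x
    using pf(1)[OF inV[OF that]] by simp
  have mc: "continuous_on ?B m"
    unfolding m_def
    by (intro continuous_on_divide continuous_on_add continuous_on_diff continuous_on_mult continuous_on_power
       continuous_on_subset[OF cont[OF E(1)] r(2)] continuous_on_subset[OF cont[OF E(2)] r(2)] continuous_on_subset[OF cont[OF E(3)] r(2)] ballI nz)
  have "?B \<noteq> {}" using r(1) by simp
  then obtain x0 where x0: "x0 \<in> ?B" "\<And>x. x \<in> ?B \<Longrightarrow> m x0 \<le> m x"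
    using continuous_attains_inf[OF compact_cball _ mc] by blast
  have m0: "0 < m x0" by (rule mpos[OF x0(1)])
  show ?thesis
  proof (rule that[OF r(1) rU _ Xc])
    show "0 < sqrt (2 / m x0)" using m0 by simp
    show "\<exists>Y\<in>D (\<psi> x). X1 x = frame_matrix G \<kappa> (\<psi> x) *v Y" if "x \<in> ?B" for x
      using D[OF inV[OF that]] unfolding X1_def by (intro bexI[of _ "Y (\<psi> x)"]) (simp_all add: span_base)
    show "\<exists>Y\<in>D (\<psi> x). X2 x = frame_matrix G \<kappa> (\<psi> x) *v Y" if "x \<in> ?B" for x
      using D[OF inV[OF that]] unfolding X2_def by (intro bexI[of _ "Z (\<psi> x)"]) (simp_all add: span_base)
    fix x w assume x: "x \<in> ?B" and w: "w \<in> D (\<psi> x)"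
    let ?q = "\<psi> x"
    define a where "a = plane_coordinate (Y ?q) (Z ?q) \<bullet> w"
    define b where "b = plane_coordinate (Z ?q) (Y ?q) \<bullet> w"
    have wV: "w \<in> span {Y ?q, Z ?q}" using w D[OF inV[OF x]] by simp
    note pl = plane_form(1,2)[OF dim[OF inV[OF x]] ip[OF inV[OF x]] wV]
    have "frame_matrix G \<kappa> ?q *v w = a *\<^sub>R X1 x + b *\<^sub>R X2 x"
      unfolding X1_def X2_def a_def b_def
      by (subst pl(1)) (simp add: matrix_vector_right_distrib matrix_vector_mult_scaleR)
    moreover have "\<bar>a\<bar> + \<bar>b\<bar> \<le> sqrt (2 / m x0) * sqrt (h ?q w w)"
    proof -
      have "m x0 * (a\<^sup>2 + b\<^sup>2) \<le> m x * (a\<^sup>2 + b\<^sup>2)" by (intro mult_right_mono x0(2)[OF x]) simp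
      also have "\<dots> \<le> h ?q w w"
        unfolding pl(2) m_def a_def[symmetric] b_def[symmetric]
        by (rule quadratic_form_lower_bound[OF pf[OF inV[OF x]]])
      finally have 1: "a\<^sup>2 + b\<^sup>2 \<le> h ?q w w / m x0" using m0 by (simp add: pos_le_divide_eq mult.commute)
      have "(\<bar>a\<bar> + \<bar>b\<bar>)\<^sup>2 \<le> 2 * (a\<^sup>2 + b\<^sup>2)"
        using zero_le_power2[of "\<bar>a\<bar> - \<bar>b\<bar>"] by (simp add: power2_sum power2_diff)
      also have "\<dots> \<le> 2 / m x0 * h ?q w w" using 1 by simp
      finally have "sqrt ((\<bar>a\<bar> + \<bar>b\<bar>)\<^sup>2) \<le> sqrt (2 / m x0 * h ?q w w)" by (rule real_sqrt_le_mono)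
      then show ?thesis by (simp only: real_sqrt_abs real_sqrt_mult)
    qed
    ultimately show "\<exists>a b. frame_matrix G \<kappa> (\<psi> x) *v w = a *\<^sub>R X1 x + b *\<^sub>R X2 x \<and> \<bar>a\<bar> + \<bar>b\<bar> \<le> sqrt (2 / m x0) * sqrt (h (\<psi> x) w w)"
      by blast
  qed
qed

text \<open>
  A covector that vanishes on the distribution at \<open>p\<close> is small on it nearby. This smallness is what
  separates a sub-Riemannian from a Riemannian distance.
\<close>
lemma sub_riemannian_velocity_bounds:
  assumes p: "p \<in> U" and sr: "sub_riemannian_structure G \<pi> D h"
  obtains r C where "r > 0" "C \<ge> 0" "cball (\<kappa> p) r \<subseteq> \<kappa> ` U" "velocity_bound D h (\<kappa> p) r norm C"
    "\<And>\<nu> \<eta>. (\<And>w. w \<in> D p \<Longrightarrow> \<nu> \<bullet> (frame_matrix G \<kappa> p *v w) = 0) \<Longrightarrow> \<eta> > 0 \<Longrightarrow>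
       \<exists>r'>0. r' \<le> r \<and> velocity_bound D h (\<kappa> p) r' (\<lambda>x. \<bar>\<nu> \<bullet> x\<bar>) \<eta>"
proof -
  obtain r c X1 X2 where r: "r > 0" "cball (\<kappa> p) r \<subseteq> \<kappa> ` U" "c > 0"
    and Xc: "continuous_on (cball (\<kappa> p) r) X1" "continuous_on (cball (\<kappa> p) r) X2"
    and XD: "\<And>x. x \<in> cball (\<kappa> p) r \<Longrightarrow> \<exists>Y\<in>D (\<psi> x). X1 x = frame_matrix G \<kappa> (\<psi> x) *v Y"
    "\<And>x. x \<in> cball (\<kappa> p) r \<Longrightarrow> \<exists>Y\<in>D (\<psi> x). X2 x = frame_matrix G \<kappa> (\<psi> x) *v Y"
    and X: "\<And>x w. x \<in> cball (\<kappa> p) r \<Longrightarrow> w \<in> D (\<psi> x) \<Longrightarrow>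
      \<exists>a b. frame_matrix G \<kappa> (\<psi> x) *v w = a *\<^sub>R X1 x + b *\<^sub>R X2 x \<and> \<bar>a\<bar> + \<bar>b\<bar> \<le> c * sqrt (h (\<psi> x) w w)"
    using sub_riemannian_velocity_frame[OF p sr] by blast
  have gen: "velocity_bound D h (\<kappa> p) r' \<phi> (B * c)"
    if r': "r' \<le> r" and B: "0 \<le> B" "\<And>x. x \<in> cball (\<kappa> p) r' \<Longrightarrow> \<phi> (X1 x) \<le> B \<and> \<phi> (X2 x) \<le> B"
      and \<phi>: "\<And>a b x y. \<phi> (a *\<^sub>R x + b *\<^sub>R y) \<le> \<bar>a\<bar> * \<phi> x + \<bar>b\<bar> * \<phi> y" for r' B \<phi>
    unfolding velocity_bound_def
  proof (intro ballI)
    fix x w assume x: "x \<in> cball (\<kappa> p) r'" and w: "w \<in> D (\<psi> x)"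
    have xr: "x \<in> cball (\<kappa> p) r" using x r' by simp
    obtain a b where ab: "frame_matrix G \<kappa> (\<psi> x) *v w = a *\<^sub>R X1 x + b *\<^sub>R X2 x" "\<bar>a\<bar> + \<bar>b\<bar> \<le> c * sqrt (h (\<psi> x) w w)"
      using X[OF xr w] by blast
    have "\<phi> (a *\<^sub>R X1 x + b *\<^sub>R X2 x) \<le> \<bar>a\<bar> * \<phi> (X1 x) + \<bar>b\<bar> * \<phi> (X2 x)" by (rule \<phi>)
    also have "\<dots> \<le> \<bar>a\<bar> * B + \<bar>b\<bar> * B" using B(2)[OF x] by (intro add_mono mult_left_mono) auto
    also have "\<dots> = B * (\<bar>a\<bar> + \<bar>b\<bar>)" by (simp add: algebra_simps)
    also have "\<dots> \<le> B * (c * sqrt (h (\<psi> x) w w))" by (intro mult_left_mono ab B)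
    finally show "\<phi> (frame_matrix G \<kappa> (\<psi> x) *v w) \<le> B * c * sqrt (h (\<psi> x) w w)" unfolding ab(1) by (simp add: mult.assoc)
  qed
  have "bounded (X1 ` cball (\<kappa> p) r)" "bounded (X2 ` cball (\<kappa> p) r)"
    by (intro compact_imp_bounded compact_continuous_image Xc compact_cball)+
  then obtain B1 B2 where B: "\<And>x. x \<in> cball (\<kappa> p) r \<Longrightarrow> norm (X1 x) \<le> B1" "\<And>x. x \<in> cball (\<kappa> p) r \<Longrightarrow> norm (X2 x) \<le> B2"
    unfolding bounded_iff by blast
  define B where "B = max 0 (max B1 B2)"
  have vb: "velocity_bound D h (\<kappa> p) r norm (B * c)"
  proof (rule gen[OF order_refl])
    show "norm (a *\<^sub>R x + b *\<^sub>R y) \<le> \<bar>a\<bar> * norm x + \<bar>b\<bar> * norm y" for a b and x y :: "real^3"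
      by (rule norm_triangle_le) simp
    show "norm (X1 x) \<le> B \<and> norm (X2 x) \<le> B" if "x \<in> cball (\<kappa> p) r" for x
      using B[OF that] by (simp add: B_def le_max_iff_disj)
  qed (simp add: B_def)
  have B0: "0 \<le> B" unfolding B_def by simp
  have BC: "B * c \<ge> 0" using B0 r(3) by simp
  show ?thesis
  proof (rule that[OF r(1) BC r(2) vb])
    fix \<nu> \<eta> assume \<nu>: "\<And>w. w \<in> D p \<Longrightarrow> \<nu> \<bullet> (frame_matrix G \<kappa> p *v w) = 0" and \<eta>: "(\<eta>::real) > 0"
    have pB: "\<kappa> p \<in> cball (\<kappa> p) r" using r(1) by simp
    have 0: "\<nu> \<bullet> X1 (\<kappa> p) = 0" "\<nu> \<bullet> X2 (\<kappa> p) = 0" using XD[OF pB] \<nu> p by auto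
    have ic: "isCont (\<lambda>x. \<nu> \<bullet> X1 x) (\<kappa> p)" "isCont (\<lambda>x. \<nu> \<bullet> X2 x) (\<kappa> p)"
    proof -
      have "continuous_on (ball (\<kappa> p) r) X1" "continuous_on (ball (\<kappa> p) r) X2"
        using Xc continuous_on_subset ball_subset_cball by blast+
      then have c: "isCont X1 (\<kappa> p)" "isCont X2 (\<kappa> p)"
        using r(1) by (simp_all add: continuous_on_eq_continuous_at)
      show "isCont (\<lambda>x. \<nu> \<bullet> X1 x) (\<kappa> p)" by (rule continuous_inner[OF continuous_const c(1)])
      show "isCont (\<lambda>x. \<nu> \<bullet> X2 x) (\<kappa> p)" by (rule continuous_inner[OF continuous_const c(2)])
    qed
    have \<eta>c: "0 < \<eta> / c" using \<eta> r(3) by simp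
    obtain d1 where d1: "d1 > 0" "\<And>x. dist x (\<kappa> p) < d1 \<Longrightarrow> \<bar>\<nu> \<bullet> X1 x\<bar> < \<eta> / c"
      using ic(1) \<eta>c 0 unfolding continuous_at_eps_delta by (auto simp: dist_real_def)
    obtain d2 where d2: "d2 > 0" "\<And>x. dist x (\<kappa> p) < d2 \<Longrightarrow> \<bar>\<nu> \<bullet> X2 x\<bar> < \<eta> / c"
      using ic(2) \<eta>c 0 unfolding continuous_at_eps_delta by (auto simp: dist_real_def)
    define r' where "r' = min r (min d1 d2 / 2)"
    have r': "r' > 0" "r' \<le> r" "r' < d1" "r' < d2" unfolding r'_def using r(1) d1(1) d2(1) by auto
    have "velocity_bound D h (\<kappa> p) r' (\<lambda>x. \<bar>\<nu> \<bullet> x\<bar>) (\<eta> / c * c)"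
    proof (rule gen[OF r'(2)])
      show "0 \<le> \<eta> / c" using \<eta>c by simp
      show "\<bar>\<nu> \<bullet> X1 x\<bar> \<le> \<eta> / c \<and> \<bar>\<nu> \<bullet> X2 x\<bar> \<le> \<eta> / c" if "x \<in> cball (\<kappa> p) r'" for x
        using d1(2)[of x] d2(2)[of x] that r' by (auto simp: dist_commute)
      show "\<bar>\<nu> \<bullet> (a *\<^sub>R x + b *\<^sub>R y)\<bar> \<le> \<bar>a\<bar> * \<bar>\<nu> \<bullet> x\<bar> + \<bar>b\<bar> * \<bar>\<nu> \<bullet> y\<bar>" for a b and x y :: "real^3"
        by (simp add: inner_add_right abs_mult[symmetric] abs_triangle_ineq)
    qed
    then show "\<exists>r'>0. r' \<le> r \<and> velocity_bound D h (\<kappa> p) r' (\<lambda>x. \<bar>\<nu> \<bullet> x\<bar>) \<eta>"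
      using r' r(3) by auto
  qed
qed

lemma riemannian_velocity_bound:
  assumes p: "p \<in> U" and A: "c > 0" "\<And>q v. c * (norm v)\<^sup>2 \<le> metric_ip g q v v"
  obtains r C where "r > 0" "C \<ge> 0" "cball (\<kappa> p) r \<subseteq> \<kappa> ` U" "velocity_bound (\<lambda>_. UNIV) (metric_ip g) (\<kappa> p) r norm C"
proof -
  obtain r where r: "r > 0" "cball (\<kappa> p) r \<subseteq> \<kappa> ` U"
    using chart_homeo(2) p by (meson imageI open_contains_cball)
  have Jc: "continuous_on (cball (\<kappa> p) r) (\<lambda>x. frame_matrix G \<kappa> (\<psi> x) $ i $ j)" for i j
    by (rule continuous_on_subset[OF frame_matrix_continuous r(2)])
  have "continuous_on (cball (\<kappa> p) r) (\<lambda>x. \<chi> i j. frame_matrix G \<kappa> (\<psi> x) $ i $ j)"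
    by (intro continuous_on_vec_lambda Jc)
  then have "continuous_on (cball (\<kappa> p) r) (\<lambda>x. frame_matrix G \<kappa> (\<psi> x))" by simp
  then have "bounded ((\<lambda>x. frame_matrix G \<kappa> (\<psi> x)) ` cball (\<kappa> p) r)"
    by (intro compact_imp_bounded compact_continuous_image compact_cball)
  then obtain B where B: "\<And>x. x \<in> cball (\<kappa> p) r \<Longrightarrow> norm (frame_matrix G \<kappa> (\<psi> x)) \<le> B" unfolding bounded_iff by blast
  have B0: "0 \<le> B" using B[of "\<kappa> p"] r(1) norm_ge_zero[of "frame_matrix G \<kappa> (\<psi> (\<kappa> p))"] by (meson centre_in_cball less_imp_le order_trans)
  have "velocity_bound (\<lambda>_. UNIV) (metric_ip g) (\<kappa> p) r norm (3 * B / sqrt c)"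
    unfolding velocity_bound_def
  proof (intro ballI)
    fix x and w :: "real^3" assume x: "x \<in> cball (\<kappa> p) r"
    have "sqrt c * norm w = sqrt (c * (norm w)\<^sup>2)" by (simp add: real_sqrt_mult)
    also have "\<dots> \<le> sqrt (metric_ip g (\<psi> x) w w)" by (intro real_sqrt_le_mono A)
    finally have w: "norm w \<le> sqrt (metric_ip g (\<psi> x) w w) / sqrt c" using A(1) by (simp add: pos_le_divide_eq mult.commute)
    have "norm (frame_matrix G \<kappa> (\<psi> x) *v w) \<le> 3 * norm (frame_matrix G \<kappa> (\<psi> x)) * norm w" by (rule norm_matrix_vector_le)
    also have "\<dots> \<le> 3 * B * (sqrt (metric_ip g (\<psi> x) w w) / sqrt c)"
      using B[OF x] B0 w by (intro mult_mono) auto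
    finally show "norm (frame_matrix G \<kappa> (\<psi> x) *v w) \<le> 3 * B / sqrt c * sqrt (metric_ip g (\<psi> x) w w)" by simp
  qed
  moreover have "3 * B / sqrt c \<ge> 0" using B0 A(1) by simp
  ultimately show ?thesis using that r by blast
qed

end

section \<open>Limits of uniformly equivalent metrics\<close>

lemma horizontal_curve_UNIV: "horizontal_curve G D \<gamma> v \<Longrightarrow> horizontal_curve G (\<lambda>_. UNIV) \<gamma> v"
  unfolding horizontal_curve_def by blast

lemma constant_metric_local_quadratic_form:
  "(\<And>q. g q = A) \<Longrightarrow> local_quadratic_form (\<lambda>_. UNIV) (metric_ip g)"
  unfolding local_quadratic_form_def metric_ip_def
  by (intro allI exI[of _ UNIV] exI[of _ "\<lambda>_. A"]) simp

lemma curve_length_nonneg: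
  assumes h: "local_quadratic_form D h" "\<And>q w. w \<in> D q \<Longrightarrow> 0 \<le> h q w w" and \<gamma>: "horizontal_curve G D \<gamma> v"
  shows "0 \<le> curve_length h \<gamma> v"
proof -
  obtain S where S: "finite S" "\<And>s. s \<in> {0..1} - S \<Longrightarrow> v s \<in> D (\<gamma> s)"
    using \<gamma> unfolding horizontal_curve_def by blast
  let ?f = "\<lambda>s. sqrt (h (\<gamma> s) (v s) (v s))"
  have fi: "?f integrable_on {0..1}" by (rule speed_integrable[OF h(1) \<gamma>])
  have e: "integral {0..1} ?f = integral {0..1} (\<lambda>s. if s \<in> S then 0 else ?f s)"
    by (rule integral_spike[of S]) (use S(1) in \<open>auto simp: negligible_finite\<close>)
  have i: "(\<lambda>s. if s \<in> S then 0 else ?f s) integrable_on {0..1}"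
    by (rule integrable_spike_finite[OF S(1) _ fi]) auto
  have "0 \<le> integral {0..1} (\<lambda>s. if s \<in> S then 0 else ?f s)"
  proof (rule integral_nonneg[OF i])
    show "0 \<le> (if s \<in> S then 0 else ?f s)" if "s \<in> {0..1}" for s
      using h(2)[OF S(2)[of s]] that by simp
  qed
  then show ?thesis unfolding curve_length_def e .
qed

lemma curve_length_mono:
  assumes g: "\<And>q. g q = A" "\<And>q. g' q = B" and le: "\<And>w. w \<bullet> (A *v w) \<le> a\<^sup>2 * (w \<bullet> (B *v w))" and a: "0 \<le> a"
    and \<gamma>: "horizontal_curve G (\<lambda>_. UNIV) \<gamma> v"
  shows "curve_length (metric_ip g) \<gamma> v \<le> a * curve_length (metric_ip g') \<gamma> v"
proof -
  have i: "(\<lambda>s. sqrt (metric_ip g (\<gamma> s) (v s) (v s))) integrable_on {0..1}"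
    "(\<lambda>s. sqrt (metric_ip g' (\<gamma> s) (v s) (v s))) integrable_on {0..1}"
    using speed_integrable[OF constant_metric_local_quadratic_form \<gamma>] g by blast+
  have "integral {0..1} (\<lambda>s. sqrt (metric_ip g (\<gamma> s) (v s) (v s)))
     \<le> integral {0..1} (\<lambda>s. a *\<^sub>R sqrt (metric_ip g' (\<gamma> s) (v s) (v s)))"
  proof (rule integral_le[OF i(1) integrable_cmul[OF i(2)]])
    fix s
    have "sqrt (metric_ip g (\<gamma> s) (v s) (v s)) \<le> sqrt (a\<^sup>2 * metric_ip g' (\<gamma> s) (v s) (v s))"
      unfolding metric_ip_def g by (intro real_sqrt_le_mono le)
    also have "\<dots> = a *\<^sub>R sqrt (metric_ip g' (\<gamma> s) (v s) (v s))" using a by (simp add: real_sqrt_mult)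
    finally show "sqrt (metric_ip g (\<gamma> s) (v s) (v s)) \<le> a *\<^sub>R sqrt (metric_ip g' (\<gamma> s) (v s) (v s))" .
  qed
  also have "\<dots> = a *\<^sub>R integral {0..1} (\<lambda>s. sqrt (metric_ip g' (\<gamma> s) (v s) (v s)))" by (rule integral_cmul)
  finally show ?thesis unfolding curve_length_def by simp
qed

text \<open>
  To first order \<open>x\<close> moves along its initial velocity, here up to an error of half its size.
\<close>
lemma vector_derivative_leaves:
  fixes x :: "real \<Rightarrow> real^3"
  assumes h: "0 < h" and x: "(x has_vector_derivative \<nu>) (at 0 within {0..h})" and \<nu>: "\<nu> \<noteq> 0"
  obtains s0 where "0 < s0" "s0 \<le> h" "\<And>s. 0 < s \<Longrightarrow> s \<le> s0 \<Longrightarrow> (norm \<nu>)\<^sup>2 / 2 * s \<le> \<nu> \<bullet> (x s - x 0)"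
proof -
  have n: "0 < norm \<nu> / 2" using \<nu> by simp
  have "\<exists>d>0. \<forall>y\<in>{0..h}. norm (y - 0) < d \<longrightarrow> norm (x y - x 0 - (y - 0) *\<^sub>R \<nu>) \<le> norm \<nu> / 2 * norm (y - 0)"
    using x n unfolding has_vector_derivative_def has_derivative_within_alt by blast
  then obtain d where d: "d > 0" "\<And>y. y \<in> {0..h} \<Longrightarrow> \<bar>y\<bar> < d \<Longrightarrow> norm (x y - x 0 - y *\<^sub>R \<nu>) \<le> norm \<nu> / 2 * \<bar>y\<bar>"
    by auto
  show ?thesis
  proof (rule that[of "min h (d / 2)"])
    fix s assume s: "0 < s" "s \<le> min h (d / 2)"
    have "norm (x s - x 0 - s *\<^sub>R \<nu>) \<le> norm \<nu> / 2 * s" using d(2)[of s] s d(1) by simp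
    then have "norm \<nu> * norm (x s - x 0 - s *\<^sub>R \<nu>) \<le> norm \<nu> * (norm \<nu> / 2 * s)" by (intro mult_left_mono) auto
    moreover have "\<bar>\<nu> \<bullet> (x s - x 0 - s *\<^sub>R \<nu>)\<bar> \<le> norm \<nu> * norm (x s - x 0 - s *\<^sub>R \<nu>)" by (rule Cauchy_Schwarz_ineq2)
    moreover have "\<nu> \<bullet> (x s - x 0 - s *\<^sub>R \<nu>) = \<nu> \<bullet> (x s - x 0) - s * (norm \<nu>)\<^sup>2"
      by (simp add: inner_diff_right power2_norm_eq_inner)
    moreover have "norm \<nu> * (norm \<nu> / 2 * s) = (norm \<nu>)\<^sup>2 / 2 * s" "s * (norm \<nu>)\<^sup>2 = 2 * ((norm \<nu>)\<^sup>2 / 2 * s)"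
      by (simp_all add: power2_eq_square)
    ultimately show "(norm \<nu>)\<^sup>2 / 2 * s \<le> \<nu> \<bullet> (x s - x 0)" by linarith
  qed (use h d in auto)
qed

context lie_chart
begin

lemma velocity_bound_mono: "velocity_bound D h x0 r \<phi> C \<Longrightarrow> r' \<le> r \<Longrightarrow> velocity_bound D h x0 r' \<phi> C"
  unfolding velocity_bound_def by auto

text \<open>
  A deck transformation moves the start of the curve to \<open>p\<close>. A curve that is too short to leave the
  ball ends at the only point of the ball over its endpoint.
\<close>
lemma length_lower_bound:
  fixes \<pi> :: "'g \<Rightarrow> 'm"
  assumes p: "p \<in> U" and r: "r > 0" "cball (\<kappa> p) r \<subseteq> \<kappa> ` U" and inj: "inj_on \<pi> (\<psi> ` cball (\<kappa> p) r)"
    and t2: "\<forall>K :: 'g set. compact K \<longrightarrow> closed K"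
    and trans: "\<forall>a b. \<pi> a = \<pi> b \<longrightarrow> (\<exists>\<delta>\<in>deck \<pi>. \<delta> a = b)"
    and D: "deck_invariant G \<pi> D h" "local_quadratic_form D h"
    and hpos: "\<forall>q. \<forall>w\<in>D q. 0 \<le> h q w w"
    and C: "0 \<le> C" "velocity_bound D h (\<kappa> p) r norm C"
    and y: "y \<in> cball (\<kappa> p) r"
    and \<gamma>: "horizontal_curve G D \<gamma> v" "\<pi> (\<gamma> 0) = \<pi> p" "\<pi> (\<gamma> 1) = \<pi> (\<psi> y)"
  shows "norm (y - \<kappa> p) \<le> C * curve_length h \<gamma> v"
    and "\<And>r' \<eta> \<nu>. velocity_bound D h (\<kappa> p) r' (\<lambda>x. \<bar>\<nu> \<bullet> x\<bar>) \<eta> \<Longrightarrow> C * curve_length h \<gamma> v < r' \<Longrightarrow> r' \<le> r \<Longrightarrow>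
       \<bar>\<nu> \<bullet> (y - \<kappa> p)\<bar> \<le> \<eta> * curve_length h \<gamma> v"
proof -
  obtain \<delta> where \<delta>: "\<delta> \<in> deck \<pi>" "\<delta> (\<gamma> 0) = p" using trans \<gamma>(2) by blast
  have disp1: "\<delta> (\<gamma> 1) \<in> \<psi> ` ball (\<kappa> p) r" if "C * curve_length h \<gamma> v < r"
    by (rule curve_displacement(1)[OF p r _ D _ C \<delta> \<gamma>(1) that]) (use t2 hpos in auto)
  have disp2: "norm (\<kappa> (\<delta> (\<gamma> 1)) - \<kappa> p) \<le> C * curve_length h \<gamma> v" if "C * curve_length h \<gamma> v < r"
    by (rule curve_displacement(2)[OF p r _ D _ C \<delta> \<gamma>(1) that]) (use t2 hpos in auto)
  have "\<pi> (\<delta> q) = \<pi> q" for q using \<delta>(1) unfolding deck_def by (auto simp: fun_eq_iff)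
  then have \<pi>y: "\<pi> (\<delta> (\<gamma> 1)) = \<pi> (\<psi> y)" using \<gamma>(3) by simp
  have yU: "y \<in> \<kappa> ` U" using y r(2) by blast
  have end_eq: "\<kappa> (\<delta> (\<gamma> 1)) = y" if L: "C * curve_length h \<gamma> v < r"
  proof -
    have "\<delta> (\<gamma> 1) \<in> \<psi> ` cball (\<kappa> p) r" using disp1[OF L] by auto
    moreover have "\<psi> y \<in> \<psi> ` cball (\<kappa> p) r" using y by blast
    ultimately have "\<delta> (\<gamma> 1) = \<psi> y" using inj \<pi>y by (meson inj_onD)
    then show ?thesis using yU by simp
  qed
  show "norm (y - \<kappa> p) \<le> C * curve_length h \<gamma> v"
  proof (cases "C * curve_length h \<gamma> v < r")
    case True
    then show ?thesis using disp2[OF True] end_eq by simp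
  next
    case False
    then show ?thesis using y by (simp add: dist_norm norm_minus_commute)
  qed
  show "\<bar>\<nu> \<bullet> (y - \<kappa> p)\<bar> \<le> \<eta> * curve_length h \<gamma> v"
    if "velocity_bound D h (\<kappa> p) r' (\<lambda>x. \<bar>\<nu> \<bullet> x\<bar>) \<eta>" "C * curve_length h \<gamma> v < r'" "r' \<le> r" for r' \<eta> \<nu>
  proof -
    have L: "C * curve_length h \<gamma> v < r" using that by simp
    have "\<bar>\<nu> \<bullet> (\<kappa> (\<delta> (\<gamma> 1)) - \<kappa> p)\<bar> \<le> \<eta> * curve_length h \<gamma> v"
      by (rule curve_displacement(3)[OF p r _ D _ C \<delta> \<gamma>(1) L that]) (use t2 hpos in auto)
    then show ?thesis using end_eq[OF L] by simp
  qed
qed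

text \<open>
  Integral curves of sections of \<open>D\<close> are horizontal and leave their starting point.
\<close>
lemma reachable_points:
  assumes p: "p \<in> U" and Y: "smooth_field G V Y" "p \<in> V" "\<And>q. q \<in> V \<Longrightarrow> Y q \<in> D q" "\<And>q. subspace (D q)"
    and \<nu>: "\<nu> = frame_matrix G \<kappa> p *v Y p" "\<nu> \<noteq> 0" and r: "r > 0"
  obtains s0 x where "s0 > 0" "x 0 = \<kappa> p"
    "\<And>s. 0 < s \<Longrightarrow> s \<le> s0 \<Longrightarrow> x s \<in> cball (\<kappa> p) r \<and> (norm \<nu>)\<^sup>2 / 2 * s \<le> \<nu> \<bullet> (x s - \<kappa> p) \<and>
       horizontal_curve G D (\<lambda>t. \<psi> (x (s * t))) (\<lambda>t. s *\<^sub>R Y (\<psi> (x (s * t))))"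
proof -
  have "open (\<kappa> ` (V \<inter> U))" using smooth_fun_chart(2) Y(1) unfolding smooth_field_def by blast
  moreover have "\<kappa> p \<in> \<kappa> ` (V \<inter> U)" using p Y(2) by blast
  ultimately obtain r' where r': "r' > 0" "cball (\<kappa> p) r' \<subseteq> \<kappa> ` (V \<inter> U)" by (meson open_contains_cball)
  have m: "min r r' > 0" using r r' by simp
  obtain h x where hx: "h > 0" "x 0 = \<kappa> p" and x: "\<And>t. t \<in> {0..h} \<Longrightarrow> x t \<in> cball (\<kappa> p) (min r r') \<and>
      (x has_vector_derivative frame_matrix G \<kappa> (\<psi> (x t)) *v Y (\<psi> (x t))) (at t within {0..h})"
    using integral_curve[OF p Y(1,2) m] by blast
  have x': "x t \<in> \<kappa> ` (U \<inter> V) \<and>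
      (x has_vector_derivative frame_matrix G \<kappa> (\<psi> (x t)) *v Y (\<psi> (x t))) (at t within {0..h})" if "t \<in> {0..h}" for t
  proof -
    have "x t \<in> cball (\<kappa> p) r'" using x[OF that] by simp
    then have "x t \<in> \<kappa> ` (V \<inter> U)" using r'(2) by blast
    then show ?thesis using x[OF that] by (simp add: Int_commute)
  qed
  have "(x has_vector_derivative \<nu>) (at 0 within {0..h})" using x[of 0] hx p by (simp add: \<nu>(1))
  from vector_derivative_leaves[OF hx(1) this \<nu>(2)] obtain s0 where s0: "0 < s0" "s0 \<le> h"
    "\<And>s. 0 < s \<Longrightarrow> s \<le> s0 \<Longrightarrow> (norm \<nu>)\<^sup>2 / 2 * s \<le> \<nu> \<bullet> (x s - x 0)" by blast
  show ?thesis
  proof (rule that[of s0 x, OF s0(1) hx(2)])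
    fix s assume s: "0 < s" "s \<le> s0"
    have "horizontal_curve G D (\<lambda>t. \<psi> (x (s * t))) (\<lambda>t. s *\<^sub>R Y (\<psi> (x (s * t))))"
      by (rule horizontal_integral_curve[OF x' Y(1) Y(3) Y(4) s(1)]) (use s s0 in auto)
    moreover have "x s \<in> cball (\<kappa> p) r" using x[of s] s s0 by simp
    ultimately show "x s \<in> cball (\<kappa> p) r \<and> (norm \<nu>)\<^sup>2 / 2 * s \<le> \<nu> \<bullet> (x s - \<kappa> p) \<and>
       horizontal_curve G D (\<lambda>t. \<psi> (x (s * t))) (\<lambda>t. s *\<^sub>R Y (\<psi> (x (s * t))))"
      using s0(3)[OF s] hx(2) by simp
  qed
qed

end

text \<open>
  Let \<open>\<rho>\<close> be the limit distance from \<open>p\<close>. Bounded scaling factors give \<open>\<rho> \<le> B s\<close> along an integral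
  curve transverse to \<open>D\<close>. Horizontal curves to these points would be longer than that, so no
  such curve exists and \<open>\<rho>\<close> has there the value of the infimum of the empty set. That value is at
  most \<open>B s\<close> for all small \<open>s\<close>, hence not positive. It is positive, however: some other point has a
  horizontal curve to it and therefore a positive limit distance, which keeps the scaling factors
  away from zero, and then all limit distances in the chart are positive.
\<close>
theorem no_sub_riemannian_limit:
  fixes G :: "'g::t2_space lie_group_data" and \<pi> :: "'g \<Rightarrow> 'm::t2_space"
  assumes G: "lie_group G" and sc: "simply_connected (UNIV :: 'g set)" and cov: "covering_space UNIV \<pi> (UNIV :: 'm set)"
    and sr: "sub_riemannian_structure G \<pi> D h"
    and g0: "quotient_metric G \<pi> g0" "\<And>q. g0 q = A0"
    and g: "\<And>t q. P t \<Longrightarrow> g t q = A t" and a: "a > 0"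
    and comp: "\<And>t w. P t \<Longrightarrow> w \<bullet> (A t *v w) \<le> a\<^sup>2 * (w \<bullet> (A0 *v w))" "\<And>t w. P t \<Longrightarrow> w \<bullet> (A0 *v w) \<le> a\<^sup>2 * (w \<bullet> (A t *v w))"
    and \<phi>: "\<And>t. P t \<Longrightarrow> 0 < \<phi> t" and freq: "\<exists>\<^sub>F t in F. P t"
    and lim: "\<And>x y. ((\<lambda>t. riemannian_distance G \<pi> (\<lambda>p. \<phi> t *\<^sub>R g t p) x y) \<longlongrightarrow> cc_distance G \<pi> D h x y) F"
  shows False
proof -
  have trans: "\<forall>u v. \<pi> u = \<pi> v \<longrightarrow> (\<exists>\<delta>\<in>deck \<pi>. \<delta> u = v)"
  proof (intro allI impI)
    fix u v assume uv: "\<pi> u = \<pi> v"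
    show "\<exists>\<delta>\<in>deck \<pi>. \<delta> u = v"
      by (rule deck_transitive[OF cov sc lie_group_locally_path_connected[OF G] uv]) blast+
  qed
  \<comment> \<open>Stated with object-level quantifiers to serve as premises of \<open>length_lower_bound\<close>.\<close>
  have t2: "\<forall>K :: 'g set. compact K \<longrightarrow> closed K" by (simp add: compact_imp_closed)
  define p where "p = \<one>\<^bsub>G\<^esub>"
  obtain U \<kappa> where c: "(U, \<kappa>) \<in> atlas G" "p \<in> U" using lie_group_chart_at[OF G] .
  interpret lie_chart G U \<kappa> by unfold_locales (use G c in auto)
  let ?J = "frame_matrix G \<kappa> p"
  have pd0: "positive_definite A0" using riemannian_metric_positive_definite[of G g0 p] g0 unfolding quotient_metric_def by simp
  have sub: "\<And>q. subspace (D q)" and dim2: "dim (D p) = 2" and ip: "\<And>q. inner_product_on (D q) (h q)"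
    using sr unfolding sub_riemannian_structure_def by simp_all
  have hpos: "0 \<le> h q w w" if w: "w \<in> D q" for q w
  proof (cases "w = 0")
    case True
    have "h q (0 + 1 *\<^sub>R 0) 0 = h q 0 0 + 1 * h q 0 0"
      using ip[of q] subspace_0[OF sub] unfolding inner_product_on_def by blast
    then show ?thesis using True by simp
  next
    case False
    then show ?thesis using ip[of q] w unfolding inner_product_on_def by (simp add: less_imp_le)
  qed
  have g0pos: "0 \<le> metric_ip g0 q w w" for q w
    using pd0 unfolding metric_ip_def g0(2) positive_definite_def by (cases "w = 0") (auto simp: less_imp_le)
  have g0pos': "\<forall>q. \<forall>w\<in>UNIV. 0 \<le> metric_ip g0 q w w" and hpos': "\<forall>q. \<forall>w\<in>D q. 0 \<le> h q w w"
    using g0pos hpos by blast+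
  have smd: "smooth_map G \<delta>" if "\<delta> \<in> deck \<pi>" for \<delta>
    using g0(1) that unfolding quotient_metric_def riemannian_isometry_def by blast
  have di0: "deck_invariant G \<pi> (\<lambda>_. UNIV) (metric_ip g0)"
    using g0(1) unfolding deck_invariant_def quotient_metric_def riemannian_isometry_def by blast
  have diD: "deck_invariant G \<pi> D h"
    unfolding deck_invariant_def
  proof (intro ballI conjI allI smd)
    fix \<delta> q assume "\<delta> \<in> deck \<pi>"
    then obtain B where "is_differential G \<delta> q B" "D (\<delta> q) = (\<lambda>v. B *v v) ` D q"
      "\<forall>v\<in>D q. \<forall>w\<in>D q. h (\<delta> q) (B *v v) (B *v w) = h q v w"
      using sr unfolding sub_riemannian_structure_def by meson
    then show "\<exists>A. is_differential G \<delta> q A \<and> (\<forall>w\<in>D q. A *v w \<in> D (\<delta> q) \<and> h (\<delta> q) (A *v w) (A *v w) = h q w w)"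
      by (intro exI[of _ B]) simp
  qed
  have lq0: "local_quadratic_form (\<lambda>_. UNIV) (metric_ip g0)" by (rule constant_metric_local_quadratic_form) (rule g0)
  have lqD: "local_quadratic_form D h" by (rule sub_riemannian_local_quadratic_form[OF G sr])
  obtain c0 where c0: "c0 > 0" "\<And>v. c0 * (norm v)\<^sup>2 \<le> v \<bullet> (A0 *v v)"
    using positive_definite_lower_bound[of "det A0" "norm A0"] positive_definite_inverse(4)[OF pd0] pd0
    by (metis less_irrefl order_refl)
  obtain r1 C1 where r1: "r1 > 0" "C1 \<ge> 0" "cball (\<kappa> p) r1 \<subseteq> \<kappa> ` U" "velocity_bound (\<lambda>_. UNIV) (metric_ip g0) (\<kappa> p) r1 norm C1"
    using riemannian_velocity_bound[OF c(2) c0(1), of g0] c0(2) unfolding metric_ip_def g0(2) by blast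
  obtain r2 C2 where r2: "r2 > 0" "C2 \<ge> 0" "cball (\<kappa> p) r2 \<subseteq> \<kappa> ` U" "velocity_bound D h (\<kappa> p) r2 norm C2"
    and r2': "\<And>\<nu> \<eta>. (\<And>w. w \<in> D p \<Longrightarrow> \<nu> \<bullet> (?J *v w) = 0) \<Longrightarrow> \<eta> > 0 \<Longrightarrow>
       \<exists>r'>0. r' \<le> r2 \<and> velocity_bound D h (\<kappa> p) r' (\<lambda>x. \<bar>\<nu> \<bullet> x\<bar>) \<eta>"
    using sub_riemannian_velocity_bounds[OF c(2) sr] by blast
  obtain W where W: "open W" "p \<in> W" "inj_on \<pi> W" using covering_locally_injective[OF cov] .
  have "open (\<kappa> ` (W \<inter> U))" using W chart_homeo(1) by (intro open_chart_image) auto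
  moreover have "\<kappa> p \<in> \<kappa> ` (W \<inter> U)" using W c(2) by blast
  ultimately obtain r3 where r3: "r3 > 0" "cball (\<kappa> p) r3 \<subseteq> \<kappa> ` (W \<inter> U)" by (meson open_contains_cball)
  define r where "r = min r1 (min r2 r3)"
  have r: "r > 0" "r \<le> r1" "r \<le> r2" "r \<le> r3" unfolding r_def using r1 r2 r3 by auto
  have rU: "cball (\<kappa> p) r \<subseteq> \<kappa> ` U" using r1(3) subset_cball[OF r(2), of "\<kappa> p"] by blast
  have inj: "inj_on \<pi> (\<psi> ` cball (\<kappa> p) r)"
  proof (rule inj_on_subset[OF W(3)], rule image_subsetI)
    fix x assume "x \<in> cball (\<kappa> p) r"
    then have "x \<in> \<kappa> ` (W \<inter> U)" using r3(2) subset_cball[OF r(4), of "\<kappa> p"] by blast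
    then obtain q where "q \<in> W \<inter> U" "x = \<kappa> q" by blast
    then show "\<psi> x \<in> W" by simp
  qed
  note low0 = length_lower_bound[OF c(2) r(1) rU inj t2 trans di0 lq0 g0pos' r1(2) velocity_bound_mono[OF r1(4) r(2)]]
  note lowD = length_lower_bound[OF c(2) r(1) rU inj t2 trans diD lqD hpos' r2(2) velocity_bound_mono[OF r2(4) r(3)]]
  define M where "M t y = riemannian_distance G \<pi> (\<lambda>p. \<phi> t *\<^sub>R g t p) (\<pi> p) (\<pi> (\<psi> y))" for t y
  define \<rho> where "\<rho> y = cc_distance G \<pi> D h (\<pi> p) (\<pi> (\<psi> y))" for y
  define H where "H D' y = {(\<gamma>, v). horizontal_curve G D' \<gamma> v \<and> \<pi> (\<gamma> 0) = \<pi> p \<and> \<pi> (\<gamma> 1) = \<pi> (\<psi> y)}" for D' y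
  have M_eq: "M t y = Inf ((\<lambda>(\<gamma>, v). curve_length (metric_ip (\<lambda>p. \<phi> t *\<^sub>R g t p)) \<gamma> v) ` H (\<lambda>_. UNIV) y)" for t y
    unfolding M_def riemannian_distance_def cc_distance_def H_def by (rule arg_cong[of _ _ Inf]) auto
  have \<rho>_eq: "\<rho> y = Inf ((\<lambda>(\<gamma>, v). curve_length h \<gamma> v) ` H D y)" for y
    unfolding \<rho>_def cc_distance_def H_def by (rule arg_cong[of _ _ Inf]) auto
  have lim': "((\<lambda>t. M t y) \<longlongrightarrow> \<rho> y) F" for y unfolding M_def \<rho>_def by (rule lim)
  \<comment> \<open>Comparison of the rescaled distances with lengths in \<open>g0\<close>: an upper bound by any curve, and a lower bound in the chart.\<close>
  have gt: "\<phi> t *\<^sub>R g t q = \<phi> t *\<^sub>R A t" if "P t" for t q using g[OF that] by simp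
  have Mup: "M t y \<le> sqrt (\<phi> t) * a * curve_length (metric_ip g0) \<gamma> v" if t: "P t" and \<gamma>: "(\<gamma>, v) \<in> H (\<lambda>_. UNIV) y" for t y \<gamma> v
  proof -
    have hc: "horizontal_curve G (\<lambda>_. UNIV) \<gamma> v" using \<gamma> unfolding H_def by blast
    have "M t y \<le> curve_length (metric_ip (\<lambda>p. \<phi> t *\<^sub>R g t p)) \<gamma> v"
      unfolding M_eq
    proof (rule cInf_lower)
      show "bdd_below ((\<lambda>(\<gamma>, v). curve_length (metric_ip (\<lambda>p. \<phi> t *\<^sub>R g t p)) \<gamma> v) ` H (\<lambda>_. UNIV) y)"
      proof (rule bdd_belowI[of _ 0], safe)
        fix \<gamma> v assume "(\<gamma>, v) \<in> H (\<lambda>_. UNIV) y"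
        then have hc: "horizontal_curve G (\<lambda>_. UNIV) \<gamma> v" unfolding H_def by blast
        have "0 \<le> w \<bullet> (A t *v w)" for w
          using comp(2)[OF t, of w] g0pos[of p w] a unfolding metric_ip_def g0(2)
          by (metis order_trans zero_le_mult_iff zero_less_power less_le_not_le)
        then have "0 \<le> metric_ip (\<lambda>p. \<phi> t *\<^sub>R g t p) q w w" for q w
          using \<phi>[OF t] by (simp add: metric_ip_def gt[OF t] scaleR_matrix_vector_assoc[symmetric])
        then show "0 \<le> curve_length (metric_ip (\<lambda>p. \<phi> t *\<^sub>R g t p)) \<gamma> v"
          by (intro curve_length_nonneg[OF constant_metric_local_quadratic_form[OF gt[OF t]] _ hc])
      qed
    qed (use \<gamma> in force)
    also have "\<dots> \<le> (sqrt (\<phi> t) * a) * curve_length (metric_ip g0) \<gamma> v"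
    proof (rule curve_length_mono[OF gt[OF t] g0(2) _ _ hc])
      show "w \<bullet> ((\<phi> t *\<^sub>R A t) *v w) \<le> (sqrt (\<phi> t) * a)\<^sup>2 * (w \<bullet> (A0 *v w))" for w
        using mult_left_mono[OF comp(1)[OF t, of w], of "\<phi> t"] \<phi>[OF t]
        by (simp add: scaleR_matrix_vector_assoc[symmetric] power_mult_distrib mult.assoc)
      show "0 \<le> sqrt (\<phi> t) * a" using a \<phi>[OF t] by simp
    qed
    finally show ?thesis .
  qed
  have Mlow: "norm (y - \<kappa> p) * sqrt (\<phi> t) \<le> (C1 * a) * M t y"
    if t: "P t" and y: "y \<in> cball (\<kappa> p) r" and ne: "H (\<lambda>_. UNIV) y \<noteq> {}" for t y
  proof -
    have b: "norm (y - \<kappa> p) * sqrt (\<phi> t) \<le> (C1 * a) * curve_length (metric_ip (\<lambda>p. \<phi> t *\<^sub>R g t p)) \<gamma> v"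
      if \<gamma>: "(\<gamma>, v) \<in> H (\<lambda>_. UNIV) y" for \<gamma> v
    proof -
      have hc: "horizontal_curve G (\<lambda>_. UNIV) \<gamma> v" "\<pi> (\<gamma> 0) = \<pi> p" "\<pi> (\<gamma> 1) = \<pi> (\<psi> y)" using \<gamma> unfolding H_def by auto
      have "curve_length (metric_ip g0) \<gamma> v \<le> (a / sqrt (\<phi> t)) * curve_length (metric_ip (\<lambda>p. \<phi> t *\<^sub>R g t p)) \<gamma> v"
      proof (rule curve_length_mono[OF g0(2) gt[OF t] _ _ hc(1)])
        show "w \<bullet> (A0 *v w) \<le> (a / sqrt (\<phi> t))\<^sup>2 * (w \<bullet> ((\<phi> t *\<^sub>R A t) *v w))" for w
          using comp(2)[OF t, of w] \<phi>[OF t]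
          by (simp add: scaleR_matrix_vector_assoc[symmetric] power_divide)
        show "0 \<le> a / sqrt (\<phi> t)" using a \<phi>[OF t] by simp
      qed
      then have "C1 * curve_length (metric_ip g0) \<gamma> v \<le> C1 * ((a / sqrt (\<phi> t)) * curve_length (metric_ip (\<lambda>p. \<phi> t *\<^sub>R g t p)) \<gamma> v)"
        by (rule mult_left_mono[OF _ r1(2)])
      then have "norm (y - \<kappa> p) \<le> C1 * ((a / sqrt (\<phi> t)) * curve_length (metric_ip (\<lambda>p. \<phi> t *\<^sub>R g t p)) \<gamma> v)"
        using low0(1)[OF y hc] by linarith
      then show ?thesis using \<phi>[OF t] by (simp add: field_simps)
    qed
    show ?thesis
    proof (cases "C1 * a = 0")
      case True
      obtain \<gamma> v where "(\<gamma>, v) \<in> H (\<lambda>_. UNIV) y" using ne by auto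
      from b[OF this] show ?thesis unfolding True by simp
    next
      case False
      then have pos: "0 < C1 * a" using r1(2) a by (simp add: less_le)
      have "norm (y - \<kappa> p) * sqrt (\<phi> t) / (C1 * a) \<le> M t y"
        unfolding M_eq
      proof (rule cInf_greatest)
        show "(\<lambda>(\<gamma>, v). curve_length (metric_ip (\<lambda>p. \<phi> t *\<^sub>R g t p)) \<gamma> v) ` H (\<lambda>_. UNIV) y \<noteq> {}" using ne by simp
        fix l assume "l \<in> (\<lambda>(\<gamma>, v). curve_length (metric_ip (\<lambda>p. \<phi> t *\<^sub>R g t p)) \<gamma> v) ` H (\<lambda>_. UNIV) y"
        then obtain \<gamma> v where \<gamma>: "(\<gamma>, v) \<in> H (\<lambda>_. UNIV) y" "l = curve_length (metric_ip (\<lambda>p. \<phi> t *\<^sub>R g t p)) \<gamma> v" by auto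
        show "norm (y - \<kappa> p) * sqrt (\<phi> t) / (C1 * a) \<le> l"
          unfolding \<gamma>(2) using b[OF \<gamma>(1)] pos by (simp add: pos_divide_le_eq mult.commute)
      qed
      then show ?thesis using pos by (simp add: pos_divide_le_eq mult.commute)
    qed
  qed
  have Mpos: "0 \<le> C1 * a" using r1(2) a by simp
  have Jinv: "invertible ?J" using frame_matrix_det_nonzero[OF c(2)] by (simp add: invertible_det_nz)
  \<comment> \<open>A covector \<open>\<nu>\<close> annihilating the distribution at \<open>p\<close>, and the left-invariant field with velocity \<open>\<nu>\<close> at \<open>p\<close>.\<close>
  have "dim ((*v) ?J ` D p) \<le> 2" using dim_image_le[OF matrix_vector_mul_linear, of ?J "D p"] dim2 by simp
  then have "dim ((*v) ?J ` D p) < DIM(real^3)" by simp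
  from orthogonal_to_subspace_exists[OF this]
  obtain \<nu> where \<nu>0: "\<nu> \<noteq> 0" "\<And>y. y \<in> span ((*v) ?J ` D p) \<Longrightarrow> orthogonal \<nu> y" by metis
  have \<nu>: "\<nu> \<noteq> 0" "\<And>w. w \<in> D p \<Longrightarrow> \<nu> \<bullet> (?J *v w) = 0"
    using \<nu>0(1) \<nu>0(2)[unfolded orthogonal_def, OF span_base, OF imageI] by simp_all
  obtain J' where "?J ** J' = mat 1" using Jinv unfolding invertible_def by blast
  define w0 where "w0 = J' *v \<nu>"
  have w0: "\<nu> = ?J *v w0" unfolding w0_def by (simp add: matrix_vector_mul_assoc \<open>?J ** J' = mat 1\<close>)
  have sw: "smooth_field G UNIV (\<lambda>_. w0)" unfolding smooth_field_def by (intro allI smooth_fun_const[OF G open_UNIV])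
  obtain s1 x where s1: "s1 > 0" "x 0 = \<kappa> p"
    and x: "\<And>s. 0 < s \<Longrightarrow> s \<le> s1 \<Longrightarrow> x s \<in> cball (\<kappa> p) r \<and> (norm \<nu>)\<^sup>2 / 2 * s \<le> \<nu> \<bullet> (x s - \<kappa> p) \<and>
       horizontal_curve G (\<lambda>_. UNIV) (\<lambda>t. \<psi> (x (s * t))) (\<lambda>t. s *\<^sub>R w0)"
    using reachable_points[OF c(2) sw UNIV_I UNIV_I subspace_UNIV w0 \<nu>(1) r(1)] by blast
  have n2: "0 < (norm \<nu>)\<^sup>2" using \<nu>(1) by simp
  have x_ne: "0 < norm (x s - \<kappa> p)" if s: "0 < s" "s \<le> s1" for s
  proof -
    have "0 < (norm \<nu>)\<^sup>2 / 2 * s" using n2 s by simp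
    then have "0 < \<nu> \<bullet> (x s - \<kappa> p)" using x[OF s] by linarith
    then show ?thesis by auto
  qed
  have xH: "(\<lambda>t. \<psi> (x (s * t)), \<lambda>t. s *\<^sub>R w0) \<in> H (\<lambda>_. UNIV) (x s)" if s: "0 < s" "s \<le> s1" for s
    unfolding H_def using x[OF s] s1(2) c(2) by simp
  define K where "K = sqrt (w0 \<bullet> (A0 *v w0))"
  have K0: "0 \<le> K" unfolding K_def using g0pos[of p w0] unfolding metric_ip_def g0(2) by simp
  have len: "curve_length (metric_ip g0) (\<lambda>t. \<psi> (x (s * t))) (\<lambda>t. s *\<^sub>R w0) = s * K" if "0 < s" for s
  proof -
    have "sqrt ((s *\<^sub>R w0) \<bullet> (A0 *v (s *\<^sub>R w0))) = s * K"
      using that by (simp add: K_def matrix_vector_mult_scaleR real_sqrt_mult mult.assoc[symmetric])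
    then show ?thesis unfolding curve_length_def metric_ip_def g0(2) by simp
  qed
  \<comment> \<open>The scaling factors are bounded, because the distance to the single point \<open>x s1\<close> converges.\<close>
  define N1 where "N1 = norm (x s1 - \<kappa> p)"
  have N1: "0 < N1" unfolding N1_def by (rule x_ne[OF s1(1) order_refl])
  define \<Phi> where "\<Phi> = (C1 * a) * (\<rho> (x s1) + 1) / N1"
  have ev1: "\<forall>\<^sub>F t in F. M t (x s1) < \<rho> (x s1) + 1" by (rule order_tendstoD(2)[OF lim']) simp
  have \<Phi>: "sqrt (\<phi> t) \<le> \<Phi>" if t: "P t" "M t (x s1) < \<rho> (x s1) + 1" for t
  proof -
    have "N1 * sqrt (\<phi> t) \<le> (C1 * a) * M t (x s1)"
      unfolding N1_def by (rule Mlow[OF t(1)]) (use x[OF s1(1) order_refl] xH[OF s1(1) order_refl] in auto)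
    also have "\<dots> \<le> (C1 * a) * (\<rho> (x s1) + 1)" using t(2) Mpos by (intro mult_left_mono) auto
    finally show ?thesis unfolding \<Phi>_def using N1 by (simp add: pos_le_divide_eq mult.commute)
  qed
  have freq1: "\<exists>\<^sub>F t in F. P t \<and> M t (x s1) < \<rho> (x s1) + 1" by (rule frequently_eventually_frequently[OF freq ev1])
  define B where "B = \<Phi> * a * K"
  have \<Phi>0: "0 \<le> \<Phi>"
  proof -
    obtain t where "P t" "M t (x s1) < \<rho> (x s1) + 1" using frequently_ex[OF freq1] by blast
    then show ?thesis using \<Phi>[of t] \<phi>[of t] by (meson order_trans real_sqrt_ge_zero less_imp_le)
  qed
  have B0: "0 \<le> B" unfolding B_def using \<Phi>0 a K0 by simp
  have \<rho>_up: "\<rho> (x s) \<le> B * s" if s: "0 < s" "s \<le> s1" for s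
  proof (rule ccontr)
    assume "\<not> \<rho> (x s) \<le> B * s"
    then have "\<forall>\<^sub>F t in F. B * s < M t (x s)" by (intro order_tendstoD(1)[OF lim']) simp
    from frequently_ex[OF frequently_eventually_frequently[OF freq1 this]]
    obtain t where t: "P t" "M t (x s1) < \<rho> (x s1) + 1" "B * s < M t (x s)" by blast
    have "M t (x s) \<le> sqrt (\<phi> t) * a * (s * K)" using Mup[OF t(1) xH[OF s]] len[OF s(1)] by simp
    also have "\<dots> \<le> \<Phi> * a * (s * K)" using \<Phi>[OF t(1,2)] a s K0 by (intro mult_right_mono) auto
    also have "\<dots> = B * s" by (simp add: B_def)
    finally show False using t(3) by simp
  qed
  \<comment> \<open>A horizontal curve to \<open>x s\<close> of length below \<open>(B + 1) s\<close> would move by at most \<open>\<eta> (B + 1) s\<close> in the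
    direction \<open>\<nu>\<close>, half of the displacement of \<open>x s\<close>. So for small \<open>s\<close> there is no horizontal curve at all.\<close>
  define \<eta> where "\<eta> = (norm \<nu>)\<^sup>2 / (4 * (B + 1))"
  have \<eta>: "0 < \<eta>" unfolding \<eta>_def using n2 B0 by simp
  obtain r' where r': "r' > 0" "velocity_bound D h (\<kappa> p) r' (\<lambda>x. \<bar>\<nu> \<bullet> x\<bar>) \<eta>"
    using r2'[OF \<nu>(2) \<eta>] by blast
  define r'' where "r'' = min r' r"
  have r'': "0 < r''" "r'' \<le> r'" "r'' \<le> r" unfolding r''_def using r' r(1) by auto
  note vb = velocity_bound_mono[OF r'(2) r''(2)]
  define s2 where "s2 = min s1 (r'' / (2 * (C2 + 1) * (B + 1)))"
  have s2: "0 < s2" "s2 \<le> s1" unfolding s2_def using s1(1) r''(1) r2(2) B0 by auto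
  have emptyH: "H D (x s) = {}" if s: "0 < s" "s \<le> s2" for s
  proof (rule ccontr)
    assume ne: "H D (x s) \<noteq> {}"
    have s': "s \<le> s1" using s s2 by simp
    have "\<rho> (x s) < (B + 1) * s" using \<rho>_up[OF s(1) s'] s(1) by (simp add: algebra_simps)
    then have "Inf ((\<lambda>(\<gamma>, v). curve_length h \<gamma> v) ` H D (x s)) < (B + 1) * s" unfolding \<rho>_eq .
    then obtain l where "l \<in> (\<lambda>(\<gamma>, v). curve_length h \<gamma> v) ` H D (x s)" "l < (B + 1) * s"
      using cInf_lessD[of "(\<lambda>(\<gamma>, v). curve_length h \<gamma> v) ` H D (x s)"] ne by blast
    then obtain \<gamma> v where \<gamma>: "(\<gamma>, v) \<in> H D (x s)" "curve_length h \<gamma> v < (B + 1) * s" by auto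
    have hc: "horizontal_curve G D \<gamma> v" "\<pi> (\<gamma> 0) = \<pi> p" "\<pi> (\<gamma> 1) = \<pi> (\<psi> (x s))" using \<gamma>(1) unfolding H_def by auto
    have "C2 * curve_length h \<gamma> v \<le> C2 * ((B + 1) * s)" using \<gamma>(2) r2(2) by (intro mult_left_mono) auto
    also have "\<dots> \<le> (C2 + 1) * ((B + 1) * s)" using B0 s by (intro mult_right_mono) auto
    also have "\<dots> \<le> (C2 + 1) * ((B + 1) * (r'' / (2 * (C2 + 1) * (B + 1))))"
      using s(2) r2(2) B0 unfolding s2_def by (intro mult_left_mono) auto
    also have "\<dots> = r'' / 2" using r2(2) B0 by (simp add: divide_simps) 
    also have "\<dots> < r''" using r''(1) by simp
    finally have L: "C2 * curve_length h \<gamma> v < r''" .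
    have "x s \<in> cball (\<kappa> p) r" using x[OF s(1) s'] by blast
    from lowD(2)[OF this hc vb L r''(3)]
    have "\<bar>\<nu> \<bullet> (x s - \<kappa> p)\<bar> \<le> \<eta> * curve_length h \<gamma> v" .
    also have "\<dots> \<le> \<eta> * ((B + 1) * s)" using \<gamma>(2) \<eta> by (intro mult_left_mono) auto
    also have "\<dots> = (norm \<nu>)\<^sup>2 / 4 * s" unfolding \<eta>_def using B0 by (simp add: divide_simps)
    finally have "(norm \<nu>)\<^sup>2 / 2 * s \<le> (norm \<nu>)\<^sup>2 / 4 * s" using x[OF s(1) s'] by linarith
    moreover have "0 < s * (norm \<nu>)\<^sup>2" using n2 s(1) by simp
    ultimately show False by simp
  qed
  define i0 :: real where "i0 = Inf {}"
  have \<rho>_i0: "\<rho> (x s) = i0" if "0 < s" "s \<le> s2" for s unfolding \<rho>_eq emptyH[OF that] i0_def by simp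
  \<comment> \<open>The limit distance is thus the value \<open>i0\<close> of the infimum of the empty set. A point \<open>z\<close> that is
    joined to \<open>p\<close> by a horizontal curve has positive limit distance; this bounds the scaling factors
    from below, whence \<open>i0 > 0\<close>, while \<open>i0 \<le> B s\<close> for all small \<open>s\<close>.\<close>
  obtain V Y Z where V: "p \<in> V" "smooth_field G V Y" "smooth_field G V Z"
    and DV: "\<And>q. q \<in> V \<Longrightarrow> D q = span {Y q, Z q}"
    and "smooth_fun G V (\<lambda>q. h q (Y q) (Y q))" "smooth_fun G V (\<lambda>q. h q (Y q) (Z q))" "smooth_fun G V (\<lambda>q. h q (Z q) (Z q))"
    and dimV: "\<And>q. q \<in> V \<Longrightarrow> dim (span {Y q, Z q}) = 2"
    and "\<And>q. q \<in> V \<Longrightarrow> inner_product_on (span {Y q, Z q}) (h q)"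
    using sub_riemannian_frame[OF sr, of p] by blast
  have YD: "Y q \<in> D q" if "q \<in> V" for q unfolding DV[OF that] by (simp add: span_base)
  have Yp: "Y p \<noteq> 0" using plane_gram_nonzero[OF dimV[OF V(1)]] by auto
  have JY: "?J *v Y p \<noteq> 0"
    using Yp Jinv by (metis invertible_left_inverse matrix_left_invertible_ker)
  obtain s3 x' where s3: "s3 > 0" "x' 0 = \<kappa> p"
    and x': "\<And>s. 0 < s \<Longrightarrow> s \<le> s3 \<Longrightarrow> x' s \<in> cball (\<kappa> p) r \<and> (norm (?J *v Y p))\<^sup>2 / 2 * s \<le> (?J *v Y p) \<bullet> (x' s - \<kappa> p) \<and>
       horizontal_curve G D (\<lambda>t. \<psi> (x' (s * t))) (\<lambda>t. s *\<^sub>R Y (\<psi> (x' (s * t))))"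
    using reachable_points[OF c(2) V(2,1) YD sub refl JY r(1)] by blast
  define z where "z = x' s3"
  have z: "z \<in> cball (\<kappa> p) r" using x'[OF s3(1) order_refl] unfolding z_def by blast
  have zpos: "0 < norm (z - \<kappa> p)"
  proof -
    have "0 < (norm (?J *v Y p))\<^sup>2 / 2 * s3" using JY s3 by simp
    then have "0 < (?J *v Y p) \<bullet> (z - \<kappa> p)" using x'[OF s3(1) order_refl] unfolding z_def by linarith
    then show ?thesis by auto
  qed
  define \<gamma>Y where "\<gamma>Y = (\<lambda>t. \<psi> (x' (s3 * t)))"
  define vY where "vY = (\<lambda>t. s3 *\<^sub>R Y (\<psi> (x' (s3 * t))))"
  have zH: "(\<gamma>Y, vY) \<in> H D z"
    unfolding H_def \<gamma>Y_def vY_def z_def using x'[OF s3(1) order_refl] s3(2) c(2) by simp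
  then have zH': "(\<gamma>Y, vY) \<in> H (\<lambda>_. UNIV) z" unfolding H_def using horizontal_curve_UNIV by blast
  define \<beta> where "\<beta> = norm (z - \<kappa> p) / (C2 + 1)"
  have \<beta>: "0 < \<beta>" unfolding \<beta>_def using zpos r2(2) by simp
  have "\<beta> \<le> \<rho> z"
    unfolding \<rho>_eq
  proof (rule cInf_greatest)
    show "(\<lambda>(\<gamma>, v). curve_length h \<gamma> v) ` H D z \<noteq> {}" using zH by blast
    fix l assume "l \<in> (\<lambda>(\<gamma>, v). curve_length h \<gamma> v) ` H D z"
    then obtain \<gamma> v where \<gamma>: "(\<gamma>, v) \<in> H D z" "l = curve_length h \<gamma> v" by auto
    have hc: "horizontal_curve G D \<gamma> v" "\<pi> (\<gamma> 0) = \<pi> p" "\<pi> (\<gamma> 1) = \<pi> (\<psi> z)" using \<gamma>(1) unfolding H_def by auto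
    have n: "norm (z - \<kappa> p) \<le> C2 * l" using lowD(1)[OF z hc] \<gamma>(2) by simp
    have "0 \<le> l" unfolding \<gamma>(2) by (rule curve_length_nonneg[OF lqD hpos hc(1)])
    then have "norm (z - \<kappa> p) \<le> (C2 + 1) * l" using n by (simp add: distrib_right)
    then show "\<beta> \<le> l" unfolding \<beta>_def using r2(2) by (simp add: pos_divide_le_eq mult.commute)
  qed
  then have ev2: "\<forall>\<^sub>F t in F. \<beta> / 2 < M t z" using \<beta> by (intro order_tendstoD(1)[OF lim']) simp
  define L' where "L' = curve_length (metric_ip g0) \<gamma>Y vY"
  define \<phi>0 where "\<phi>0 = \<beta> / 2 / (a * (\<bar>L'\<bar> + 1))"
  have \<phi>0: "0 < \<phi>0" unfolding \<phi>0_def using \<beta> a by (simp add: add_nonneg_pos)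
  have \<phi>_low: "\<phi>0 \<le> sqrt (\<phi> t)" if t: "P t" "\<beta> / 2 < M t z" for t
  proof -
    have "\<beta> / 2 \<le> sqrt (\<phi> t) * a * L'" using Mup[OF t(1) zH'] t(2) unfolding L'_def by linarith
    also have "\<dots> \<le> sqrt (\<phi> t) * a * (\<bar>L'\<bar> + 1)" using a \<phi>[OF t(1)] by (intro mult_left_mono) auto
    finally have le: "\<beta> / 2 \<le> sqrt (\<phi> t) * (a * (\<bar>L'\<bar> + 1))" by (simp only: mult.assoc)
    have "0 < a * (\<bar>L'\<bar> + 1)" using a by (simp add: add_nonneg_pos)
    then show ?thesis unfolding \<phi>0_def using le by (simp only: pos_divide_le_eq)
  qed
  have freq2: "\<exists>\<^sub>F t in F. P t \<and> \<beta> / 2 < M t z" by (rule frequently_eventually_frequently[OF freq ev2])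
  have i0pos: "0 < i0"
  proof (rule ccontr)
    define N2 where "N2 = norm (x s2 - \<kappa> p)"
    have N2: "0 < N2" unfolding N2_def by (rule x_ne[OF s2])
    assume "\<not> 0 < i0"
    then have "\<rho> (x s2) \<le> 0" using \<rho>_i0[OF s2(1) order_refl] by simp
    moreover have e: "0 < N2 * \<phi>0 / (C1 * a + 1)" using N2 \<phi>0 Mpos by simp
    ultimately have "\<forall>\<^sub>F t in F. M t (x s2) < N2 * \<phi>0 / (C1 * a + 1)" by (intro order_tendstoD(2)[OF lim']) simp
    from frequently_ex[OF frequently_eventually_frequently[OF freq2 this]]
    obtain t where t: "P t" "\<beta> / 2 < M t z" "M t (x s2) < N2 * \<phi>0 / (C1 * a + 1)" by blast
    have "N2 * \<phi>0 \<le> N2 * sqrt (\<phi> t)" using \<phi>_low[OF t(1,2)] N2 by (intro mult_left_mono) auto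
    also have "\<dots> \<le> (C1 * a) * M t (x s2)"
      unfolding N2_def by (rule Mlow[OF t(1)]) (use x[OF s2] xH[OF s2] in auto)
    also have "\<dots> \<le> (C1 * a) * (N2 * \<phi>0 / (C1 * a + 1))" using t(3) Mpos by (intro mult_left_mono) auto
    also have "\<dots> < (C1 * a + 1) * (N2 * \<phi>0 / (C1 * a + 1))" using e by (intro mult_strict_right_mono) auto
    also have "\<dots> = N2 * \<phi>0" using Mpos by simp
    finally show False by simp
  qed
  define s where "s = min s2 (i0 / (2 * (B + 1)))"
  have s: "0 < s" "s \<le> s2" unfolding s_def using s2(1) i0pos B0 by auto
  have "i0 \<le> B * s" using \<rho>_up[of s] \<rho>_i0[OF s] s s2 by simp
  also have "\<dots> \<le> (B + 1) * (i0 / (2 * (B + 1)))" using B0 s(1) unfolding s_def by (intro mult_mono) auto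
  also have "\<dots> = i0 / 2" using B0 by (simp add: divide_simps)
  finally show False using i0pos by simp
qed

section \<open>Vanishing of the first eigenvalue\<close>

lemma time_interval_eventually:
  assumes "0 < T"
  shows "\<forall>\<^sub>F t in time_tends_to T. t \<in> time_interval T"
proof -
  have "\<forall>\<^sub>F s in at_left T. 0 < s"
    unfolding eventually_at_filter
    by (rule eventually_mono[OF eventually_nhds_in_open[of "{0<..}" T]]) (use assms in auto)
  moreover have "\<forall>\<^sub>F s in at_left T. s < T" by (simp add: eventually_at_filter)
  ultimately have "\<forall>\<^sub>F s in at_left T. 0 < s \<and> s < T" by (rule eventually_conj)
  then have "\<forall>\<^sub>F t in time_tends_to T. 0 < ereal t \<and> ereal t < T"
    unfolding time_tends_to_def by (rule eventually_filtercomapI)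
  then show ?thesis by (rule eventually_mono) (simp add: time_interval_def)
qed

theorem theorem1:
  fixes G :: "'g::{t2_space, second_countable_topology} lie_group_data"
    and \<pi> :: "'g \<Rightarrow> 'm::t2_space"
    and T :: ereal
    and g :: "real \<Rightarrow> 'g metric"
    and a :: real
  assumes "bianchi_group G"
    and "compact (UNIV :: 'm set)"
    and "covering_space UNIV \<pi> (UNIV :: 'm set)"
    and "maximal_backward_ricci_flow G \<pi> T g"
    and "0 \<le> a"
    and "converges_to_sub_riemannian G \<pi> T g"
  shows "((\<lambda>t. max (first_eigenvalue G \<pi> (g t) a) 0) \<longlongrightarrow> 0) (time_tends_to T)"
proof -
  let ?F = "time_tends_to T"
  have G: "lie_group G" and sc: "simply_connected (UNIV :: 'g set)"
    using assms(1) unfolding bianchi_group_def by auto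
  have T: "0 < T" and flow: "backward_ricci_flow G \<pi> T g"
    using assms(4) unfolding maximal_backward_ricci_flow_def by auto
  have ev: "\<forall>\<^sub>F t in ?F. t \<in> time_interval T" by (rule time_interval_eventually[OF T])
  obtain N where N: "transpose N = N" "\<And>v w. bracket G v w = N *v cross3 v w"
    using bianchi_unimodular[OF assms(1)] by blast
  define p where "p = \<one>\<^bsub>G\<^esub>"
  define A where "A t = g t p" for t
  define R where "R t = (2 * minors2 (N ** A t) - (trace (N ** A t))\<^sup>2 / 2) / det (A t)" for t
  have qm: "quotient_metric G \<pi> (g t)" and gA: "\<And>q. g t q = A t" if "t \<in> time_interval T" for t
    using flow that unfolding backward_ricci_flow_def left_invariant_def A_def p_def by metis+
  have pd: "positive_definite (A t)" if t: "t \<in> time_interval T" for t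
    using riemannian_metric_positive_definite[of G "g t" p] qm[OF t] unfolding quotient_metric_def A_def by blast
  have R: "scalar_curvature G (g t) q = R t" if t: "t \<in> time_interval T" for t q
    unfolding R_def
    by (rule scalar_curvature_eq[OF gA[OF t] _ N(1) positive_definite_inverse(1)[OF pd[OF t]] N(2)])
      (use pd[OF t] in \<open>simp add: positive_definite_def\<close>)
  have eig: "first_eigenvalue G \<pi> (g t) a = a * R t" if t: "t \<in> time_interval T" for t
    by (rule first_eigenvalue_constant_scalar_curvature[OF G assms(2,3) _ R[OF t]])
      (use qm[OF t] in \<open>simp add: quotient_metric_def\<close>)
  have t0: "0 \<in> time_interval T" using T unfolding time_interval_def by (simp add: zero_ereal_def)
  define V where "V = det (A 0)"
  have V: "0 < V" unfolding V_def by (rule positive_definite_inverse(4)[OF pd[OF t0]])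
  have detV: "det (A t) = V" if t: "t \<in> time_interval T" for t
    unfolding V_def A_def by (rule backward_ricci_flow_det_constant[OF G assms(2,3) R flow t t0])
  have Rlim: "\<forall>\<^sub>F t in ?F. R t < \<epsilon>" if \<epsilon>: "0 < \<epsilon>" for \<epsilon>
  proof (rule ccontr)
    assume "\<not> (\<forall>\<^sub>F t in ?F. R t < \<epsilon>)"
    then have "\<exists>\<^sub>F t in ?F. \<epsilon> \<le> R t" by (simp add: frequently_def not_le)
    then have freq: "\<exists>\<^sub>F t in ?F. \<epsilon> \<le> R t \<and> t \<in> time_interval T"
      by (rule frequently_eventually_frequently[OF _ ev])
    obtain c C where c: "c > 0" "C > 0" and bound: "\<And>A v. positive_definite A \<Longrightarrow> det A = V \<Longrightarrow>
       \<epsilon> \<le> (2 * minors2 (N ** A) - (trace (N ** A))\<^sup>2 / 2) / det A \<Longrightarrow>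
       c * (norm v)\<^sup>2 \<le> v \<bullet> (A *v v) \<and> v \<bullet> (A *v v) \<le> C * (norm v)\<^sup>2"
      using positive_scalar_curvature_bounds[OF N(1) V \<epsilon>] by blast
    have b: "c * (norm v)\<^sup>2 \<le> v \<bullet> (A t *v v)" "v \<bullet> (A t *v v) \<le> C * (norm v)\<^sup>2"
      if "\<epsilon> \<le> R t \<and> t \<in> time_interval T" for t v
      using bound[of "A t" v] pd detV that unfolding R_def by auto
    obtain t1 where t1: "\<epsilon> \<le> R t1 \<and> t1 \<in> time_interval T" using frequently_ex[OF freq] by blast
    \<comment> \<open>Any two of the metrics at these times differ by at most the factor \<open>C / c\<close>.\<close>
    define k where "k = sqrt (C / c)"
    have k: "0 < k" "k\<^sup>2 = C / c" unfolding k_def using c by simp_all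
    have comp: "v \<bullet> (A t *v v) \<le> k\<^sup>2 * (v \<bullet> (A s *v v))"
      if t: "\<epsilon> \<le> R t \<and> t \<in> time_interval T" and s: "\<epsilon> \<le> R s \<and> s \<in> time_interval T" for s t v
    proof -
      have "C * (norm v)\<^sup>2 = k\<^sup>2 * (c * (norm v)\<^sup>2)" unfolding k(2) using c by simp
      also have "\<dots> \<le> k\<^sup>2 * (v \<bullet> (A s *v v))" by (intro mult_left_mono b s) simp
      finally show ?thesis using b(2)[OF t, of v] by simp
    qed
    obtain \<phi> D h where \<phi>: "\<forall>t\<in>time_interval T. 0 < \<phi> t" and sr: "sub_riemannian_structure G \<pi> D h"
      and ul: "uniform_limit UNIV (\<lambda>t (x, y). riemannian_distance G \<pi> (\<lambda>p. \<phi> t *\<^sub>R g t p) x y)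
          (\<lambda>(x, y). cc_distance G \<pi> D h x y) ?F"
      using assms(6) unfolding converges_to_sub_riemannian_def by blast
    have lim: "((\<lambda>t. riemannian_distance G \<pi> (\<lambda>p. \<phi> t *\<^sub>R g t p) x y) \<longlongrightarrow> cc_distance G \<pi> D h x y) ?F" for x y
      using tendsto_uniform_limitI[OF ul, of "(x, y)"] by simp
    show False
    proof (rule no_sub_riemannian_limit[OF G sc assms(3) sr, where P = "\<lambda>t. \<epsilon> \<le> R t \<and> t \<in> time_interval T"
          and ?g0.0 = "g t1" and ?A0.0 = "A t1" and A = A and a = k and g = g and \<phi> = \<phi> and F = "?F"])
      show "quotient_metric G \<pi> (g t1)" by (rule qm) (use t1 in simp)
      show "g t1 q = A t1" for q by (rule gA) (use t1 in simp)
      show "g t q = A t" if "\<epsilon> \<le> R t \<and> t \<in> time_interval T" for t q by (rule gA) (use that in simp)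
      show "w \<bullet> (A t *v w) \<le> k\<^sup>2 * (w \<bullet> (A t1 *v w))" if "\<epsilon> \<le> R t \<and> t \<in> time_interval T" for t w by (rule comp[OF that t1])
      show "w \<bullet> (A t1 *v w) \<le> k\<^sup>2 * (w \<bullet> (A t *v w))" if "\<epsilon> \<le> R t \<and> t \<in> time_interval T" for t w by (rule comp[OF t1 that])
      show "0 < \<phi> t" if "\<epsilon> \<le> R t \<and> t \<in> time_interval T" for t using \<phi> that by blast
    qed (use k(1) freq lim in auto)
  qed
  show ?thesis
  proof (rule tendstoI)
    fix e :: real assume e: "0 < e"
    have "0 < e / (a + 1)" using e assms(5) by simp
    from Rlim[OF this] ev show "\<forall>\<^sub>F t in ?F. dist (max (first_eigenvalue G \<pi> (g t) a) 0) 0 < e"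
    proof eventually_elim
      case (elim t)
      have "a * R t < e"
      proof (cases "R t \<le> 0")
        case True
        then have "a * R t \<le> 0" using assms(5) by (simp add: mult_nonneg_nonpos)
        then show ?thesis using e by simp
      next
        case False
        then have "a * R t \<le> (a + 1) * R t" by (intro mult_right_mono) auto
        also have "\<dots> < (a + 1) * (e / (a + 1))" using elim(1) assms(5) by (intro mult_strict_left_mono) auto
        also have "\<dots> = e" using assms(5) by simp
        finally show ?thesis .
      qed
      then show ?case using e by (simp add: eig[OF elim(2)] dist_real_def)
    qed
  qed
qed

end
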